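(* Multivariate Alexander quandles associated with multivariate Alexander modules are strictly stronger link invariants than standard Alexander quandles associated with reduced Alexander invariants or reduced Alexander modules.
   Context: A link $L=K_1\cup\dots\cup K_\mu$ is a union of finitely many pairwise disjoint, tame (piecewise smooth), oriented embedded circles in $\mathbb{S}^3$. A diagram $D$ of $L$ is obtained from a regular projection to the plane (finitely many singularities, all transverse double points called crossings) by removing two short segments of the underpassing arc at each crossing. $C(D)$ is the set of crossings; $A(D)$ is the set of connected components of $D$, called arcs; $\kappa:A(D)\to\{1,\dots,\mu\}$ is such that the arc $a$ is part of the image of $K_{\kappa(a)}$. At a crossing $c$, let $a_1$ be the overpassing arc, $a_2$ the underpassing arc on the right side of $a_1$ and $a_3$ the underpassing arc on the left side of $a_1$ (with respect to the orientation of $a_1$); so $\kappa(a_2)=\kappa(a_3)$. Let $\Lambda_\mu=\mathbb{Z}[t_1^{\pm1},\dots,t_\mu^{\pm1}]$. Let $\rho_D:\Lambda_\mu^{C(D)}\to\Lambda_\mu^{A(D)}$ be the $\Lambda_\mu$-linear map between free modules with $\rho_D(c)=(1-t_{\kappa(a_2)})a_1+t_{\kappa(a_1)}a_2-a_3$ at each crossing $c$. The (multivariate) Alexander module $M_A(L)$ is the cokernel of $\rho_D$, with quotient map $\gamma_D:\Lambda_\mu^{A(D)}\to M_A(L)$. Let $I_\mu$ be the ideal of $\Lambda_\mu$ generated by $t_1-1,\dots,t_\mu-1$, and let $\phi_L:M_A(L)\to I_\mu$ be the $\Lambda_\mu$-linear epimorphism with $\phi_L(\gamma_D(a))=t_{\kappa(a)}-1$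 for all $a\in A(D)$. A quandle is a set $Q$ with binary operations $\triangleright,\triangleright^{-1}$ such that for all $x,y,z$: (Q1) $x\triangleright x=x$; (Q2) $(x\triangleright y)\triangleright^{-1}y=x=(x\triangleright^{-1}y)\triangleright y$; (Q3) $(x\triangleright y)\triangleright z=(x\triangleright z)\triangleright(y\triangleright z)$. The multivariate Alexander quandles associated with $M_A(L)$ are the following two. The total multivariate Alexander quandle of $L$ is $U(L)=\{x\in M_A(L)\mid \phi_L(x)+1\text{ is a unit of }\Lambda_\mu\}$, a quandle with $x\triangleright y=(\phi_L(y)+1)x-\phi_L(x)y$ and $x\triangleright^{-1}y=(\phi_L(y)+1)^{-1}\cdot(x+\phi_L(x)y)$. The fundamental multivariate Alexander quandle $Q_A(L)$ is the minimal subquandle of $U(L)$ containing $\gamma_D(a)$ for all $a\in A(D)$. Let $\Lambda=\mathbb{Z}[t^{\pm1}]$ and let $I$ be the ideal of $\Lambda$ generated by $t-1$. The reduced Alexander module $M_A^{red}(L)$ is the $\Lambda$-module obtained by setting all $t_i=t$ in the definition of $M_A(L)$, with quotient map $\gamma_D^{red}:\Lambda^{A(D)}\to M_A^{red}(L)$; $\phi_L^{red}:M_A^{red}(L)\to I$ is the $\Lambda$-linear epimorphism with $\phi_L^{red}(\gamma_D^{red}(a))=t-1$ for all $a\in A(D)$. The reduced Alexander invariant of $L$ is $\ker\phi_L^{red}$. The standard Alexander quandle on a $\Lambda$-module $M$ is the quandle on the set $M$ with $x\triangleright y=tx+(1-t)y$ and $x\triangleright^{-1}y=t^{-1}\cdot(x+(t-1)y)$.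 One link invariant is strictly stronger than another if any two links that agree in the first (up to the relevant notion of equivalence) also agree in the second, while two links that agree in the second might not agree in the first.
   Formalization: Total quandles U(L) are taken to agree when some quandle isomorphism respects the maps φ_L up to re-indexing the components; with bare quandle isomorphism U(L) does not determine the standard quandles (2-braid closures of σ^1 and σ^3 with axis). *)

theory Defs
  imports
    "HOL-Analysis.Analysis"
    "HOL-Algebra.Module"
    "HOL-Algebra.AbelCoset"
    "HOL-Algebra.QuotRing"
    "HOL-Library.Poly_Mapping"
begin

section \<open>Links and their diagrams\<close>

text \<open>Space is \<^typ>\<open>complex \<times> real\<close>, i.e. the 3-sphere minus a point of the complement of the
  link; the plane of projection is \<^typ>\<open>complex\<close> and the second component is the height.\<close>

type_synonym space = "complex \<times> real"

definition smooth_regular_on :: "real set \<Rightarrow> (real \<Rightarrow> 'a::real_normed_vector) \<Rightarrow> bool" where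
  "smooth_regular_on S g \<longleftrightarrow>
     (\<exists>D. D (0::nat) = g \<and>
          (\<forall>k. \<forall>s\<in>S. (D k has_vector_derivative D (Suc k) s) (at s within S)) \<and>
          (\<forall>s\<in>S. D 1 s \<noteq> 0))"

text \<open>For curves of period 1.  Smoothness and non-vanishing of the velocity are required up to the
  end points of each piece; otherwise wild curves would be admitted.\<close>

definition piecewise_regular :: "(real \<Rightarrow> 'a::real_normed_vector) \<Rightarrow> bool" where
  "piecewise_regular g \<longleftrightarrow>
     (\<exists>(s::nat \<Rightarrow> real) n. 0 < n \<and> s n = s 0 + 1 \<and>
        (\<forall>k<n. s k < s (Suc k) \<and> smooth_regular_on {s k..s (Suc k)} g))"

text \<open>An oriented embedded circle is given by a parametrization with period 1 that follows the
  orientation.\<close>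

definition embedded_circle :: "(real \<Rightarrow> space) \<Rightarrow> bool" where
  "embedded_circle g \<longleftrightarrow>
     (\<forall>s. g (s + 1) = g s) \<and> inj_on g {0..<1} \<and> piecewise_regular g"

record link =
  ncomp :: nat
  strand :: "nat \<Rightarrow> real \<Rightarrow> space"

definition comp :: "link \<Rightarrow> nat \<Rightarrow> space set" where
  "comp L i = range (strand L i)"

definition link_set :: "link \<Rightarrow> space set" where
  "link_set L = (\<Union>i\<in>{1..ncomp L}. comp L i)"

definition is_link :: "link \<Rightarrow> bool" where
  "is_link L \<longleftrightarrow> 1 \<le> ncomp L \<and>
     (\<forall>i\<in>{1..ncomp L}. embedded_circle (strand L i)) \<and>
     (\<forall>i\<in>{1..ncomp L}. \<forall>j\<in>{1..ncomp L}. i \<noteq> j \<longrightarrow> comp L i \<inter> comp L j = {})"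

definition crossings :: "link \<Rightarrow> complex set" where
  "crossings L = {z. \<exists>x\<in>link_set L. \<exists>y\<in>link_set L. x \<noteq> y \<and> fst x = z \<and> fst y = z}"

text \<open>For planar vectors \<open>v\<close> and \<open>w\<close>, \<open>Im (cnj v * w)\<close> is their determinant; it is positive iff
  \<open>w\<close> points to the left of \<open>v\<close>.\<close>

definition regular_projection :: "link \<Rightarrow> bool" where
  "regular_projection L \<longleftrightarrow>
     (\<forall>i\<in>{1..ncomp L}. piecewise_regular (fst \<circ> strand L i)) \<and>
     finite (crossings L) \<and>
     (\<forall>z\<in>crossings L. \<exists>i\<in>{1..ncomp L}. \<exists>j\<in>{1..ncomp L}. \<exists>s u v w.
        {x \<in> link_set L. fst x = z} = {strand L i s, strand L j u} \<and>
        ((fst \<circ> strand L i) has_vector_derivative v) (at s) \<and>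
        ((fst \<circ> strand L j) has_vector_derivative w) (at u) \<and>
        Im (cnj v * w) \<noteq> 0)"

text \<open>A diagram is given by a link in regular position; every diagram of every link arises in this
  way from a representative of the link.\<close>

definition is_diagram :: "link \<Rightarrow> bool" where
  "is_diagram L \<longleftrightarrow> is_link L \<and> regular_projection L"

definition over_pt :: "link \<Rightarrow> complex \<Rightarrow> space" where
  "over_pt L z = (THE x. x \<in> link_set L \<and> fst x = z \<and>
                      (\<exists>y\<in>link_set L. fst y = z \<and> snd y < snd x))"

definition under_pt :: "link \<Rightarrow> complex \<Rightarrow> space" where
  "under_pt L z = (THE x. x \<in> link_set L \<and> fst x = z \<and>
                      (\<exists>y\<in>link_set L. fst y = z \<and> snd x < snd y))"

definition over_dir :: "link \<Rightarrow> complex \<Rightarrow> complex" where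
  "over_dir L z = (THE v. \<exists>i\<in>{1..ncomp L}. \<exists>s. strand L i s = over_pt L z \<and>
                      ((fst \<circ> strand L i) has_vector_derivative v) (at s))"

text \<open>The two short segments removed at a crossing together come from a small piece of the link
  around the underpassing point.  The arcs are represented by the components of the link cut at
  the underpassing points: shortening these at their ends and projecting gives the components of
  the drawn diagram, so that the set of arcs does not depend on the lengths of the gaps.\<close>

definition arcs :: "link \<Rightarrow> space set set" where
  "arcs L = components (link_set L - under_pt L ` crossings L)"

definition arc_comp :: "link \<Rightarrow> space set \<Rightarrow> nat" where
  "arc_comp L a = (THE i. i \<in> {1..ncomp L} \<and> a \<subseteq> comp L i)"

definition over_arc :: "link \<Rightarrow> complex \<Rightarrow> space set" where
  "over_arc L z = (THE a. a \<in> arcs L \<and> over_pt L z \<in> a)"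

definition right_arc :: "link \<Rightarrow> complex \<Rightarrow> space set" where
  "right_arc L z = (THE a. a \<in> arcs L \<and>
     under_pt L z \<in> closure {x \<in> a. Im (cnj (over_dir L z) * (fst x - z)) < 0})"

definition left_arc :: "link \<Rightarrow> complex \<Rightarrow> space set" where
  "left_arc L z = (THE a. a \<in> arcs L \<and>
     under_pt L z \<in> closure {x \<in> a. Im (cnj (over_dir L z) * (fst x - z)) > 0})"


section \<open>Laurent polynomials, free modules and quotient modules\<close>

text \<open>The monomial with exponents \<open>m\<close> is \<open>Poly_Mapping.single m 1\<close>.  The multiplication of
  \<^typ>\<open>(nat \<Rightarrow>\<^sub>0 int) \<Rightarrow>\<^sub>0 int\<close> is convolution, so this type is the group ring of the free abelian
  group on countably many generators.\<close>

type_synonym laurent = "(nat \<Rightarrow>\<^sub>0 int) \<Rightarrow>\<^sub>0 int"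

definition var :: "nat \<Rightarrow> laurent" where
  "var i = Poly_Mapping.single (Poly_Mapping.single i 1) 1"

definition laurent_ring :: "nat \<Rightarrow> laurent ring" where
  "laurent_ring n =
     \<lparr>carrier = {p. \<forall>m\<in>Poly_Mapping.keys p. Poly_Mapping.keys m \<subseteq> {1..n}},
      mult = (*), one = 1, zero = 0, add = (+)\<rparr>"

text \<open>Module records extend ring records; their fields \<open>mult\<close> and \<open>one\<close> play no role.\<close>

definition free_module :: "('r, 'k) ring_scheme \<Rightarrow> 'b set \<Rightarrow> ('r, 'b \<Rightarrow> 'r) module" where
  "free_module R B =
     \<lparr>carrier = B \<rightarrow>\<^sub>E carrier R, mult = undefined, one = undefined,
      zero = (\<lambda>b\<in>B. \<zero>\<^bsub>R\<^esub>), add = (\<lambda>f g. \<lambda>b\<in>B. f b \<oplus>\<^bsub>R\<^esub> g b),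
      smult = (\<lambda>r f. \<lambda>b\<in>B. r \<otimes>\<^bsub>R\<^esub> f b)\<rparr>"

definition basis_elt :: "('r, 'k) ring_scheme \<Rightarrow> 'b set \<Rightarrow> 'b \<Rightarrow> 'b \<Rightarrow> 'r" where
  "basis_elt R B x = (\<lambda>b\<in>B. if b = x then \<one>\<^bsub>R\<^esub> else \<zero>\<^bsub>R\<^esub>)"

definition quotient_module :: "('r, 'm, 'k) module_scheme \<Rightarrow> 'm set \<Rightarrow> ('r, 'm set) module" where
  "quotient_module M N =
     \<lparr>carrier = a_rcosets\<^bsub>M\<^esub> N, mult = undefined, one = undefined,
      zero = N, add = (\<lambda>X Y. X <+>\<^bsub>M\<^esub> Y),
      smult = (\<lambda>r X. \<Union>x\<in>X. N +>\<^bsub>M\<^esub> (r \<odot>\<^bsub>M\<^esub> x))\<rparr>"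


section \<open>Alexander modules\<close>

text \<open>The parameter \<open>\<tau>\<close> assigns to each component of the link a unit of \<open>laurent_ring n\<close>.  The
  multivariate module of a link with \<open>n\<close> components has \<open>\<tau> i = var i\<close>; in the reduced module
  \<open>n = 1\<close> and every \<open>\<tau> i\<close> is the single variable.\<close>

definition crossing_rel ::
  "nat \<Rightarrow> (nat \<Rightarrow> laurent) \<Rightarrow> link \<Rightarrow> complex \<Rightarrow> space set \<Rightarrow> laurent" where
  "crossing_rel n \<tau> L z =
    (let R = laurent_ring n; F = free_module R (arcs L); e = basis_elt R (arcs L);
         a1 = over_arc L z; a2 = right_arc L z; a3 = left_arc L z
     in ((\<one>\<^bsub>R\<^esub> \<ominus>\<^bsub>R\<^esub> \<tau> (arc_comp L a2)) \<odot>\<^bsub>F\<^esub> e a1) \<oplus>\<^bsub>F\<^esub> (\<tau> (arc_comp L a1) \<odot>\<^bsub>F\<^esub> e a2) \<ominus>\<^bsub>F\<^esub> e a3)"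

definition rho ::
  "nat \<Rightarrow> (nat \<Rightarrow> laurent) \<Rightarrow> link \<Rightarrow> (complex \<Rightarrow> laurent) \<Rightarrow> space set \<Rightarrow> laurent" where
  "rho n \<tau> L v =
    (let F = free_module (laurent_ring n) (arcs L)
     in finsum F (\<lambda>z. v z \<odot>\<^bsub>F\<^esub> crossing_rel n \<tau> L z) (crossings L))"

definition rho_image :: "nat \<Rightarrow> (nat \<Rightarrow> laurent) \<Rightarrow> link \<Rightarrow> (space set \<Rightarrow> laurent) set" where
  "rho_image n \<tau> L = rho n \<tau> L ` carrier (free_module (laurent_ring n) (crossings L))"

type_synonym alex = "(space set \<Rightarrow> laurent) set"

definition alex_module :: "nat \<Rightarrow> (nat \<Rightarrow> laurent) \<Rightarrow> link \<Rightarrow> (laurent, alex) module" where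
  "alex_module n \<tau> L =
     quotient_module (free_module (laurent_ring n) (arcs L)) (rho_image n \<tau> L)"

definition alex_gamma :: "nat \<Rightarrow> (nat \<Rightarrow> laurent) \<Rightarrow> link \<Rightarrow> (space set \<Rightarrow> laurent) \<Rightarrow> alex" where
  "alex_gamma n \<tau> L v = rho_image n \<tau> L +>\<^bsub>free_module (laurent_ring n) (arcs L)\<^esub> v"

text \<open>The linear map that sends the class of an arc \<open>a\<close> to \<open>\<tau> (arc_comp L a) - 1\<close>.\<close>

definition alex_phi :: "nat \<Rightarrow> (nat \<Rightarrow> laurent) \<Rightarrow> link \<Rightarrow> alex \<Rightarrow> laurent" where
  "alex_phi n \<tau> L X =
    (let R = laurent_ring n
     in THE r. \<forall>v\<in>X. r = finsum R (\<lambda>a. v a \<otimes>\<^bsub>R\<^esub> (\<tau> (arc_comp L a) \<ominus>\<^bsub>R\<^esub> \<one>\<^bsub>R\<^esub>)) (arcs L))"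

abbreviation lam :: "link \<Rightarrow> laurent ring" where
  "lam L \<equiv> laurent_ring (ncomp L)"

abbreviation M_A :: "link \<Rightarrow> (laurent, alex) module" where
  "M_A L \<equiv> alex_module (ncomp L) var L"

abbreviation gamma_D :: "link \<Rightarrow> (space set \<Rightarrow> laurent) \<Rightarrow> alex" where
  "gamma_D L \<equiv> alex_gamma (ncomp L) var L"

abbreviation phi_L :: "link \<Rightarrow> alex \<Rightarrow> laurent" where
  "phi_L L \<equiv> alex_phi (ncomp L) var L"

abbreviation M_A_red :: "link \<Rightarrow> (laurent, alex) module" where
  "M_A_red L \<equiv> alex_module 1 (\<lambda>_. var 1) L"

abbreviation phi_L_red :: "link \<Rightarrow> alex \<Rightarrow> laurent" where
  "phi_L_red L \<equiv> alex_phi 1 (\<lambda>_. var 1) L"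

definition alex_invariant_red :: "link \<Rightarrow> (laurent, alex) module" where
  "alex_invariant_red L =
     (M_A_red L)\<lparr>carrier := {x \<in> carrier (M_A_red L). phi_L_red L x = \<zero>\<^bsub>laurent_ring 1\<^esub>}\<rparr>"


section \<open>Quandles\<close>

record 'a quandle = "'a partial_object" +
  tri :: "'a \<Rightarrow> 'a \<Rightarrow> 'a"
  trinv :: "'a \<Rightarrow> 'a \<Rightarrow> 'a"

definition is_quandle :: "'a quandle \<Rightarrow> bool" where
  "is_quandle Q \<longleftrightarrow>
     (\<forall>x\<in>carrier Q. \<forall>y\<in>carrier Q. tri Q x y \<in> carrier Q \<and> trinv Q x y \<in> carrier Q) \<and>
     (\<forall>x\<in>carrier Q. tri Q x x = x) \<and>
     (\<forall>x\<in>carrier Q. \<forall>y\<in>carrier Q. trinv Q (tri Q x y) y = x \<and> tri Q (trinv Q x y) y = x) \<and>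
     (\<forall>x\<in>carrier Q. \<forall>y\<in>carrier Q. \<forall>z\<in>carrier Q.
        tri Q (tri Q x y) z = tri Q (tri Q x z) (tri Q y z))"

definition subquandle :: "'a set \<Rightarrow> 'a quandle \<Rightarrow> bool" where
  "subquandle S Q \<longleftrightarrow> S \<subseteq> carrier Q \<and> is_quandle (Q\<lparr>carrier := S\<rparr>)"

definition quandle_iso :: "'a quandle \<Rightarrow> 'b quandle \<Rightarrow> ('a \<Rightarrow> 'b) set" where
  "quandle_iso Q Q' =
     {f. bij_betw f (carrier Q) (carrier Q') \<and>
         (\<forall>x\<in>carrier Q. \<forall>y\<in>carrier Q.
            f (tri Q x y) = tri Q' (f x) (f y) \<and> f (trinv Q x y) = trinv Q' (f x) (f y))}"

definition quandles_isomorphic :: "'a quandle \<Rightarrow> 'b quandle \<Rightarrow> bool" where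
  "quandles_isomorphic Q Q' \<longleftrightarrow> quandle_iso Q Q' \<noteq> {}"

definition total_quandle :: "link \<Rightarrow> alex quandle" where
  "total_quandle L =
    (let R = lam L; M = M_A L; \<phi> = phi_L L
     in \<lparr>carrier = {x \<in> carrier M. \<phi> x \<oplus>\<^bsub>R\<^esub> \<one>\<^bsub>R\<^esub> \<in> Units R},
         tri = (\<lambda>x y. ((\<phi> y \<oplus>\<^bsub>R\<^esub> \<one>\<^bsub>R\<^esub>) \<odot>\<^bsub>M\<^esub> x) \<ominus>\<^bsub>M\<^esub> (\<phi> x \<odot>\<^bsub>M\<^esub> y)),
         trinv = (\<lambda>x y. inv\<^bsub>R\<^esub> (\<phi> y \<oplus>\<^bsub>R\<^esub> \<one>\<^bsub>R\<^esub>) \<odot>\<^bsub>M\<^esub> (x \<oplus>\<^bsub>M\<^esub> (\<phi> x \<odot>\<^bsub>M\<^esub> y)))\<rparr>)"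

definition fundamental_quandle :: "link \<Rightarrow> alex quandle" where
  "fundamental_quandle L =
     (total_quandle L)\<lparr>carrier :=
        \<Inter>{S. subquandle S (total_quandle L) \<and>
            (\<forall>a\<in>arcs L. gamma_D L (basis_elt (lam L) (arcs L) a) \<in> S)}\<rparr>"

text \<open>Scalars are taken from \<open>laurent_ring 1\<close>.\<close>

definition standard_quandle :: "(laurent, 'm) module \<Rightarrow> 'm quandle" where
  "standard_quandle M =
    (let R = laurent_ring 1; t = var 1
     in \<lparr>carrier = carrier M,
         tri = (\<lambda>x y. (t \<odot>\<^bsub>M\<^esub> x) \<oplus>\<^bsub>M\<^esub> ((\<one>\<^bsub>R\<^esub> \<ominus>\<^bsub>R\<^esub> t) \<odot>\<^bsub>M\<^esub> y)),
         trinv = (\<lambda>x y. inv\<^bsub>R\<^esub> t \<odot>\<^bsub>M\<^esub> (x \<oplus>\<^bsub>M\<^esub> ((t \<ominus>\<^bsub>R\<^esub> \<one>\<^bsub>R\<^esub>) \<odot>\<^bsub>M\<^esub> y)))\<rparr>)"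


section \<open>Comparison of link invariants\<close>

definition same_fundamental :: "link \<Rightarrow> link \<Rightarrow> bool" where
  "same_fundamental L L' \<longleftrightarrow> quandles_isomorphic (fundamental_quandle L) (fundamental_quandle L')"

text \<open>Total quandles are compared by quandle isomorphisms that are compatible with the maps \<open>\<phi>\<close>,
  up to a bijection \<open>\<pi>\<close> between the components and the renaming \<open>\<sigma>\<close> of variables it induces.
  Without \<open>\<phi>\<close> the total quandle sees the ring of scalars only up to automorphisms, which need not
  preserve the set of variables, and then it does not determine the reduced modules: for
  \<open>k = 1, 3\<close> let \<open>L\<^sub>k\<close> be the closure of the \<open>k\<close>-th power of the generator of the braid group on
  two strands, together with the braid axis.  A full twist along the axis identifies the two
  complements, hence the bare total quandles, but (for suitable orientations) the reduced Alexander
  polynomials are \<open>(t - 1) (1 + t^2)\<close> and \<open>(t - 1) (1 + t^4)\<close>.\<close>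

definition same_total :: "link \<Rightarrow> link \<Rightarrow> bool" where
  "same_total L L' \<longleftrightarrow>
     (\<exists>f \<in> quandle_iso (total_quandle L) (total_quandle L').
      \<exists>\<sigma> \<in> ring_iso (lam L) (lam L'). \<exists>\<pi>.
        bij_betw \<pi> {1..ncomp L} {1..ncomp L'} \<and>
        (\<forall>i\<in>{1..ncomp L}. \<sigma> (var i) = var (\<pi> i)) \<and>
        (\<forall>x\<in>carrier (total_quandle L). phi_L L' (f x) = \<sigma> (phi_L L x)))"

definition same_standard_invariant :: "link \<Rightarrow> link \<Rightarrow> bool" where
  "same_standard_invariant L L' \<longleftrightarrow>
     quandles_isomorphic (standard_quandle (alex_invariant_red L))
                         (standard_quandle (alex_invariant_red L'))"

definition same_standard_module :: "link \<Rightarrow> link \<Rightarrow> bool" where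
  "same_standard_module L L' \<longleftrightarrow>
     quandles_isomorphic (standard_quandle (M_A_red L)) (standard_quandle (M_A_red L'))"

definition strictly_stronger ::
  "(link \<Rightarrow> link \<Rightarrow> bool) \<Rightarrow> (link \<Rightarrow> link \<Rightarrow> bool) \<Rightarrow> bool" where
  "strictly_stronger P Q \<longleftrightarrow>
     (\<forall>L L'. is_diagram L \<and> is_diagram L' \<and> P L L' \<longrightarrow> Q L L') \<and>
     (\<exists>L L'. is_diagram L \<and> is_diagram L' \<and> Q L L' \<and> \<not> P L L')"

end

theory Submission
  imports Defs "HOL-Library.Function_Algebras"
begin

text \<open>Let \<open>f\<close> be a homomorphism between multivariate quandles of two links which sends elements with
  \<open>\<phi> + 1\<close> a variable to elements of this kind.  Sending the class of an arc \<open>a\<close> to the reduction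
  (\<open>t\<^sub>i = t\<close>) of \<open>f (\<gamma> a)\<close> defines a linear map of reduced Alexander modules, because the relation of
  a crossing is a quandle identity between the classes of its arcs.  For an isomorphism of
  fundamental quandles the map induced by the inverse is an inverse, as two quandle homomorphisms
  that agree on generators are equal.

  An isomorphism of total quandles need not preserve the subquandle generated by the arcs, and the
  composite \<open>N\<close> of the two induced maps need not be the identity.  But \<open>N = 1\<close> modulo \<open>t - 1\<close>, since
  the module modulo \<open>t - 1\<close> only records the components, and \<open>(t - 1)\<^sup>2 (N - 1) = 0\<close>: the quandle
  determines the translations by \<open>(t\<^sub>l - 1) k\<close> with \<open>\<phi> k = 0\<close>, and the commutator of the actions of two
  arcs \<open>a\<close>, \<open>b\<close> is the translation by a unit times \<open>(t\<^sub>l - 1) ((t\<^sub>j - 1) a - (t\<^sub>i - 1) b)\<close>.  Hence \<open>N\<close> is bijective.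

  The Hopf link and the chain of three circles show strictness.  For both, \<open>(t - 1) (a - b) = 0\<close> holds in
  the reduced module for all arcs, so as a quandle it is the product of \<open>\<Lambda>\<close> and a countably
  infinite trivial quandle.  The total quandle of the Hopf link is trivial, while in the chain the
  two outer components, which are not linked, act nontrivially on each other.\<close>

section \<open>Laurent polynomials\<close>

text \<open>A quandle isomorphism comes with no linearity, so the linear map is built from the
  images of the arcs alone, and the work lies in comparing it with \<open>f\<close> on other
  elements. Every element of a fundamental quandle has phi + 1 equal to some t_i, and all t_i reduce
  to the same t. Whichever component an image belongs to, the reduction of the product of x and y is
  therefore t x - (t - 1) y, and a bare isomorphism of fundamental quandles carries enough
  information. For total quandles, let M be the reduced module. The two facts about N combine as
  follows: (N - 1) M lies in (t - 1) M, so (N - 1)^2 M lies in (t - 1)^2 M, and (N - 1)^3 M = 0.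
  Thus N is unipotent. A second obstacle is geometric: arcs are connected components of a subset of
  space. The algebra only sees that they are finitely many, how they meet at crossings, and that a
  walk along a component passes from arc to arc through crossings. These facts form the locale
  \<open>wirtinger\<close>, which is established for diagrams only after the algebra.\<close>

definition ev :: "('k \<Rightarrow> 'b::comm_ring_1) \<Rightarrow> ('k \<Rightarrow>\<^sub>0 int) \<Rightarrow> 'b" where
  "ev f p = (\<Sum>m\<in>Poly_Mapping.keys p. of_int (Poly_Mapping.lookup p m) * f m)"

lemma ev_superset:
  assumes "finite S" "Poly_Mapping.keys p \<subseteq> S"
  shows "ev f p = (\<Sum>m\<in>S. of_int (Poly_Mapping.lookup p m) * f m)"
  unfolding ev_def using assms
  by (intro sum.mono_neutral_left) (auto simp: not_in_keys_iff_lookup_eq_zero)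

lemma ev_diff: "ev f (p - q) = ev f p - ev f q"
proof -
  let ?S = "Poly_Mapping.keys p \<union> Poly_Mapping.keys q"
  have "Poly_Mapping.keys (p - q) \<subseteq> ?S"
    by (rule keys_diff)
  then show ?thesis
    by (simp add: ev_superset[of ?S] lookup_minus sum_subtractf[symmetric] left_diff_distrib)
qed

lemma ev_zero [simp]: "ev f 0 = 0"
  by (simp add: ev_def)

lemma ev_uminus: "ev f (- p) = - ev f p"
  using ev_diff[of f 0 p] by simp

lemma ev_add: "ev f (p + q) = ev f p + ev f q"
  using ev_diff[of f p "- q"] by (simp add: ev_uminus)

lemma ev_single: "ev f (Poly_Mapping.single m c) = of_int c * f m"
  by (simp add: ev_def)

lemma frag_of_mult: "frag_of m * frag_of n = frag_of (m + n)"
  for m n :: "'k::monoid_add"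
  by (simp add: mult_single)

lemma ev_frag_of: "ev f (frag_of m) = f m"
  by (simp add: ev_single)

lemma ev_one: "ev f (1 :: 'k::monoid_add \<Rightarrow>\<^sub>0 int) = f 0"
  by (simp add: ev_def)

text \<open>Both sides are additive in each factor, so induction on one factor and then on the other
  reduces multiplicativity to monomials, where multiplication adds exponents.\<close>

lemma ev_mult:
  fixes p q :: "'k::monoid_add \<Rightarrow>\<^sub>0 int"
  assumes "\<And>m n. f (m + n) = f m * f n"
  shows "ev f (p * q) = ev f p * ev f q"
proof (rule frag_induction[where S = UNIV and c = p])
  fix m
  show "ev f (frag_of m * q) = ev f (frag_of m) * ev f q"
  proof (rule frag_induction[where S = UNIV and c = q])
    fix n
    show "ev f (frag_of m * frag_of n) = ev f (frag_of m) * ev f (frag_of n)"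
      by (simp add: frag_of_mult ev_frag_of assms)
  qed (simp_all add: ev_diff algebra_simps)
qed (simp_all add: ev_diff algebra_simps)

abbreviation lring :: "nat \<Rightarrow> laurent set" where
  "lring n \<equiv> carrier (laurent_ring n)"

definition ivar :: "nat \<Rightarrow> laurent" where
  "ivar i = Poly_Mapping.single (Poly_Mapping.single i (- 1)) 1"

lemma var_frag_of: "var i = frag_of (frag_of i)"
  by (simp add: var_def)

lemma ivar_frag_of: "ivar i = frag_of (- frag_of i)"
  by (simp add: ivar_def single_uminus)

lemma ivar_var [simp]: "ivar i * var i = 1" "var i * ivar i = 1"
  by (simp_all add: var_frag_of ivar_frag_of frag_of_mult)

lemma ivar_var_mult [simp]: "ivar i * (var i * p) = p" "var i * (ivar i * p) = p"
  by (simp_all add: mult.assoc[symmetric])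

lemma lring_iff: "p \<in> lring n \<longleftrightarrow> (\<forall>m\<in>Poly_Mapping.keys p. Poly_Mapping.keys m \<subseteq> {1..n})"
  by (simp add: laurent_ring_def)

lemma laurent_ring_simps [simp]:
  "\<zero>\<^bsub>laurent_ring n\<^esub> = 0" "\<one>\<^bsub>laurent_ring n\<^esub> = 1"
  "x \<oplus>\<^bsub>laurent_ring n\<^esub> y = x + y" "x \<otimes>\<^bsub>laurent_ring n\<^esub> y = x * y"
  by (simp_all add: laurent_ring_def)

lemma lring_zero [simp]: "0 \<in> lring n"
  by (simp add: lring_iff)

lemma lring_one [simp]: "1 \<in> lring n"
  by (simp add: lring_iff)

lemma lring_diff [simp]: "p \<in> lring n \<Longrightarrow> q \<in> lring n \<Longrightarrow> p - q \<in> lring n"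
  using keys_diff[of p q] unfolding lring_iff by blast

lemma lring_uminus [simp]: "p \<in> lring n \<Longrightarrow> - p \<in> lring n"
  using lring_diff[of 0 n p] by simp

lemma lring_add [simp]: "p \<in> lring n \<Longrightarrow> q \<in> lring n \<Longrightarrow> p + q \<in> lring n"
  using lring_diff[of p n "- q"] by simp

lemma lring_mult [simp]:
  assumes "p \<in> lring n" "q \<in> lring n"
  shows "p * q \<in> lring n"
  unfolding lring_iff
proof
  fix m
  assume "m \<in> Poly_Mapping.keys (p * q)"
  then obtain k l where m: "m = k + l" and k: "k \<in> Poly_Mapping.keys p" and l: "l \<in> Poly_Mapping.keys q"
    using keys_mult[of p q] by auto
  have "Poly_Mapping.keys k \<subseteq> {1..n}" "Poly_Mapping.keys l \<subseteq> {1..n}"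
    using assms k l unfolding lring_iff by simp_all
  then show "Poly_Mapping.keys m \<subseteq> {1..n}"
    unfolding m using keys_add[of k l] by (meson Un_least order_trans)
qed

lemma lring_sum [simp]: "(\<And>x. x \<in> A \<Longrightarrow> f x \<in> lring n) \<Longrightarrow> sum f A \<in> lring n"
  by (induction A rule: infinite_finite_induct) auto

lemma lring_var [simp]: "1 \<le> i \<Longrightarrow> i \<le> n \<Longrightarrow> var i \<in> lring n"
  by (simp add: lring_iff var_def)

lemma lring_ivar [simp]: "1 \<le> i \<Longrightarrow> i \<le> n \<Longrightarrow> ivar i \<in> lring n"
  by (simp add: lring_iff ivar_def)

lemma lring_of_int [simp]: "of_int k \<in> lring n"
proof -
  have "of_nat m \<in> lring n" for m
    by (induction m) auto
  then show ?thesis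
    by (cases k rule: int_cases2) auto
qed

text \<open>The ring is generated from 1 by differences and by multiplication with t_i and its
  inverse. This form suits quandles: multiplication by t_i on the kernel of phi is the action of an
  arc of component i.\<close>

lemma lring_induct [consumes 1, case_names one diff var ivar]:
  assumes "p \<in> lring n"
    and one: "P 1" and diff: "\<And>a b. a \<in> lring n \<Longrightarrow> b \<in> lring n \<Longrightarrow> P a \<Longrightarrow> P b \<Longrightarrow> P (a - b)"
    and var: "\<And>i a. i \<in> {1..n} \<Longrightarrow> a \<in> lring n \<Longrightarrow> P a \<Longrightarrow> P (var i * a)"
    and ivar: "\<And>i a. i \<in> {1..n} \<Longrightarrow> a \<in> lring n \<Longrightarrow> P a \<Longrightarrow> P (ivar i * a)"
  shows "P p"
proof -
  \<comment> \<open>The monomials with exponents m and -m are treated together, since the exponent a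
    - b is reached through the inverse monomial of b.\<close>
  have mono: "\<forall>p. p \<in> lring n \<and> P p \<longrightarrow> (frag_of m * p \<in> lring n \<and> P (frag_of m * p)) \<and>
      (frag_of (- m) * p \<in> lring n \<and> P (frag_of (- m) * p))"
    if "Poly_Mapping.keys m \<subseteq> {1..n}" for m
    using that
  proof (induction m rule: frag_induction)
    case zero
    then show ?case by simp
  next
    case (one i)
    then show ?case
      using var ivar unfolding var_frag_of ivar_frag_of
      by (metis lring_ivar lring_mult lring_var var_frag_of ivar_frag_of atLeastAtMost_iff)
  next
    case (diff a b)
    have "frag_of (a - b) * p = frag_of a * (frag_of (- b) * p)"
      "frag_of (- (a - b)) * p = frag_of (- a) * (frag_of b * p)" for p :: laurent
      by (simp_all add: mult.assoc[symmetric] frag_of_mult)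
    then show ?case using diff by metis
  qed
  have "p \<in> lring n \<and> P p"
  proof (rule frag_induction[where S = "{m. Poly_Mapping.keys m \<subseteq> {1..n}}" and c = p])
    show "Poly_Mapping.keys p \<subseteq> {m. Poly_Mapping.keys m \<subseteq> {1..n}}"
      using assms(1) by (auto simp: lring_iff)
    show "0 \<in> lring n \<and> P 0"
      using diff[OF _ _ one one] by simp
    show "frag_of m \<in> lring n \<and> P (frag_of m)" if "m \<in> {m. Poly_Mapping.keys m \<subseteq> {1..n}}" for m
      using mono[of m] that one by (metis lring_one mem_Collect_eq mult.right_neutral)
  qed (use diff in auto)
  then show ?thesis by blast
qed

lemma laurent_cring: "cring (laurent_ring n)"
proof (rule cringI)
  show "abelian_group (laurent_ring n)"
  proof (rule abelian_groupI)
    show "\<exists>y\<in>lring n. y \<oplus>\<^bsub>laurent_ring n\<^esub> x = \<zero>\<^bsub>laurent_ring n\<^esub>" if "x \<in> lring n" for x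
      using that by (intro bexI[of _ "- x"]) auto
  qed (auto simp: algebra_simps)
  show "comm_monoid (laurent_ring n)"
    by (rule comm_monoidI) (auto simp: algebra_simps)
qed (auto simp: algebra_simps)

lemma laurent_a_inv [simp]: "p \<in> lring n \<Longrightarrow> \<ominus>\<^bsub>laurent_ring n\<^esub> p = - p"
  using abelian_group.minus_equality[OF ring.is_abelian_group[OF cring.axioms(1)[OF laurent_cring]], of n "- p" p]
  by auto

lemma laurent_minus [simp]:
  "p \<in> lring n \<Longrightarrow> q \<in> lring n \<Longrightarrow> p \<ominus>\<^bsub>laurent_ring n\<^esub> q = p - q"
  by (simp add: a_minus_def)

lemma laurent_Units:
  "u \<in> Units (laurent_ring n) \<longleftrightarrow> u \<in> lring n \<and> (\<exists>v\<in>lring n. v * u = 1)"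
  by (auto simp: Units_def mult.commute)

lemma laurent_inv: "u \<in> lring n \<Longrightarrow> v \<in> lring n \<Longrightarrow> u * v = 1 \<Longrightarrow> inv\<^bsub>laurent_ring n\<^esub> u = v"
  using comm_monoid.comm_inv_char[OF cring.axioms(2)[OF laurent_cring], of u n v] by simp

lemma laurent_finsum [simp]:
  assumes "finite A" "\<And>a. a \<in> A \<Longrightarrow> f a \<in> lring n"
  shows "finsum (laurent_ring n) f A = sum f A"
proof -
  interpret cring "laurent_ring n" by (rule laurent_cring)
  show ?thesis using assms
    by (induction A rule: finite_induct) (auto simp: Pi_def)
qed

section \<open>Reduction to one variable, augmentation and derivatives\<close>

text \<open>The inner \<open>ev\<close> is the total degree of an exponent vector, so
  \<open>red\<close> substitutes the first variable for all variables.\<close>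

definition red :: "laurent \<Rightarrow> laurent" where
  "red = ev (\<lambda>m. frag_of (Poly_Mapping.single 1 (ev (\<lambda>_. 1) m)))"

definition aug :: "laurent \<Rightarrow> int" where
  "aug = ev (\<lambda>_. 1)"

lemma red_simps [simp]:
  "red 0 = 0" "red 1 = 1" "red (p - q) = red p - red q" "red (- p) = - red p"
  "red (p + q) = red p + red q" "red (p * q) = red p * red q" "red (var i) = var 1"
  "red (ivar i) = ivar 1"
  unfolding red_def
          apply (simp_all add: ev_diff ev_add ev_uminus var_frag_of ivar_frag_of ev_frag_of)
    apply (simp add: ev_one)
   apply (rule ev_mult)
   apply (simp_all add: ev_add frag_of_mult single_add)
   apply (simp_all add: ivar_frag_of single_uminus)
  done

lemma red_sum: "red (sum f A) = (\<Sum>x\<in>A. red (f x))"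
  by (induction A rule: infinite_finite_induct) auto

lemma red_lring [simp]: "red p \<in> lring 1"
proof (rule frag_induction[where S = UNIV and c = p])
  show "red (frag_of m) \<in> lring 1" for m
    by (simp add: red_def ev_frag_of lring_iff)
qed auto

lemma aug_simps [simp]:
  "aug 0 = 0" "aug 1 = 1" "aug (p - q) = aug p - aug q" "aug (- p) = - aug p"
  "aug (p + q) = aug p + aug q" "aug (p * q) = aug p * aug q" "aug (var i) = 1" "aug (ivar i) = 1"
  unfolding aug_def
         by (simp_all add: ev_one ev_diff ev_add ev_uminus var_frag_of ivar_frag_of ev_frag_of ev_mult)

lemma aug_of_int [simp]: "aug (of_int k) = k"
proof -
  have "aug (of_nat m) = int m" for m
    by (induction m) auto
  then show ?thesis
    by (cases k rule: int_cases2) auto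
qed

lemma aug_red [simp]: "aug (red p) = aug p"
proof (rule frag_induction[where S = UNIV and c = p])
  show "aug (red (frag_of m)) = aug (frag_of m)" for m
    by (simp add: red_def aug_def ev_frag_of)
qed auto

text \<open>Modulo t - 1, multiplication by t or by its inverse does nothing, so a polynomial is
  congruent to its value at 1.\<close>

lemma aug_dvd:
  assumes "p \<in> lring 1"
  shows "\<exists>q\<in>lring 1. p - of_int (aug p) = (var 1 - 1) * q"
  using assms
proof (induction p rule: lring_induct)
  case one
  then show ?case by (intro bexI[of _ 0]) auto
next
  case (diff a b)
  then obtain q r where "q \<in> lring 1" "a - of_int (aug a) = (var 1 - 1) * q"
    "r \<in> lring 1" "b - of_int (aug b) = (var 1 - 1) * r" by blast
  moreover have "a - b - of_int (aug (a - b)) = (a - of_int (aug a)) - (b - of_int (aug b))"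
    by simp
  ultimately show ?case
    by (intro bexI[of _ "q - r"]) (simp_all only: right_diff_distrib lring_diff)
next
  case (var i a)
  then obtain q where q: "q \<in> lring 1" "a - of_int (aug a) = (var 1 - 1) * q" by blast
  have i: "i = 1" using var by auto
  have "var 1 * a - of_int (aug a) = (a - of_int (aug a)) + (var 1 - 1) * a"
    by (simp add: algebra_simps)
  also have "\<dots> = (var 1 - 1) * (q + a)"
    unfolding q(2) by (simp add: algebra_simps)
  finally show ?case using q(1) var i
    by (intro bexI[of _ "q + a"]) auto
next
  case (ivar i a)
  then obtain q where q: "q \<in> lring 1" "a - of_int (aug a) = (var 1 - 1) * q" by blast
  have i: "i = 1" using ivar by auto
  have "ivar 1 * a - of_int (aug a) = (var 1 - 1) * (q - ivar 1 * a)"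
    using q(2) by (simp add: algebra_simps)
  then show ?case using q ivar i
    by (intro bexI[of _ "q - ivar 1 * a"]) auto
qed

text \<open>The partial derivative by \<open>t\<^sub>j\<close> at the point where all variables are 1.\<close>

definition expt :: "nat \<Rightarrow> laurent \<Rightarrow> int" where
  "expt j = ev (\<lambda>m. Poly_Mapping.lookup m j)"

text \<open>Leibniz rule at the point 1: there the factor t_i - 1 vanishes, and only its own
  derivative contributes.\<close>

lemma expt_mult_var: "expt j (p * (var i - 1)) = (if i = j then aug p else 0)"
proof (rule frag_induction[where S = UNIV and c = p])
  show "expt j (frag_of m * (var i - 1)) = (if i = j then aug (frag_of m) else 0)" for m
    by (simp add: expt_def aug_def ev_frag_of right_diff_distrib frag_of_mult var_frag_of ev_diff
        lookup_add lookup_single)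
qed (auto simp: expt_def ev_diff left_diff_distrib)

lemma expt_sum: "expt j (sum f A) = (\<Sum>x\<in>A. expt j (f x))"
  by (induction A rule: infinite_finite_induct) (auto simp: expt_def ev_add)

lemma expt_var: "expt j (var i - 1) = (if i = j then 1 else 0)"
  using expt_mult_var[of j 1 i] by simp

section \<open>Alexander modules\<close>

definition sc :: "'r::comm_ring_1 \<Rightarrow> ('b \<Rightarrow> 'r) \<Rightarrow> 'b \<Rightarrow> 'r" where
  "sc r v = (\<lambda>a. r * v a)"

definition dl :: "'b \<Rightarrow> 'b \<Rightarrow> 'r::comm_ring_1" where
  "dl a = (\<lambda>b. if b = a then 1 else 0)"

lemma sc_apply: "sc r v a = r * v a"
  by (simp add: sc_def)

lemmas fun_apply = plus_fun_apply minus_apply uminus_apply zero_fun_apply sc_apply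

text \<open>As simplification rules these also rewrite unapplied sums of functions to abstractions.\<close>

declare plus_fun_apply [simp del] minus_apply [simp del] uminus_apply [simp del] zero_fun_apply [simp del]

lemma sc_simps [simp]:
  "sc 0 v = 0" "sc r 0 = 0" "sc 1 v = v" "sc r (sc s v) = sc (r * s) v"
  by (auto simp: fun_eq_iff fun_apply mult.assoc)

lemma sc_right_distrib: "sc r (v + w) = sc r v + sc r w" "sc r (v - w) = sc r v - sc r w"
  by (auto simp: fun_eq_iff fun_apply algebra_simps)

lemma sc_minus_one: "sc (- 1) v = - v"
  by (auto simp: fun_eq_iff fun_apply)

text \<open>The free module as total functions that vanish off the arcs. Unlike the extensional
  functions of \<open>free_module\<close>, they are closed under the pointwise operations, so
  ordinary group arithmetic applies; \<open>rs\<close> translates between the two.\<close>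

definition fn :: "link \<Rightarrow> nat \<Rightarrow> (space set \<Rightarrow> laurent) set" where
  "fn L n = {v. (\<forall>a. v a \<in> lring n) \<and> (\<forall>a. a \<notin> arcs L \<longrightarrow> v a = 0)}"

lemma fnI: "(\<And>a. v a \<in> lring n) \<Longrightarrow> (\<And>a. a \<notin> arcs L \<Longrightarrow> v a = 0) \<Longrightarrow> v \<in> fn L n"
  unfolding fn_def by blast

lemma fn_closed [simp]:
  "0 \<in> fn L n" "v \<in> fn L n \<Longrightarrow> w \<in> fn L n \<Longrightarrow> v + w \<in> fn L n"
  "v \<in> fn L n \<Longrightarrow> w \<in> fn L n \<Longrightarrow> v - w \<in> fn L n" "v \<in> fn L n \<Longrightarrow> - v \<in> fn L n"
  "r \<in> lring n \<Longrightarrow> v \<in> fn L n \<Longrightarrow> sc r v \<in> fn L n" "a \<in> arcs L \<Longrightarrow> dl a \<in> fn L n"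
  by (auto simp: fn_def dl_def fun_apply)

lemma fn_lring [simp]: "v \<in> fn L n \<Longrightarrow> v a \<in> lring n"
  by (auto simp: fn_def)

lemma fn_zero: "v \<in> fn L n \<Longrightarrow> a \<notin> arcs L \<Longrightarrow> v a = 0"
  unfolding fn_def by blast

lemma fn_sum [simp]: "(\<And>x. x \<in> S \<Longrightarrow> f x \<in> fn L n) \<Longrightarrow> sum f S \<in> fn L n"
  by (induction S rule: infinite_finite_induct) (auto)

lemma sum_fun_apply: "(\<Sum>x\<in>S. f x) a = (\<Sum>x\<in>S. f x a)"
  by (induction S rule: infinite_finite_induct) (auto simp: fun_apply)

lemma sum_sc_dl: "finite S \<Longrightarrow> a \<in> S \<Longrightarrow> (\<Sum>b\<in>S. r b * dl b a) = r a"
  by (simp add: dl_def if_distrib[of "(*) _"] cong: if_cong)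

text \<open>The interface between topology and algebra. The assumption \<open>conn\<close> expresses
  the walk along a component: a set of arcs that cannot be left or entered by passing beneath a
  crossing contains every component of which it contains one arc.\<close>

locale wirtinger =
  fixes L :: link
  assumes finC: "finite (crossings L)" and finA: "finite (arcs L)" and neA: "arcs L \<noteq> {}"
    and over_arc [simp]: "z \<in> crossings L \<Longrightarrow> over_arc L z \<in> arcs L"
    and right_arc [simp]: "z \<in> crossings L \<Longrightarrow> right_arc L z \<in> arcs L"
    and left_arc [simp]: "z \<in> crossings L \<Longrightarrow> left_arc L z \<in> arcs L"
    and comp_left: "z \<in> crossings L \<Longrightarrow> arc_comp L (left_arc L z) = arc_comp L (right_arc L z)"
    and arc_comp: "a \<in> arcs L \<Longrightarrow> arc_comp L a \<in> {1..ncomp L}"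
    and comp_arc: "i \<in> {1..ncomp L} \<Longrightarrow> \<exists>a\<in>arcs L. arc_comp L a = i"
    and conn: "\<And>S a b. \<lbrakk>\<And>z. z \<in> crossings L \<Longrightarrow> right_arc L z \<in> S \<longleftrightarrow> left_arc L z \<in> S;
      a \<in> S; a \<in> arcs L; b \<in> arcs L; arc_comp L a = arc_comp L b\<rbrakk> \<Longrightarrow> b \<in> S"

locale alexander = wirtinger +
  fixes n :: nat and \<tau> :: "nat \<Rightarrow> laurent"
  assumes tau_lring: "i \<in> {1..ncomp L} \<Longrightarrow> \<tau> i \<in> lring n"
begin

definition rel :: "complex \<Rightarrow> space set \<Rightarrow> laurent" where
  "rel z = sc (1 - \<tau> (arc_comp L (right_arc L z))) (dl (over_arc L z))
         + sc (\<tau> (arc_comp L (over_arc L z))) (dl (right_arc L z)) - dl (left_arc L z)"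

definition spn :: "(space set \<Rightarrow> laurent) set" where
  "spn = {\<Sum>z\<in>crossings L. sc (c z) (rel z) | c. \<forall>z\<in>crossings L. c z \<in> lring n}"

definition phi :: "(space set \<Rightarrow> laurent) \<Rightarrow> laurent" where
  "phi v = (\<Sum>a\<in>arcs L. v a * (\<tau> (arc_comp L a) - 1))"

lemma tau [simp]: "a \<in> arcs L \<Longrightarrow> \<tau> (arc_comp L a) \<in> lring n"
  using tau_lring arc_comp by blast

lemma rel_fn [simp]: "z \<in> crossings L \<Longrightarrow> rel z \<in> fn L n"
  by (simp add: rel_def)

lemma spn_fn: "v \<in> spn \<Longrightarrow> v \<in> fn L n"
  by (auto simp: spn_def)

lemma spn_diff [simp]:
  assumes "v \<in> spn" "w \<in> spn"
  shows "v - w \<in> spn"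
proof -
  obtain c d where "v = (\<Sum>z\<in>crossings L. sc (c z) (rel z))" "\<forall>z\<in>crossings L. c z \<in> lring n"
    "w = (\<Sum>z\<in>crossings L. sc (d z) (rel z))" "\<forall>z\<in>crossings L. d z \<in> lring n"
    using assms unfolding spn_def by blast
  then have "v - w = (\<Sum>z\<in>crossings L. sc (c z - d z) (rel z))"
    "\<forall>z\<in>crossings L. c z - d z \<in> lring n"
    by (auto simp: fun_eq_iff fun_apply sum_fun_apply sum_subtractf[symmetric] algebra_simps)
  then show ?thesis unfolding spn_def by (intro CollectI exI[of _ "\<lambda>z. c z - d z"]) simp
qed

lemma spn_sc [simp]:
  assumes "r \<in> lring n" "v \<in> spn"
  shows "sc r v \<in> spn"
proof -
  obtain c where "v = (\<Sum>z\<in>crossings L. sc (c z) (rel z))" "\<forall>z\<in>crossings L. c z \<in> lring n"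
    using assms unfolding spn_def by blast
  then have "sc r v = (\<Sum>z\<in>crossings L. sc (r * c z) (rel z))"
    "\<forall>z\<in>crossings L. r * c z \<in> lring n"
    using assms by (auto simp: fun_eq_iff fun_apply sum_fun_apply sum_distrib_left algebra_simps)
  then show ?thesis unfolding spn_def by (intro CollectI exI[of _ "\<lambda>z. r * c z"]) simp
qed

lemma spn_zero [simp]: "0 \<in> spn"
  unfolding spn_def by (intro CollectI exI[of _ "\<lambda>_. 0"]) auto

lemma spn_uminus [simp]: "v \<in> spn \<Longrightarrow> - v \<in> spn"
  using spn_diff[of 0 v] by simp

lemma spn_add [simp]: "v \<in> spn \<Longrightarrow> w \<in> spn \<Longrightarrow> v + w \<in> spn"
  using spn_diff[of v "- w"] by simp

lemma spn_sum: "(\<And>x. x \<in> S \<Longrightarrow> f x \<in> spn) \<Longrightarrow> sum f S \<in> spn"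
  by (induction S rule: infinite_finite_induct) (auto)

lemma spn_commute: "v - w \<in> spn \<Longrightarrow> w - v \<in> spn"
  using spn_uminus[of "v - w"] by simp

lemma rel_spn [simp]:
  assumes "z \<in> crossings L"
  shows "rel z \<in> spn"
proof -
  have "rel z = (\<Sum>y\<in>crossings L. sc (dl z y) (rel y))"
    using finC assms
    by (simp add: fun_eq_iff fun_apply sum_fun_apply dl_def if_distrib[of "\<lambda>x. x * _"] cong: if_cong)
  then show ?thesis
    unfolding spn_def by (intro CollectI exI[of _ "dl z"]) (auto simp: dl_def)
qed

lemma spn_induct [consumes 1, case_names zero add]:
  assumes "v \<in> spn" and "P 0"
    and add: "\<And>r z v. r \<in> lring n \<Longrightarrow> z \<in> crossings L \<Longrightarrow> v \<in> spn \<Longrightarrow> P v \<Longrightarrow> P (sc r (rel z) + v)"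
  shows "P v"
proof -
  obtain c where c: "v = (\<Sum>z\<in>crossings L. sc (c z) (rel z))" "\<forall>z\<in>crossings L. c z \<in> lring n"
    using assms(1) unfolding spn_def by blast
  have "P (\<Sum>z\<in>S. sc (c z) (rel z)) \<and> (\<Sum>z\<in>S. sc (c z) (rel z)) \<in> spn" if "finite S" "S \<subseteq> crossings L" for S
    using that
  proof (induction S rule: finite_induct)
    case (insert x F)
    then show ?case using c(2) add[of "c x" x] by auto
  qed (use assms(2) in auto)
  then show ?thesis using c finC by auto
qed

lemma phi_simps [simp]:
  "phi 0 = 0" "phi (v + w) = phi v + phi w" "phi (v - w) = phi v - phi w" "phi (- v) = - phi v"
  "phi (sc r v) = r * phi v"
  by (simp_all add: phi_def fun_apply sum.distrib sum_subtractf sum_negf sum_distrib_left algebra_simps)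

lemma phi_dl [simp]: "a \<in> arcs L \<Longrightarrow> phi (dl a) = \<tau> (arc_comp L a) - 1"
  using finA by (simp add: phi_def dl_def if_distrib[of "\<lambda>x. x * _"] cong: if_cong)

lemma phi_lring [simp]: "v \<in> fn L n \<Longrightarrow> phi v \<in> lring n"
  by (auto simp: phi_def)

text \<open>The terms of a crossing relation cancel under phi because both underpassing arcs belong
  to the same component.\<close>

lemma phi_spn: "v \<in> spn \<Longrightarrow> phi v = 0"
proof (induction rule: spn_induct)
  case (add r z v)
  then show ?case by (simp add: rel_def comp_left algebra_simps)
qed (rule phi_simps)

lemma phi_cong: "v - w \<in> spn \<Longrightarrow> phi v = phi w"
  using phi_spn[of "v - w"] by simp

lemma fn_expand:
  assumes "v \<in> fn L n"
  shows "v = (\<Sum>a\<in>arcs L. sc (v a) (dl a))"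
proof
  fix x
  show "v x = (\<Sum>a\<in>arcs L. sc (v a) (dl a)) x"
  proof (cases "x \<in> arcs L")
    case True
    then show ?thesis using finA by (simp add: sum_fun_apply sc_apply sum_sc_dl)
  next
    case False
    have "v x = 0" by (rule fn_zero[OF assms False])
    moreover have "(\<Sum>a\<in>arcs L. v a * dl a x) = 0"
      using False by (intro sum.neutral ballI) (metis dl_def mult_zero_right)
    ultimately show ?thesis by (simp add: sum_fun_apply sc_apply)
  qed
qed

section \<open>Cosets and their representatives\<close>

abbreviation F where "F \<equiv> free_module (laurent_ring n) (arcs L)"
abbreviation N where "N \<equiv> rho_image n \<tau> L"
abbreviation M where "M \<equiv> alex_module n \<tau> L"

definition rs :: "(space set \<Rightarrow> laurent) \<Rightarrow> space set \<Rightarrow> laurent" where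
  "rs v = restrict v (arcs L)"

lemma rs_eq_iff: "rs v = rs w \<longleftrightarrow> (\<forall>a\<in>arcs L. v a = w a)"
  unfolding rs_def by (metis restrict_apply' restrict_ext)

lemma rs_apply: "a \<in> arcs L \<Longrightarrow> rs v a = v a"
  by (simp add: rs_def)

lemma rs_ext:
  assumes "f \<in> arcs L \<rightarrow>\<^sub>E lring n"
  shows "f \<in> rs ` fn L n"
proof
  show "f = rs (\<lambda>a. if a \<in> arcs L then f a else 0)"
    using assms by (auto simp: rs_def PiE_iff restrict_def extensional_def)
  show "(\<lambda>a. if a \<in> arcs L then f a else 0) \<in> fn L n"
    using assms by (intro fnI) (simp_all add: PiE_iff)
qed

lemma rs_fn: "v \<in> fn L n \<Longrightarrow> rs v \<in> arcs L \<rightarrow>\<^sub>E lring n"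
  by (auto simp: rs_def)

lemma rs_inj: "v \<in> fn L n \<Longrightarrow> w \<in> fn L n \<Longrightarrow> rs v = rs w \<Longrightarrow> v = w"
  unfolding rs_eq_iff by (metis ext fn_zero)

lemma carrier_F: "carrier F = rs ` fn L n"
  using rs_ext rs_fn by (auto simp: free_module_def)

lemma F_simps:
  "rs v \<oplus>\<^bsub>F\<^esub> rs w = rs (v + w)" "r \<odot>\<^bsub>F\<^esub> rs v = rs (sc r v)" "\<zero>\<^bsub>F\<^esub> = rs 0"
  unfolding free_module_def rs_def by (simp_all add: restrict_def fun_eq_iff fun_apply)

lemma F_abelian: "abelian_group F"
proof (rule abelian_groupI)
  fix x assume "x \<in> carrier F"
  then obtain v where "v \<in> fn L n" "x = rs v" by (auto simp: carrier_F)
  then show "\<exists>y\<in>carrier F. y \<oplus>\<^bsub>F\<^esub> x = \<zero>\<^bsub>F\<^esub>"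
    by (intro bexI[of _ "rs (- v)"]) (auto simp: F_simps carrier_F)
qed (auto simp: carrier_F F_simps add.assoc add.commute add.left_commute simp del: restrict_apply)

lemma F_minus:
  assumes "v \<in> fn L n" "w \<in> fn L n"
  shows "rs v \<ominus>\<^bsub>F\<^esub> rs w = rs (v - w)"
proof -
  have "\<ominus>\<^bsub>F\<^esub> rs w = rs (- w)"
    by (rule abelian_group.minus_equality[OF F_abelian])
      (use assms in \<open>auto simp: F_simps carrier_F\<close>)
  then show ?thesis
    by (simp add: a_minus_def F_simps)
qed

lemma basis_elt_rs: "basis_elt (laurent_ring n) (arcs L) a = rs (dl a)"
  by (auto simp: basis_elt_def rs_def dl_def)

lemma crossing_rel_rs:
  assumes z: "z \<in> crossings L"
  shows "crossing_rel n \<tau> L z = rs (rel z)"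
  using z by (simp add: crossing_rel_def Let_def basis_elt_rs F_simps F_minus rel_def)

lemma rho_rs:
  assumes "\<And>z. z \<in> crossings L \<Longrightarrow> c z \<in> lring n"
  shows "rho n \<tau> L c = rs (\<Sum>z\<in>crossings L. sc (c z) (rel z))"
proof -
  interpret abelian_group F by (rule F_abelian)
  have "finsum F (\<lambda>z. c z \<odot>\<^bsub>F\<^esub> crossing_rel n \<tau> L z) S = rs (\<Sum>z\<in>S. sc (c z) (rel z))"
    if "finite S" "S \<subseteq> crossings L" for S
    using that
  proof (induction S rule: finite_induct)
    case empty
    then show ?case by (simp add: F_simps)
  next
    case (insert x S)
    have c: "c z \<odot>\<^bsub>F\<^esub> crossing_rel n \<tau> L z = rs (sc (c z) (rel z))" if "z \<in> crossings L" for z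
      using that by (simp add: crossing_rel_rs F_simps)
    have "c z \<odot>\<^bsub>F\<^esub> crossing_rel n \<tau> L z \<in> carrier F" if "z \<in> crossings L" for z
      unfolding c[OF that] carrier_F using that assms by (intro imageI) simp
    then have "finsum F (\<lambda>z. c z \<odot>\<^bsub>F\<^esub> crossing_rel n \<tau> L z) (insert x S) =
      c x \<odot>\<^bsub>F\<^esub> crossing_rel n \<tau> L x \<oplus>\<^bsub>F\<^esub> finsum F (\<lambda>z. c z \<odot>\<^bsub>F\<^esub> crossing_rel n \<tau> L z) S"
      using insert by (intro finsum_insert) auto
    also have "\<dots> = rs (\<Sum>z\<in>insert x S. sc (c z) (rel z))"
      using insert c by (simp add: F_simps)
    finally show ?case .
  qed
  then show ?thesis using finC by (simp add: rho_def Let_def)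
qed

lemma rho_image_rs: "N = rs ` spn"
proof -
  have "rho n \<tau> L c \<in> rs ` spn" if "c \<in> crossings L \<rightarrow>\<^sub>E lring n" for c
    using that rho_rs[of c] unfolding spn_def by auto
  moreover have "rs v \<in> N" if v: "v \<in> spn" for v
  proof -
    obtain c where c: "v = (\<Sum>z\<in>crossings L. sc (c z) (rel z))" "\<forall>z\<in>crossings L. c z \<in> lring n"
      using v unfolding spn_def by blast
    have "rho n \<tau> L (restrict c (crossings L)) = rs (\<Sum>z\<in>crossings L. sc (restrict c (crossings L) z) (rel z))"
      using c by (intro rho_rs) auto
    also have "\<dots> = rs v" unfolding c(1) by (intro arg_cong[of _ _ rs] sum.cong) auto
    finally show ?thesis
      using c unfolding rho_image_def free_module_def
      by (auto intro!: image_eqI[of _ _ "restrict c (crossings L)"])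
  qed
  ultimately show ?thesis
    unfolding rho_image_def free_module_def by auto
qed

definition cl :: "(space set \<Rightarrow> laurent) \<Rightarrow> alex" where
  "cl v = alex_gamma n \<tau> L (rs v)"

lemma cl_alt: "cl v = (\<lambda>s. rs (s + v)) ` spn"
  by (auto simp: cl_def alex_gamma_def a_r_coset_def' rho_image_rs F_simps)

text \<open>This replaces computations with cosets by computations with representatives: equality in
  the Alexander module becomes membership of a difference in \<open>spn\<close>.\<close>

lemma cl_eq:
  assumes "v \<in> fn L n" "w \<in> fn L n"
  shows "cl v = cl w \<longleftrightarrow> v - w \<in> spn"
proof
  assume "cl v = cl w"
  then have "rs (0 + v) \<in> cl w" using spn_zero unfolding cl_alt by blast
  then obtain s where s: "s \<in> spn" "rs v = rs (s + w)" unfolding cl_alt by auto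
  have "v = s + w"
    by (rule rs_inj[OF assms(1) fn_closed(2)[OF spn_fn[OF s(1)] assms(2)] s(2)])
  then show "v - w \<in> spn" using s by simp
next
  assume s: "v - w \<in> spn"
  have "rs (t + v) \<in> (\<lambda>s. rs (s + w)) ` spn" if "t \<in> spn" for t
    using that s by (intro image_eqI[of _ _ "t + (v - w)"]) simp_all
  moreover have "rs (t + w) \<in> (\<lambda>s. rs (s + v)) ` spn" if "t \<in> spn" for t
    using that s by (intro image_eqI[of _ _ "t - (v - w)"]) simp_all
  ultimately show "cl v = cl w"
    unfolding cl_alt by blast
qed

lemma carrier_M: "carrier M = cl ` fn L n"
  by (auto simp: alex_module_def quotient_module_def A_RCOSETS_def' carrier_F cl_def alex_gamma_def)

lemma M_add: "cl v \<oplus>\<^bsub>M\<^esub> cl w = cl (v + w)"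
proof -
  have "rs (s + v) \<oplus>\<^bsub>F\<^esub> rs (t + w) = rs ((s + t) + (v + w))" for s t
    unfolding F_simps by (simp add: add_ac)
  then have 1: "rs (s + v) \<oplus>\<^bsub>F\<^esub> rs (t + w) \<in> cl (v + w)" if "s \<in> spn" "t \<in> spn" for s t
    using that unfolding cl_alt by (intro image_eqI[of _ _ "s + t"]) simp_all
  have 2: "rs (s + (v + w)) = rs (s + v) \<oplus>\<^bsub>F\<^esub> rs (0 + w)" for s
    unfolding F_simps by (simp add: add_ac)
  have "cl v <+>\<^bsub>F\<^esub> cl w = cl (v + w)"
  proof
    show "cl v <+>\<^bsub>F\<^esub> cl w \<subseteq> cl (v + w)"
      using 1 unfolding set_add_def' cl_alt[of v] cl_alt[of w] by blast
    show "cl (v + w) \<subseteq> cl v <+>\<^bsub>F\<^esub> cl w"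
      using 2 spn_zero unfolding set_add_def' cl_alt by blast
  qed
  then show ?thesis
    by (simp add: alex_module_def quotient_module_def)
qed

lemma M_sc: 
  assumes "r \<in> lring n" "v \<in> fn L n"
  shows "r \<odot>\<^bsub>M\<^esub> cl v = cl (sc r v)"
proof -
  have "N +>\<^bsub>F\<^esub> (r \<odot>\<^bsub>F\<^esub> rs (s + v)) = cl (sc r v)" if "s \<in> spn" for s
  proof -
    have "cl (sc r (s + v)) = cl (sc r v)"
      using that assms spn_fn by (subst cl_eq) (auto simp: sc_right_distrib)
    then show ?thesis by (simp add: F_simps cl_def alex_gamma_def)
  qed
  moreover have "spn \<noteq> {}" using spn_zero by blast
  ultimately show ?thesis
    unfolding alex_module_def quotient_module_def by (auto simp: cl_alt[of v])
qed

lemma M_zero: "\<zero>\<^bsub>M\<^esub> = cl 0"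
  by (simp add: alex_module_def quotient_module_def cl_alt rho_image_rs)

lemma M_abelian: "abelian_group M"
proof (rule abelian_groupI)
  fix x assume "x \<in> carrier M"
  then obtain v where "v \<in> fn L n" "x = cl v" by (auto simp: carrier_M)
  then show "\<exists>y\<in>carrier M. y \<oplus>\<^bsub>M\<^esub> x = \<zero>\<^bsub>M\<^esub>"
    by (intro bexI[of _ "cl (- v)"]) (auto simp: M_add M_zero carrier_M)
qed (auto simp: carrier_M M_add M_zero add.assoc add.commute add.left_commute)

lemma M_minus:
  assumes "v \<in> fn L n" "w \<in> fn L n"
  shows "cl v \<ominus>\<^bsub>M\<^esub> cl w = cl (v - w)"
proof -
  have "\<ominus>\<^bsub>M\<^esub> cl w = cl (- w)"
    by (rule abelian_group.minus_equality[OF M_abelian])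
      (use assms in \<open>auto simp: M_add M_zero carrier_M\<close>)
  then show ?thesis
    by (simp add: a_minus_def M_add)
qed

text \<open>Since \<open>phi\<close> vanishes on \<open>spn\<close>, all members of the coset give
  the same value, and the definite description in \<open>alex_phi\<close> denotes it.\<close>

lemma alex_phi_cl:
  assumes v: "v \<in> fn L n"
  shows "alex_phi n \<tau> L (cl v) = phi v"
proof -
  have *: "finsum (laurent_ring n) (\<lambda>a. w a \<otimes>\<^bsub>laurent_ring n\<^esub> (\<tau> (arc_comp L a) \<ominus>\<^bsub>laurent_ring n\<^esub> \<one>\<^bsub>laurent_ring n\<^esub>)) (arcs L) = phi v"
    if w: "w \<in> cl v" for w
  proof -
    obtain s where s: "s \<in> spn" "w = rs (s + v)" using w unfolding cl_alt by blast
    have "finsum (laurent_ring n) (\<lambda>a. w a \<otimes>\<^bsub>laurent_ring n\<^esub> (\<tau> (arc_comp L a) \<ominus>\<^bsub>laurent_ring n\<^esub> \<one>\<^bsub>laurent_ring n\<^esub>)) (arcs L)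
      = phi (s + v)"
      using s fn_lring[OF fn_closed(2)[OF spn_fn[OF s(1)] v]] finA
      by (subst laurent_finsum) (simp_all add: phi_def rs_apply)
    then show ?thesis using phi_spn[OF s(1)] by simp
  qed
  moreover have "rs (0 + v) \<in> cl v" unfolding cl_alt using spn_zero by blast
  ultimately show ?thesis
    unfolding alex_phi_def Let_def by (intro the_equality) auto
qed

definition rep :: "alex \<Rightarrow> space set \<Rightarrow> laurent" where
  "rep X = (SOME v. v \<in> fn L n \<and> cl v = X)"

lemma rep:
  assumes "X \<in> carrier M"
  shows "rep X \<in> fn L n" "cl (rep X) = X"
proof -
  have "\<exists>v. v \<in> fn L n \<and> cl v = X" using assms by (auto simp: carrier_M)
  then have "rep X \<in> fn L n \<and> cl (rep X) = X" unfolding rep_def by (rule someI_ex)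
  then show "rep X \<in> fn L n" "cl (rep X) = X" by auto
qed

lemma rep_cl:
  assumes "v \<in> fn L n"
  shows "rep (cl v) \<in> fn L n" "rep (cl v) - v \<in> spn"
proof -
  have "cl v \<in> carrier M" using assms by (simp add: carrier_M)
  from rep[OF this] show "rep (cl v) \<in> fn L n" "rep (cl v) - v \<in> spn"
    using cl_eq[of "rep (cl v)" v] assms by auto
qed

lemma cl_eqI: "v \<in> fn L n \<Longrightarrow> w \<in> fn L n \<Longrightarrow> v - w \<in> spn \<Longrightarrow> cl v = cl w"
  by (simp add: cl_eq)

end

context wirtinger
begin

sublocale mul: alexander L "ncomp L" var
  by unfold_locales simp

sublocale rdc: alexander L 1 "\<lambda>_. var 1"
  by unfold_locales simp

end

section \<open>Multivariate Alexander quandles\<close>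

lemma subquandleI:
  assumes q: "is_quandle Q" and S: "S \<subseteq> carrier Q"
    and t: "\<And>x y. x \<in> S \<Longrightarrow> y \<in> S \<Longrightarrow> tri Q x y \<in> S"
    and ti: "\<And>x y. x \<in> S \<Longrightarrow> y \<in> S \<Longrightarrow> trinv Q x y \<in> S"
  shows "subquandle S Q"
proof -
  have e: "tri (Q\<lparr>carrier := S\<rparr>) = tri Q" "trinv (Q\<lparr>carrier := S\<rparr>) = trinv Q" "carrier (Q\<lparr>carrier := S\<rparr>) = S"
    by simp_all
  note c = subsetD[OF S]
  have "is_quandle (Q\<lparr>carrier := S\<rparr>)"
    unfolding is_quandle_def e
    apply (intro conjI ballI)
    subgoal by (rule t)
    subgoal by (rule ti)
    subgoal using q c unfolding is_quandle_def by blast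
    subgoal using q c unfolding is_quandle_def by blast
    subgoal using q c unfolding is_quandle_def by blast
    subgoal premises p for x y z
      using q c[OF p(1)] c[OF p(2)] c[OF p(3)] unfolding is_quandle_def by blast
    done
  then show ?thesis unfolding subquandle_def using S by blast
qed

lemma subquandle_closed:
  assumes "subquandle S Q" "x \<in> S" "y \<in> S"
  shows "tri Q x y \<in> S" "trinv Q x y \<in> S"
proof -
  have e: "tri (Q\<lparr>carrier := S\<rparr>) = tri Q" "trinv (Q\<lparr>carrier := S\<rparr>) = trinv Q" "carrier (Q\<lparr>carrier := S\<rparr>) = S"
    by simp_all
  show "tri Q x y \<in> S" "trinv Q x y \<in> S"
    using assms unfolding subquandle_def is_quandle_def e by blast+
qed

context wirtinger
begin

abbreviation "R \<equiv> laurent_ring (ncomp L)"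

definition tr :: "(space set \<Rightarrow> laurent) \<Rightarrow> (space set \<Rightarrow> laurent) \<Rightarrow> space set \<Rightarrow> laurent" where
  "tr v w = sc (mul.phi w + 1) v - sc (mul.phi v) w"

definition U :: "(space set \<Rightarrow> laurent) set" where
  "U = {v \<in> fn L (ncomp L). mul.phi v + 1 \<in> Units R}"

definition V :: "nat \<Rightarrow> (space set \<Rightarrow> laurent) set" where
  "V i = {v \<in> fn L (ncomp L). mul.phi v = var i - 1}"

text \<open>The kernel of phi. Its elements k act on the quandle by the translations taking v to v -
  phi(v) k, and an element w acts on \<open>K\<close> as multiplication by phi(w) + 1.\<close>

definition K :: "(space set \<Rightarrow> laurent) set" where
  "K = {v \<in> fn L (ncomp L). mul.phi v = 0}"

lemma tr_fn [simp]: "v \<in> fn L (ncomp L) \<Longrightarrow> w \<in> fn L (ncomp L) \<Longrightarrow> tr v w \<in> fn L (ncomp L)"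
  by (simp add: tr_def)

lemma phi_tr [simp]: "mul.phi (tr v w) = mul.phi v"
  by (simp add: tr_def algebra_simps)

lemma U_fn: "v \<in> U \<Longrightarrow> v \<in> fn L (ncomp L)"
  by (simp add: U_def)

lemma V_fn: "v \<in> V i \<Longrightarrow> v \<in> fn L (ncomp L)"
  by (simp add: V_def)

lemma K_fn: "v \<in> K \<Longrightarrow> v \<in> fn L (ncomp L)"
  by (simp add: K_def)

lemma tr_U: "v \<in> U \<Longrightarrow> w \<in> U \<Longrightarrow> tr v w \<in> U"
  by (simp add: U_def)

lemma tr_V: "v \<in> V i \<Longrightarrow> w \<in> fn L (ncomp L) \<Longrightarrow> tr v w \<in> V i"
  by (simp add: V_def)

lemma K_U: "v \<in> K \<Longrightarrow> v \<in> U"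
  by (simp add: K_def U_def laurent_Units)

lemma V_U: "v \<in> V i \<Longrightarrow> i \<in> {1..ncomp L} \<Longrightarrow> v \<in> U"
  using bexI[of "\<lambda>u. u * var i = 1" "ivar i" "lring (ncomp L)"]
  by (auto simp: V_def U_def laurent_Units)

lemma dl_V: "a \<in> arcs L \<Longrightarrow> dl a \<in> V (arc_comp L a)"
  by (simp add: V_def)

lemma total_simps:
  "carrier (total_quandle L) = mul.cl ` U"
  "v \<in> fn L (ncomp L) \<Longrightarrow> w \<in> fn L (ncomp L) \<Longrightarrow>
     tri (total_quandle L) (mul.cl v) (mul.cl w) = mul.cl (tr v w)"
  by (auto simp: total_quandle_def Let_def mul.carrier_M U_def mul.alex_phi_cl mul.M_sc mul.M_minus tr_def)

lemma total_trinv: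
  assumes "v \<in> fn L (ncomp L)" "w \<in> fn L (ncomp L)" "u \<in> lring (ncomp L)" "(mul.phi w + 1) * u = 1"
  shows "trinv (total_quandle L) (mul.cl v) (mul.cl w) = mul.cl (sc u (v + sc (mul.phi v) w))"
proof -
  have "inv\<^bsub>R\<^esub> (mul.phi w + 1) = u"
    using assms by (intro laurent_inv) auto
  then show ?thesis using assms
    by (simp add: total_quandle_def Let_def mul.alex_phi_cl mul.M_sc mul.M_add)
qed

lemma U_inverse:
  assumes "w \<in> U"
  obtains u where "u \<in> lring (ncomp L)" "(mul.phi w + 1) * u = 1"
  using assms unfolding U_def laurent_Units by (auto simp: mult.commute)

lemma phi_trinv:
  assumes "(mul.phi w + 1) * u = 1"
  shows "mul.phi (sc u (v + sc (mul.phi v) w)) = mul.phi v"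
proof -
  have "mul.phi (sc u (v + sc (mul.phi v) w)) = mul.phi v * ((mul.phi w + 1) * u)"
    by (simp add: algebra_simps)
  then show ?thesis using assms by simp
qed

text \<open>A \<open>subquandle\<close> must satisfy the axioms. Once they hold in the total
  quandle, closure under both operations is all that remains to be checked for a subset. The
  identities rest on the fact that a product has the phi of its left factor.\<close>

lemma total_is_quandle: "is_quandle (total_quandle L)"
  unfolding is_quandle_def
proof (intro conjI ballI)
  fix X Y assume "X \<in> carrier (total_quandle L)" "Y \<in> carrier (total_quandle L)"
  then obtain v w where v: "v \<in> U" "X = mul.cl v" and w: "w \<in> U" "Y = mul.cl w"
    by (auto simp: total_simps)
  obtain u where u: "u \<in> lring (ncomp L)" "(mul.phi w + 1) * u = 1"
    using U_inverse[OF w(1)] by blast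
  note fn = U_fn[OF v(1)] U_fn[OF w(1)]
  let ?t = "sc u (v + sc (mul.phi v) w)"
  have t: "?t \<in> U" using v(1) fn u phi_trinv[OF u(2)] by (simp add: U_def)
  show "tri (total_quandle L) X Y \<in> carrier (total_quandle L)"
    using v w fn by (simp add: total_simps tr_U)
  show "trinv (total_quandle L) X Y \<in> carrier (total_quandle L)"
    using v w fn t by (simp add: total_simps(1) total_trinv[OF fn u])
  have "tr ?t w = sc ((mul.phi w + 1) * u) v"
    using phi_trinv[OF u(2)]
    unfolding tr_def by (simp add: fun_eq_iff fun_apply algebra_simps)
      (metis (no_types, opaque_lifting) distrib_left mult.assoc mult.commute mult.right_neutral u(2))
  then show "tri (total_quandle L) (trinv (total_quandle L) X Y) Y = X"
    using u v w fn U_fn[OF t] by (simp add: total_simps total_trinv[OF fn u])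
  have "sc u (tr v w + sc (mul.phi (tr v w)) w) = sc ((mul.phi w + 1) * u) v"
    unfolding phi_tr by (simp add: tr_def fun_eq_iff fun_apply algebra_simps)
  then show "trinv (total_quandle L) (tri (total_quandle L) X Y) Y = X"
    using u v w fn by (simp add: total_simps total_trinv[OF _ fn(2) u])
next
  fix X assume "X \<in> carrier (total_quandle L)"
  then obtain v where v: "v \<in> U" "X = mul.cl v" by (auto simp: total_simps)
  have "tr v v = v" by (simp add: tr_def fun_eq_iff fun_apply algebra_simps)
  then show "tri (total_quandle L) X X = X"
    using v U_fn by (simp add: total_simps)
next
  fix X Y Z
  assume "X \<in> carrier (total_quandle L)" "Y \<in> carrier (total_quandle L)" "Z \<in> carrier (total_quandle L)"
  then obtain v w x where v: "v \<in> U" "X = mul.cl v" and w: "w \<in> U" "Y = mul.cl w"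
    and x: "x \<in> U" "Z = mul.cl x"
    by (auto simp: total_simps)
  have "tr (tr v w) x = tr (tr v x) (tr w x)"
    unfolding tr_def[of "tr v w"] tr_def[of "tr v x"] phi_tr
    by (simp add: tr_def fun_eq_iff fun_apply algebra_simps)
  then show "tri (total_quandle L) (tri (total_quandle L) X Y) Z =
       tri (total_quandle L) (tri (total_quandle L) X Z) (tri (total_quandle L) Y Z)"
    using v w x U_fn by (simp add: total_simps)
qed

abbreviation "Q \<equiv> carrier (fundamental_quandle L)"

lemma fundamental_simps:
  "tri (fundamental_quandle L) = tri (total_quandle L)"
  "trinv (fundamental_quandle L) = trinv (total_quandle L)"
  by (simp_all add: fundamental_quandle_def)

lemma gamma_cl: "gamma_D L (basis_elt (lam L) (arcs L) a) = mul.cl (dl a)"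
  by (simp add: mul.cl_def mul.basis_elt_rs)

lemma Q_eq: "Q = \<Inter>{S. subquandle S (total_quandle L) \<and> (\<forall>a\<in>arcs L. mul.cl (dl a) \<in> S)}"
  by (simp add: fundamental_quandle_def gamma_cl)

lemma Q_least: "subquandle S (total_quandle L) \<Longrightarrow> (\<And>a. a \<in> arcs L \<Longrightarrow> mul.cl (dl a) \<in> S) \<Longrightarrow> Q \<subseteq> S"
  unfolding Q_eq by blast

lemma Q_dl: "a \<in> arcs L \<Longrightarrow> mul.cl (dl a) \<in> Q"
  unfolding Q_eq by blast

text \<open>Both operations keep the phi of the left operand, so the classes with phi + 1 a variable
  form a subquandle, and this contains the arcs.\<close>

lemma Q_V: "Q \<subseteq> mul.cl ` (\<Union>i\<in>{1..ncomp L}. V i)"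
proof (rule Q_least)
  show "subquandle (mul.cl ` (\<Union>i\<in>{1..ncomp L}. V i)) (total_quandle L)"
  proof (rule subquandleI[OF total_is_quandle])
    show "mul.cl ` (\<Union>i\<in>{1..ncomp L}. V i) \<subseteq> carrier (total_quandle L)"
      using V_U by (auto simp: total_simps)
    fix X Y assume "X \<in> mul.cl ` (\<Union>i\<in>{1..ncomp L}. V i)" "Y \<in> mul.cl ` (\<Union>i\<in>{1..ncomp L}. V i)"
    then obtain v i w j where v: "v \<in> V i" "i \<in> {1..ncomp L}" "X = mul.cl v"
      and w: "w \<in> V j" "j \<in> {1..ncomp L}" "Y = mul.cl w" by blast
    obtain u where u: "u \<in> lring (ncomp L)" "(mul.phi w + 1) * u = 1"
      using U_inverse[OF V_U[OF w(1,2)]] by blast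
    note fn = V_fn[OF v(1)] V_fn[OF w(1)]
    have "tr v w \<in> V i" using v fn by (simp add: tr_V)
    then show "tri (total_quandle L) X Y \<in> mul.cl ` (\<Union>i\<in>{1..ncomp L}. V i)"
      using v(2) unfolding v(3) w(3) total_simps(2)[OF fn] by blast
    have "sc u (v + sc (mul.phi v) w) \<in> fn L (ncomp L)"
      using fn u by simp
    then have "sc u (v + sc (mul.phi v) w) \<in> V i"
      using v(1) unfolding V_def mem_Collect_eq phi_trinv[OF u(2)] by blast
    then show "trinv (total_quandle L) X Y \<in> mul.cl ` (\<Union>i\<in>{1..ncomp L}. V i)"
      using v(2) unfolding v(3) w(3) total_trinv[OF fn u] by blast
  qed
qed (use dl_V arc_comp in blast)

lemma Q_total: "Q \<subseteq> carrier (total_quandle L)"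
  using Q_V V_U unfolding total_simps(1) by blast

lemma
  assumes "X \<in> Q" "Y \<in> Q"
  shows Q_tri: "tri (total_quandle L) X Y \<in> Q" and Q_trinv: "trinv (total_quandle L) X Y \<in> Q"
proof -
  have "X \<in> S" "Y \<in> S" if "subquandle S (total_quandle L)" "\<forall>a\<in>arcs L. mul.cl (dl a) \<in> S" for S
    using assms that unfolding Q_eq by blast+
  then show "tri (total_quandle L) X Y \<in> Q" "trinv (total_quandle L) X Y \<in> Q"
    unfolding Q_eq by (auto intro!: subquandle_closed)
qed

text \<open>The elements of \<open>Q\<close> with property \<open>P\<close> form a subquandle
  containing the arcs, hence all of \<open>Q\<close>, which is the smallest one.\<close>

lemma Q_induct [consumes 1, case_names dl tri trinv]:
  assumes "X \<in> Q"
    and "\<And>a. a \<in> arcs L \<Longrightarrow> P (mul.cl (dl a))"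
    and "\<And>X Y. X \<in> Q \<Longrightarrow> Y \<in> Q \<Longrightarrow> P X \<Longrightarrow> P Y \<Longrightarrow> P (tri (total_quandle L) X Y)"
    and "\<And>X Y. X \<in> Q \<Longrightarrow> Y \<in> Q \<Longrightarrow> P X \<Longrightarrow> P Y \<Longrightarrow> P (trinv (total_quandle L) X Y)"
  shows "P X"
proof -
  have "Q \<subseteq> {X \<in> Q. P X}"
  proof (rule Q_least)
    show "subquandle {X \<in> Q. P X} (total_quandle L)"
    proof (rule subquandleI[OF total_is_quandle])
      show "{X \<in> Q. P X} \<subseteq> carrier (total_quandle L)" using Q_total by blast
      fix X Y assume "X \<in> {X \<in> Q. P X}" "Y \<in> {X \<in> Q. P X}"
      then have *: "X \<in> Q" "Y \<in> Q" "P X" "P Y" by simp_all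
      show "tri (total_quandle L) X Y \<in> {X \<in> Q. P X}"
        using Q_tri[OF *(1,2)] assms(3)[OF *] unfolding mem_Collect_eq by (rule conjI)
      show "trinv (total_quandle L) X Y \<in> {X \<in> Q. P X}"
        using Q_trinv[OF *(1,2)] assms(4)[OF *] unfolding mem_Collect_eq by (rule conjI)
    qed
  qed (use Q_dl assms in blast)
  then show ?thesis using assms(1) by blast
qed

end

section \<open>Maps between reduced Alexander modules\<close>

declare One_nat_def [simp del]

definition Rd :: "('b \<Rightarrow> laurent) \<Rightarrow> 'b \<Rightarrow> laurent" where
  "Rd v = (\<lambda>a. red (v a))"

lemma Rd_simps [simp]:
  "Rd 0 = 0" "Rd (v + w) = Rd v + Rd w" "Rd (v - w) = Rd v - Rd w" "Rd (sc r v) = sc (red r) (Rd v)"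
  "Rd (dl a) = dl a"
  by (simp_all add: Rd_def fun_eq_iff fun_apply dl_def)

lemma Rd_fn [simp]: "v \<in> fn L n \<Longrightarrow> Rd v \<in> fn L 1"
  by (intro fnI) (simp_all add: Rd_def fn_zero)

context wirtinger
begin

lemma Rd_rel: "z \<in> crossings L \<Longrightarrow> Rd (mul.rel z) = rdc.rel z"
  by (simp add: mul.rel_def rdc.rel_def)

text \<open>Each crossing relation reduces to the corresponding reduced relation, so reduction
  descends to a map from the multivariate to the reduced module.\<close>

lemma Rd_spn: "v \<in> mul.spn \<Longrightarrow> Rd v \<in> rdc.spn"
  by (induction rule: mul.spn_induct) (simp_all add: Rd_rel)

lemma phi_Rd: "rdc.phi (Rd v) = red (mul.phi v)"
  by (simp add: rdc.phi_def mul.phi_def Rd_def red_sum)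

definition st :: "(space set \<Rightarrow> laurent) \<Rightarrow> (space set \<Rightarrow> laurent) \<Rightarrow> space set \<Rightarrow> laurent" where
  "st v w = sc (var 1) v + sc (1 - var 1) w"

definition sti :: "(space set \<Rightarrow> laurent) \<Rightarrow> (space set \<Rightarrow> laurent) \<Rightarrow> space set \<Rightarrow> laurent" where
  "sti v w = sc (ivar 1) (v + sc (var 1 - 1) w)"

lemma standard_simps:
  "carrier (standard_quandle (M_A_red L)) = rdc.cl ` fn L 1"
  "v \<in> fn L 1 \<Longrightarrow> w \<in> fn L 1 \<Longrightarrow> tri (standard_quandle (M_A_red L)) (rdc.cl v) (rdc.cl w) = rdc.cl (st v w)"
  "v \<in> fn L 1 \<Longrightarrow> w \<in> fn L 1 \<Longrightarrow> trinv (standard_quandle (M_A_red L)) (rdc.cl v) (rdc.cl w) = rdc.cl (sti v w)"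
  using laurent_inv[of "var 1" 1 "ivar 1"]
  by (simp_all add: standard_quandle_def Let_def rdc.carrier_M rdc.M_sc rdc.M_add st_def sti_def)

definition K1 :: "(space set \<Rightarrow> laurent) set" where
  "K1 = {v \<in> fn L 1. rdc.phi v = 0}"

lemma invariant_simps:
  "carrier (standard_quandle (alex_invariant_red L)) = rdc.cl ` K1"
  "tri (standard_quandle (alex_invariant_red L)) = tri (standard_quandle (M_A_red L))"
  "trinv (standard_quandle (alex_invariant_red L)) = trinv (standard_quandle (M_A_red L))"
  by (auto simp: standard_quandle_def Let_def alex_invariant_red_def rdc.carrier_M K1_def rdc.alex_phi_cl)

lemma K1_fn: "v \<in> K1 \<Longrightarrow> v \<in> fn L 1"
  by (simp add: K1_def)

lemma st_closed [simp]:
  "v \<in> fn L 1 \<Longrightarrow> w \<in> fn L 1 \<Longrightarrow> st v w \<in> fn L 1" "v \<in> fn L 1 \<Longrightarrow> w \<in> fn L 1 \<Longrightarrow> sti v w \<in> fn L 1"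
  "v \<in> K1 \<Longrightarrow> w \<in> K1 \<Longrightarrow> st v w \<in> K1" "v \<in> K1 \<Longrightarrow> w \<in> K1 \<Longrightarrow> sti v w \<in> K1"
  by (simp_all add: st_def sti_def K1_def)

end

definition lin :: "link \<Rightarrow> (space set \<Rightarrow> space set \<Rightarrow> laurent) \<Rightarrow> (space set \<Rightarrow> laurent) \<Rightarrow> space set \<Rightarrow> laurent" where
  "lin L p v = (\<Sum>a\<in>arcs L. sc (v a) (p a))"

lemma lin_simps [simp]:
  "lin L p 0 = 0" "lin L p (v + w) = lin L p v + lin L p w" "lin L p (v - w) = lin L p v - lin L p w"
  "lin L p (sc r v) = sc r (lin L p v)"
  by (simp_all add: lin_def fun_eq_iff fun_apply sum_fun_apply sum.distrib sum_subtractf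
      sum_distrib_left algebra_simps)

lemma (in wirtinger) lin_dl [simp]: "a \<in> arcs L \<Longrightarrow> lin L p (dl a) = p a"
  using finA by (simp add: lin_def fun_eq_iff fun_apply sum_fun_apply dl_def
      if_distrib[of "\<lambda>x. x * _"] cong: if_cong)

locale diagram_pair = A: wirtinger L + B: wirtinger L' for L L'
begin

text \<open>Isomorphisms of standard quandles are given by maps \<open>g\<close> of representatives
  that work modulo relations. The sets \<open>H\<close> and \<open>H'\<close> allow both the whole
  module and the kernel of phi; \<open>g\<close> may be nonlinear, which the examples use.\<close>

lemma quandles_isomorphicI:
  assumes H: "H \<subseteq> fn L 1" "H' \<subseteq> fn L' 1" and g: "\<And>v. v \<in> H \<Longrightarrow> g v \<in> H'"
    and eq: "\<And>v w. v \<in> H \<Longrightarrow> w \<in> H \<Longrightarrow> g v - g w \<in> B.rdc.spn \<longleftrightarrow> v - w \<in> A.rdc.spn"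
    and surj: "\<And>v'. v' \<in> H' \<Longrightarrow> \<exists>v\<in>H. g v - v' \<in> B.rdc.spn"
    and st: "\<And>v w. v \<in> H \<Longrightarrow> w \<in> H \<Longrightarrow> A.st v w \<in> H"
      "\<And>v w. v \<in> H \<Longrightarrow> w \<in> H \<Longrightarrow> g (A.st v w) - B.st (g v) (g w) \<in> B.rdc.spn"
    and sti: "\<And>v w. v \<in> H \<Longrightarrow> w \<in> H \<Longrightarrow> A.sti v w \<in> H"
      "\<And>v w. v \<in> H \<Longrightarrow> w \<in> H \<Longrightarrow> g (A.sti v w) - B.sti (g v) (g w) \<in> B.rdc.spn"
    and Q: "carrier Q = A.rdc.cl ` H" "tri Q = tri (standard_quandle (M_A_red L))"
      "trinv Q = trinv (standard_quandle (M_A_red L))"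
    and Q': "carrier Q' = B.rdc.cl ` H'" "tri Q' = tri (standard_quandle (M_A_red L'))"
      "trinv Q' = trinv (standard_quandle (M_A_red L'))"
  shows "quandles_isomorphic Q Q'"
proof -
  \<comment> \<open>The representative is chosen inside \<open>H\<close>, because only there is
    \<open>g\<close> known to respect congruence.\<close>
  define r where "r X = (SOME v. v \<in> H \<and> A.rdc.cl v = X)" for X
  define f where "f X = B.rdc.cl (g (r X))" for X
  have fn: "v \<in> H \<Longrightarrow> v \<in> fn L 1" "v \<in> H \<Longrightarrow> g v \<in> fn L' 1" for v
    using H g by blast+
  have clg: "B.rdc.cl (g v) = B.rdc.cl (g w) \<longleftrightarrow> A.rdc.cl v = A.rdc.cl w" if "v \<in> H" "w \<in> H" for v w
    using that fn eq by (simp add: A.rdc.cl_eq B.rdc.cl_eq)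
  have f: "f (A.rdc.cl v) = B.rdc.cl (g v)" if "v \<in> H" for v
  proof -
    have "r (A.rdc.cl v) \<in> H \<and> A.rdc.cl (r (A.rdc.cl v)) = A.rdc.cl v"
      unfolding r_def by (rule someI[of _ v]) (use that in blast)
    then show ?thesis unfolding f_def using clg that by blast
  qed
  have "bij_betw f (carrier Q) (carrier Q')"
    unfolding bij_betw_def
  proof
    show "inj_on f (carrier Q)"
      unfolding Q(1) by (intro inj_onI) (use f clg in auto)
    have "X \<in> f ` A.rdc.cl ` H" if X: "X \<in> B.rdc.cl ` H'" for X
    proof -
      obtain v' where v': "v' \<in> H'" "X = B.rdc.cl v'" using X by blast
      obtain v where v: "v \<in> H" "g v - v' \<in> B.rdc.spn" using surj[OF v'(1)] by blast
      have "X = f (A.rdc.cl v)"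
        unfolding f[OF v(1)] v'(2) using v v' H(2) fn by (intro B.rdc.cl_eqI[symmetric]) auto
      then show ?thesis using v(1) by blast
    qed
    then show "f ` carrier Q = carrier Q'"
      unfolding Q(1) Q'(1) using f g by auto
  qed
  moreover have "f (tri Q X Y) = tri Q' (f X) (f Y) \<and> f (trinv Q X Y) = trinv Q' (f X) (f Y)"
    if XY: "X \<in> carrier Q" "Y \<in> carrier Q" for X Y
  proof -
    obtain v w where v: "v \<in> H" "X = A.rdc.cl v" and w: "w \<in> H" "Y = A.rdc.cl w"
      using XY unfolding Q(1) by blast
    have 1: "f (A.rdc.cl (A.st v w)) = B.rdc.cl (B.st (g v) (g w))"
      unfolding f[OF st(1)[OF v(1) w(1)]]
      by (intro B.rdc.cl_eqI st(2) v w fn st(1) B.st_closed)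
    have 2: "f (A.rdc.cl (A.sti v w)) = B.rdc.cl (B.sti (g v) (g w))"
      unfolding f[OF sti(1)[OF v(1) w(1)]]
      by (intro B.rdc.cl_eqI sti(2) v w fn sti(1) B.st_closed)
    show ?thesis
      unfolding Q Q' v(2) w(2) f[OF v(1)] f[OF w(1)]
      using 1 2 fn[OF v(1)] fn[OF w(1)] by (simp add: A.standard_simps B.standard_simps)
  qed
  ultimately show ?thesis
    unfolding quandles_isomorphic_def quandle_iso_def by blast
qed

lemma lin_fn:
  assumes "\<And>a. a \<in> arcs L \<Longrightarrow> p a \<in> fn L' 1" "v \<in> fn L 1"
  shows "lin L p v \<in> fn L' 1"
  using assms by (simp add: lin_def)

lemma lin_spn:
  assumes rel: "\<And>z. z \<in> crossings L \<Longrightarrow> sc (var 1) (p (right_arc L z)) - sc (var 1 - 1) (p (over_arc L z))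
      - p (left_arc L z) \<in> B.rdc.spn"
    and v: "v \<in> A.rdc.spn"
  shows "lin L p v \<in> B.rdc.spn"
  using v
proof (induction rule: A.rdc.spn_induct)
  case (add r z v)
  have "lin L p (A.rdc.rel z) = sc (var 1) (p (right_arc L z)) - sc (var 1 - 1) (p (over_arc L z))
      - p (left_arc L z)"
    using add by (simp add: A.rdc.rel_def fun_eq_iff fun_apply algebra_simps)
  then show ?case using add rel by simp
qed simp

lemma lin_phi:
  assumes "\<And>a. a \<in> arcs L \<Longrightarrow> B.rdc.phi (p a) = var 1 - 1"
  shows "B.rdc.phi (lin L p v) = A.rdc.phi v"
proof -
  have "B.rdc.phi (\<Sum>a\<in>S. sc (v a) (p a)) = (\<Sum>a\<in>S. v a * B.rdc.phi (p a))" for S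
    by (induction S rule: infinite_finite_induct) simp_all
  then show ?thesis using assms by (simp add: lin_def A.rdc.phi_def)
qed

text \<open>The operations of standard quandles are linear combinations, so a linear bijection
  modulo relations is an isomorphism of quandles. It also preserves phi and therefore restricts to
  the kernels.\<close>

lemma linear_same:
  assumes p: "\<And>a. a \<in> arcs L \<Longrightarrow> p a \<in> fn L' 1"
      "\<And>a. a \<in> arcs L \<Longrightarrow> B.rdc.phi (p a) = var 1 - 1"
    and spn: "\<And>v. v \<in> fn L 1 \<Longrightarrow> lin L p v \<in> B.rdc.spn \<longleftrightarrow> v \<in> A.rdc.spn"
    and surj: "\<And>v'. v' \<in> fn L' 1 \<Longrightarrow> \<exists>v\<in>fn L 1. lin L p v - v' \<in> B.rdc.spn"
  shows "same_standard_module L L' \<and> same_standard_invariant L L'"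
proof
  have eq: "lin L p v - lin L p w \<in> B.rdc.spn \<longleftrightarrow> v - w \<in> A.rdc.spn" if "v \<in> fn L 1" "w \<in> fn L 1" for v w
    using spn[of "v - w"] that by simp
  have st: "lin L p (A.st v w) = B.st (lin L p v) (lin L p w)"
    "lin L p (A.sti v w) = B.sti (lin L p v) (lin L p w)" for v w
    by (simp_all add: A.st_def B.st_def A.sti_def B.sti_def)
  show "same_standard_module L L'"
    unfolding same_standard_module_def
    by (rule quandles_isomorphicI[where g = "lin L p" and H = "fn L 1" and H' = "fn L' 1"])
      (use p surj eq in \<open>simp_all add: st A.standard_simps(1) B.standard_simps(1) lin_fn\<close>)
  \<comment> \<open>A preimage in the whole module automatically lies in the kernel, as the linear
    map preserves phi.\<close>
  have K1: "\<exists>v\<in>A.K1. lin L p v - v' \<in> B.rdc.spn" if v': "v' \<in> B.K1" for v'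
  proof -
    obtain v where v: "v \<in> fn L 1" "lin L p v - v' \<in> B.rdc.spn"
      using surj[OF B.K1_fn[OF v']] by blast
    have "A.rdc.phi v = 0"
      using B.rdc.phi_cong[OF v(2)] v' by (simp add: lin_phi[OF p(2)] B.K1_def)
    then show ?thesis using v by (auto simp: A.K1_def)
  qed
  have K1': "lin L p v \<in> B.K1" if "v \<in> A.K1" for v
    using that lin_fn[OF p(1)] lin_phi[OF p(2)] by (simp add: A.K1_def B.K1_def)
  have K1_fn: "A.K1 \<subseteq> fn L 1" "B.K1 \<subseteq> fn L' 1"
    using A.K1_fn B.K1_fn by blast+
  show "same_standard_invariant L L'"
    unfolding same_standard_invariant_def
    by (rule quandles_isomorphicI[where g = "lin L p" and H = "A.K1" and H' = "B.K1", OF K1_fn K1' eq K1])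
      (simp_all add: st A.invariant_simps B.invariant_simps A.K1_fn)
qed

end

context wirtinger
begin

text \<open>Used to show that a composite is the identity (\<open>c\<close> = 1), or the identity up
  to elements killed by (t - 1)^2: by linearity it is enough to look at the arcs.\<close>

lemma linear_extend:
  assumes N: "N 0 = 0" "\<And>v w. N (v + w) = N v + N w" "\<And>r v. N (sc r v) = sc r (N v)"
    and dl: "\<And>a. a \<in> arcs L \<Longrightarrow> sc c (N (dl a) - dl a) \<in> rdc.spn" and v: "v \<in> fn L 1"
  shows "sc c (N v - v) \<in> rdc.spn"
proof -
  have "sc c (N (\<Sum>a\<in>S. sc (v a) (dl a)) - (\<Sum>a\<in>S. sc (v a) (dl a))) \<in> rdc.spn"
    if "finite S" "S \<subseteq> arcs L" for S
    using that
  proof (induction S rule: finite_induct)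
    case (insert a S)
    have "sc (v a) (sc c (N (dl a) - dl a))
      + sc c (N (\<Sum>a\<in>S. sc (v a) (dl a)) - (\<Sum>a\<in>S. sc (v a) (dl a))) \<in> rdc.spn"
      using insert v by (intro rdc.spn_add rdc.spn_sc[OF _ dl]) auto
    then show ?case using insert by (simp add: N sc_right_distrib algebra_simps)
  qed (simp add: N)
  from this[OF finA order_refl] show ?thesis
    unfolding rdc.fn_expand[OF v, symmetric] .
qed

lemma Rd_tr: "Rd (tr v w) = sc (red (mul.phi w) + 1) (Rd v) - sc (red (mul.phi v)) (Rd w)"
  by (simp add: tr_def)

text \<open>phi is constant on cosets, so a chosen representative has the same type as any
  other.\<close>

lemma rep_U:
  assumes "X \<in> mul.cl ` U"
  shows "mul.rep X \<in> U" "mul.cl (mul.rep X) = X"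
    and rep_V: "X \<in> mul.cl ` V i \<Longrightarrow> mul.rep X \<in> V i" and rep_K: "X \<in> mul.cl ` K \<Longrightarrow> mul.rep X \<in> K"
proof -
  have *: "mul.rep X \<in> fn L (ncomp L)" "mul.cl (mul.rep X) = X"
    using mul.rep[of X] assms U_fn unfolding mul.carrier_M by blast+
  have phi: "mul.phi (mul.rep X) = mul.phi v" if "X = mul.cl v" "v \<in> fn L (ncomp L)" for v
    using * that by (intro mul.phi_cong) (simp add: mul.cl_eq)
  show "mul.cl (mul.rep X) = X" by (rule *)
  have **: "mul.rep X \<in> {v \<in> fn L (ncomp L). P (mul.phi v)}"
    if P: "X \<in> mul.cl ` {v \<in> fn L (ncomp L). P (mul.phi v)}" for P
  proof -
    obtain v where "v \<in> fn L (ncomp L)" "P (mul.phi v)" "X = mul.cl v" using P by blast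
    then show ?thesis using *(1) phi by simp
  qed
  show "mul.rep X \<in> U"
    using **[of "\<lambda>y. y + 1 \<in> Units R"] assms unfolding U_def by blast
  show "mul.rep X \<in> V i" if "X \<in> mul.cl ` V i"
    using **[of "\<lambda>y. y = var i - 1"] that unfolding V_def by blast
  show "mul.rep X \<in> K" if "X \<in> mul.cl ` K"
    using **[of "\<lambda>y. y = 0"] that unfolding K_def by blast
qed

lemma Rd_rep_cl:
  assumes "v \<in> fn L (ncomp L)"
  shows "Rd (mul.rep (mul.cl v)) - Rd v \<in> rdc.spn"
  using Rd_spn[OF mul.rep_cl(2)[OF assms]] by simp

lemma Rd_rep_tri:
  assumes X: "X \<in> carrier (total_quandle L)" and Y: "Y \<in> carrier (total_quandle L)"
  shows "Rd (mul.rep (tri (total_quandle L) X Y)) - Rd (tr (mul.rep X) (mul.rep Y)) \<in> rdc.spn"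
proof -
  note X = X[unfolded total_simps(1)] and Y = Y[unfolded total_simps(1)]
  have fn: "mul.rep X \<in> fn L (ncomp L)" "mul.rep Y \<in> fn L (ncomp L)"
    by (rule U_fn[OF rep_U(1)[OF X]], rule U_fn[OF rep_U(1)[OF Y]])
  show ?thesis
    using Rd_rep_cl[OF tr_fn[OF fn]] total_simps(2)[OF fn] rep_U(2)[OF X] rep_U(2)[OF Y] by simp
qed

end

subsection \<open>Isomorphisms of fundamental quandles\<close>

context diagram_pair
begin

text \<open>Only the values of \<open>f\<close> on arcs and on products of two arcs enter, so this
  serves fundamental and total quandles alike. The images of different arcs of a component may have
  different t_i; after reduction all of them act through the same t.\<close>

lemma arc_images:
  fixes f :: "alex \<Rightarrow> alex"
  defines "p \<equiv> \<lambda>a. Rd (B.mul.rep (f (A.mul.cl (dl a))))"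
  assumes V: "\<And>a. a \<in> arcs L \<Longrightarrow> \<exists>i\<in>{1..ncomp L'}. f (A.mul.cl (dl a)) \<in> B.mul.cl ` B.V i"
    and hom: "\<And>a b. a \<in> arcs L \<Longrightarrow> b \<in> arcs L \<Longrightarrow> f (tri (total_quandle L) (A.mul.cl (dl a)) (A.mul.cl (dl b)))
      = tri (total_quandle L') (f (A.mul.cl (dl a))) (f (A.mul.cl (dl b)))"
  shows "a \<in> arcs L \<Longrightarrow> p a \<in> fn L' 1" "a \<in> arcs L \<Longrightarrow> B.rdc.phi (p a) = var 1 - 1"
    and "v \<in> A.rdc.spn \<Longrightarrow> lin L p v \<in> B.rdc.spn"
proof -
  have BV: "f (A.mul.cl (dl a)) \<in> carrier (total_quandle L') \<and> (\<exists>i. B.mul.rep (f (A.mul.cl (dl a))) \<in> B.V i)"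
    if a: "a \<in> arcs L" for a
  proof -
    obtain i where i: "i \<in> {1..ncomp L'}" "f (A.mul.cl (dl a)) \<in> B.mul.cl ` B.V i" using V[OF a] by blast
    then have U: "f (A.mul.cl (dl a)) \<in> B.mul.cl ` B.U" using B.V_U by blast
    show ?thesis using U B.rep_V[OF U i(2)] unfolding B.total_simps(1) by blast
  qed
  show "p a \<in> fn L' 1" "B.rdc.phi (p a) = var 1 - 1" if a: "a \<in> arcs L" for a
  proof -
    obtain i where "B.mul.rep (f (A.mul.cl (dl a))) \<in> B.V i" using BV[OF a] by blast
    then show "p a \<in> fn L' 1" "B.rdc.phi (p a) = var 1 - 1"
      unfolding p_def B.phi_Rd by (auto simp: B.V_def intro: Rd_fn)
  qed
  show "lin L p v \<in> B.rdc.spn" if v: "v \<in> A.rdc.spn" for v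
  proof (rule lin_spn[OF _ v])
    fix z assume z: "z \<in> crossings L"
    let ?X = "A.mul.cl (dl (right_arc L z))" and ?Y = "A.mul.cl (dl (over_arc L z))"
      and ?Z = "A.mul.cl (dl (left_arc L z))"
    have "A.tr (dl (right_arc L z)) (dl (over_arc L z)) - dl (left_arc L z) = A.mul.rel z"
      using z by (simp add: A.tr_def A.mul.rel_def fun_eq_iff fun_apply algebra_simps)
    then have "tri (total_quandle L) ?X ?Y = ?Z"
      using z A.mul.rel_spn[OF z] by (simp add: A.total_simps A.mul.cl_eq)
    then have fZ: "f ?Z = tri (total_quandle L') (f ?X) (f ?Y)"
      using hom[of "right_arc L z" "over_arc L z"] z by simp
    have X: "f ?X \<in> carrier (total_quandle L')" and Y: "f ?Y \<in> carrier (total_quandle L')"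
      using BV z by simp_all
    obtain i j where "B.mul.rep (f ?X) \<in> B.V i" "B.mul.rep (f ?Y) \<in> B.V j"
      using BV A.right_arc[OF z] A.over_arc[OF z] by blast
    then have "Rd (B.mul.rep (f ?Z)) - (sc (var 1) (Rd (B.mul.rep (f ?X))) - sc (var 1 - 1) (Rd (B.mul.rep (f ?Y))))
      \<in> B.rdc.spn"
      using B.Rd_rep_tri[OF X Y] unfolding fZ by (simp add: B.Rd_tr B.V_def)
    from B.rdc.spn_commute[OF this]
    show "sc (var 1) (p (right_arc L z)) - sc (var 1 - 1) (p (over_arc L z)) - p (left_arc L z) \<in> B.rdc.spn"
      by (simp add: p_def)
  qed
qed

text \<open>The last claim is the one that makes inverses work: the linear map built from arcs
  agrees with the reduction of \<open>f\<close> on the entire fundamental quandle. The discrepancy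
  vanishes on arcs and is propagated through both operations.\<close>

lemma fundamental_images:
  fixes f :: "alex \<Rightarrow> alex"
  defines "p \<equiv> \<lambda>a. Rd (B.mul.rep (f (A.mul.cl (dl a))))"
  assumes f: "\<And>X. X \<in> A.Q \<Longrightarrow> f X \<in> B.Q"
    and hom: "\<And>X Y. X \<in> A.Q \<Longrightarrow> Y \<in> A.Q \<Longrightarrow>
      f (tri (total_quandle L) X Y) = tri (total_quandle L') (f X) (f Y)"
  shows "a \<in> arcs L \<Longrightarrow> p a \<in> fn L' 1" "a \<in> arcs L \<Longrightarrow> B.rdc.phi (p a) = var 1 - 1"
    and "v \<in> A.rdc.spn \<Longrightarrow> lin L p v \<in> B.rdc.spn"
    and "X \<in> A.Q \<Longrightarrow> lin L p (Rd (A.mul.rep X)) - Rd (B.mul.rep (f X)) \<in> B.rdc.spn"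
proof -
  have AV: "\<exists>i. A.mul.rep X \<in> A.V i" and AU: "X \<in> carrier (total_quandle L)" if "X \<in> A.Q" for X
    using that A.Q_V A.Q_total A.rep_V unfolding A.total_simps(1) by blast+
  have BV: "\<exists>i. B.mul.rep X \<in> B.V i" and BU: "X \<in> carrier (total_quandle L')" if "X \<in> B.Q" for X
    using that B.Q_V B.Q_total B.rep_V unfolding B.total_simps(1) by blast+
  have V: "\<exists>i\<in>{1..ncomp L'}. f (A.mul.cl (dl a)) \<in> B.mul.cl ` B.V i" if "a \<in> arcs L" for a
    using f[OF A.Q_dl[OF that]] B.Q_V by blast
  have hom': "f (tri (total_quandle L) (A.mul.cl (dl a)) (A.mul.cl (dl b)))
      = tri (total_quandle L') (f (A.mul.cl (dl a))) (f (A.mul.cl (dl b)))" if "a \<in> arcs L" "b \<in> arcs L" for a b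
    by (rule hom[OF A.Q_dl[OF that(1)] A.Q_dl[OF that(2)]])
  show "p a \<in> fn L' 1" if "a \<in> arcs L" for a
    unfolding p_def by (rule arc_images(1)[of f]; fact V hom' that)
  show "B.rdc.phi (p a) = var 1 - 1" if "a \<in> arcs L" for a
    unfolding p_def by (rule arc_images(2)[of f]; fact V hom' that)
  show spn: "lin L p v \<in> B.rdc.spn" if "v \<in> A.rdc.spn" for v
    unfolding p_def by (rule arc_images(3)[of f]; fact V hom' that)
  have A_tri: "Rd (A.mul.rep (tri (total_quandle L) X Y))
      - (sc (var 1) (Rd (A.mul.rep X)) - sc (var 1 - 1) (Rd (A.mul.rep Y))) \<in> A.rdc.spn"
    if XY: "X \<in> A.Q" "Y \<in> A.Q" for X Y
  proof -
    obtain i j where "A.mul.rep X \<in> A.V i" "A.mul.rep Y \<in> A.V j" using AV XY by blast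
    then show ?thesis
      using A.Rd_rep_tri[OF AU[OF XY(1)] AU[OF XY(2)]] by (simp add: A.Rd_tr A.V_def)
  qed
  have B_tri: "Rd (B.mul.rep (tri (total_quandle L') X Y))
      - (sc (var 1) (Rd (B.mul.rep X)) - sc (var 1 - 1) (Rd (B.mul.rep Y))) \<in> B.rdc.spn"
    if XY: "X \<in> B.Q" "Y \<in> B.Q" for X Y
  proof -
    obtain i j where "B.mul.rep X \<in> B.V i" "B.mul.rep Y \<in> B.V j" using BV XY by blast
    then show ?thesis
      using B.Rd_rep_tri[OF BU[OF XY(1)] BU[OF XY(2)]] by (simp add: B.Rd_tr B.V_def)
  qed
  \<comment> \<open>The discrepancy between the linear map and the reduction of \<open>f\<close>;
    modulo relations it behaves under products like the reduced operation itself.\<close>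
  define D where "D X = lin L p (Rd (A.mul.rep X)) - Rd (B.mul.rep (f X))" for X
  have D_tri: "D (tri (total_quandle L) X Y) - (sc (var 1) (D X) - sc (var 1 - 1) (D Y)) \<in> B.rdc.spn"
    if XY: "X \<in> A.Q" "Y \<in> A.Q" for X Y
  proof -
    have eq: "D (tri (total_quandle L) X Y) - (sc (var 1) (D X) - sc (var 1 - 1) (D Y)) =
      lin L p (Rd (A.mul.rep (tri (total_quandle L) X Y))
        - (sc (var 1) (Rd (A.mul.rep X)) - sc (var 1 - 1) (Rd (A.mul.rep Y))))
      - (Rd (B.mul.rep (tri (total_quandle L') (f X) (f Y)))
        - (sc (var 1) (Rd (B.mul.rep (f X))) - sc (var 1 - 1) (Rd (B.mul.rep (f Y)))))"
      unfolding D_def hom[OF XY] lin_simps by (simp add: fun_eq_iff fun_apply algebra_simps)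
    show ?thesis
      unfolding eq by (rule B.rdc.spn_diff[OF spn[OF A_tri[OF XY]] B_tri[OF f[OF XY(1)] f[OF XY(2)]]])
  qed
  show "lin L p (Rd (A.mul.rep X)) - Rd (B.mul.rep (f X)) \<in> B.rdc.spn" if X: "X \<in> A.Q" for X
    unfolding D_def[symmetric] using X
  proof (induction rule: A.Q_induct)
    case (dl a)
    have "lin L p (Rd (A.mul.rep (A.mul.cl (dl a))) - Rd (dl a)) \<in> B.rdc.spn"
      using dl by (intro spn A.Rd_rep_cl) simp
    then show ?case using dl by (simp add: D_def p_def)
  next
    case (tri X Y)
    have "D (tri (total_quandle L) X Y) = ((D (tri (total_quandle L) X Y) - (sc (var 1) (D X) - sc (var 1 - 1) (D Y)))
      + sc (var 1) (D X)) - sc (var 1 - 1) (D Y)" by simp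
    also have "\<dots> \<in> B.rdc.spn"
      by (rule B.rdc.spn_diff[OF B.rdc.spn_add[OF D_tri[OF tri(1,2)] B.rdc.spn_sc[OF _ tri(3)]]
            B.rdc.spn_sc[OF _ tri(4)]]) simp_all
    finally show ?case .
  next
    case (trinv X Y)
    let ?W = "trinv (total_quandle L) X Y"
    have W: "?W \<in> A.Q" using trinv A.Q_trinv by simp
    have WX: "tri (total_quandle L) ?W Y = X"
      using A.total_is_quandle AU[OF trinv(1)] AU[OF trinv(2)] unfolding is_quandle_def by blast
    \<comment> \<open>The product of \<open>?W\<close> and Y is X; the resulting congruence for D X
      is solved for D \<open>?W\<close>, which is possible because t is a unit.\<close>
    have "D ?W = sc (ivar 1) (D X + sc (var 1 - 1) (D Y) - (D X - (sc (var 1) (D ?W) - sc (var 1 - 1) (D Y))))"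
      by (simp add: sc_right_distrib)
    also have "\<dots> \<in> B.rdc.spn"
      by (rule B.rdc.spn_sc[OF _ B.rdc.spn_diff[OF B.rdc.spn_add[OF trinv(3) B.rdc.spn_sc[OF _ trinv(4)]]
            D_tri[OF W trinv(2), unfolded WX]]]) simp_all
    finally show ?case .
  qed
qed

text \<open>The image of an arc under \<open>f\<close> need not be an arc, so the agreement of the
  second linear map with \<open>g\<close> on all of the fundamental quandle is applied at that
  image.\<close>

lemma fundamental_inverse:
  assumes f: "\<And>X. X \<in> A.Q \<Longrightarrow> f X \<in> B.Q"
      "\<And>X Y. X \<in> A.Q \<Longrightarrow> Y \<in> A.Q \<Longrightarrow> f (tri (total_quandle L) X Y) = tri (total_quandle L') (f X) (f Y)"
    and g: "\<And>X. X \<in> B.Q \<Longrightarrow> g X \<in> A.Q"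
      "\<And>X Y. X \<in> B.Q \<Longrightarrow> Y \<in> B.Q \<Longrightarrow> g (tri (total_quandle L') X Y) = tri (total_quandle L) (g X) (g Y)"
    and gf: "\<And>X. X \<in> A.Q \<Longrightarrow> g (f X) = X" and v: "v \<in> fn L 1"
  shows "lin L' (\<lambda>b. Rd (A.mul.rep (g (B.mul.cl (dl b))))) (lin L (\<lambda>a. Rd (B.mul.rep (f (A.mul.cl (dl a))))) v)
    - v \<in> A.rdc.spn"
proof -
  interpret C: diagram_pair L' L by unfold_locales
  define p where "p = (\<lambda>a. Rd (B.mul.rep (f (A.mul.cl (dl a)))))"
  define q where "q = (\<lambda>b. Rd (A.mul.rep (g (B.mul.cl (dl b)))))"
  have "lin L' q (p a) - dl a \<in> A.rdc.spn" if a: "a \<in> arcs L" for a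
  proof -
    have "lin L' q (p a) - Rd (A.mul.rep (g (f (A.mul.cl (dl a))))) \<in> A.rdc.spn"
      unfolding p_def q_def
      by (rule C.fundamental_images(4)[of g]; fact g f(1)[OF A.Q_dl[OF a]])
    moreover have "Rd (A.mul.rep (g (f (A.mul.cl (dl a))))) - dl a \<in> A.rdc.spn"
      using A.Rd_rep_cl[of "dl a"] gf[OF A.Q_dl[OF a]] a by simp
    ultimately have "lin L' q (p a) - Rd (A.mul.rep (g (f (A.mul.cl (dl a)))))
      + (Rd (A.mul.rep (g (f (A.mul.cl (dl a))))) - dl a) \<in> A.rdc.spn"
      by (rule A.rdc.spn_add)
    then show ?thesis by simp
  qed
  then have "sc 1 (lin L' q (lin L p v) - v) \<in> A.rdc.spn"
    by (intro A.linear_extend[where N = "\<lambda>v. lin L' q (lin L p v)", OF _ _ _ _ v]) simp_all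
  then show ?thesis by (simp add: p_def q_def)
qed

lemma fundamental_same:
  assumes "same_fundamental L L'"
  shows "same_standard_module L L' \<and> same_standard_invariant L L'"
proof -
  interpret C: diagram_pair L' L by unfold_locales
  obtain f where f: "bij_betw f A.Q B.Q"
    "\<And>X Y. X \<in> A.Q \<Longrightarrow> Y \<in> A.Q \<Longrightarrow> f (tri (total_quandle L) X Y) = tri (total_quandle L') (f X) (f Y)"
    using assms unfolding same_fundamental_def quandles_isomorphic_def quandle_iso_def
    by (auto simp: A.fundamental_simps B.fundamental_simps)
  define g where "g = inv_into A.Q f"
  have gf: "\<And>X. X \<in> A.Q \<Longrightarrow> g (f X) = X" and fg: "\<And>X. X \<in> B.Q \<Longrightarrow> f (g X) = X"
    and fQ: "\<And>X. X \<in> A.Q \<Longrightarrow> f X \<in> B.Q" and gQ: "\<And>X. X \<in> B.Q \<Longrightarrow> g X \<in> A.Q"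
    using bij_betw_inv_into_left[OF f(1)] bij_betw_inv_into_right[OF f(1)]
      bij_betwE[OF bij_betw_inv_into[OF f(1)]] bij_betwE[OF f(1)] unfolding g_def by blast+
  have g: "g (tri (total_quandle L') X Y) = tri (total_quandle L) (g X) (g Y)" if "X \<in> B.Q" "Y \<in> B.Q" for X Y
    using f(2)[OF gQ[OF that(1)] gQ[OF that(2)]] gf[OF A.Q_tri[OF gQ[OF that(1)] gQ[OF that(2)]]] fg that by simp
  define p where "p = (\<lambda>a. Rd (B.mul.rep (f (A.mul.cl (dl a)))))"
  define q where "q = (\<lambda>a. Rd (A.mul.rep (g (B.mul.cl (dl a)))))"
  have p: "p a \<in> fn L' 1" "B.rdc.phi (p a) = var 1 - 1" if "a \<in> arcs L" for a
    unfolding p_def by (rule fundamental_images(1,2)[of f]; fact fQ f(2) that)+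
  have p_spn: "lin L p v \<in> B.rdc.spn" if "v \<in> A.rdc.spn" for v
    unfolding p_def by (rule fundamental_images(3)[of f]; fact fQ f(2) that)
  have q: "q b \<in> fn L 1" if "b \<in> arcs L'" for b
    unfolding q_def by (rule C.fundamental_images(1)[of g]; fact gQ g that)
  have q_spn: "lin L' q v \<in> A.rdc.spn" if "v \<in> B.rdc.spn" for v
    unfolding q_def by (rule C.fundamental_images(3)[of g]; fact gQ g that)
  have qp: "lin L' q (lin L p v) - v \<in> A.rdc.spn" if "v \<in> fn L 1" for v
    unfolding p_def q_def by (rule fundamental_inverse[of f g]; fact fQ f(2) gQ g gf that)
  have pq: "lin L p (lin L' q v) - v \<in> B.rdc.spn" if "v \<in> fn L' 1" for v
    unfolding p_def q_def by (rule C.fundamental_inverse[of g f]; fact gQ g fQ f(2) fg that)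
  show ?thesis
  proof (rule linear_same[of p])
    fix v assume v: "v \<in> fn L 1"
    show "lin L p v \<in> B.rdc.spn \<longleftrightarrow> v \<in> A.rdc.spn"
    proof
      assume "lin L p v \<in> B.rdc.spn"
      from A.rdc.spn_diff[OF q_spn[OF this] qp[OF v]] show "v \<in> A.rdc.spn" by simp
    qed (rule p_spn)
  next
    fix v' assume v': "v' \<in> fn L' 1"
    show "\<exists>v\<in>fn L 1. lin L p v - v' \<in> B.rdc.spn"
      by (rule bexI[of _ "lin L' q v'"]) (use pq[OF v'] C.lin_fn[of q v'] q v' in auto)
  qed (use p in auto)
qed

end

subsection \<open>Isomorphisms of total quandles\<close>

context wirtinger
begin

text \<open>N is the identity plus an endomorphism with values in (t - 1) M that are annihilated by
  (t - 1)^m. Expanding in powers of t - 1 stops after m steps, both for the kernel and for the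
  construction of a preimage.\<close>

lemma unipotent:
  assumes N: "\<And>v w. N (v + w) = N v + N w" "\<And>v w. N (v - w) = N v - N w" "\<And>r v. N (sc r v) = sc r (N v)"
    and fn: "\<And>v. v \<in> fn L 1 \<Longrightarrow> N v \<in> fn L 1" and spn: "\<And>v. v \<in> rdc.spn \<Longrightarrow> N v \<in> rdc.spn"
    and u1: "\<And>v. v \<in> fn L 1 \<Longrightarrow> \<exists>w\<in>fn L 1. N v - v - sc (var 1 - 1) w \<in> rdc.spn"
    and u2: "\<And>v. v \<in> fn L 1 \<Longrightarrow> sc ((var 1 - 1) ^ m) (N v - v) \<in> rdc.spn"
    and v: "v \<in> fn L 1"
  shows "N v \<in> rdc.spn \<Longrightarrow> v \<in> rdc.spn" and "\<exists>u\<in>fn L 1. N u - v \<in> rdc.spn"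
proof -
  have t: "(var 1 - 1) ^ j \<in> lring 1" for j
    by (induction j) auto
  show "v \<in> rdc.spn" if Nv: "N v \<in> rdc.spn"
  proof -
    \<comment> \<open>An element of the kernel is divisible by every power of t - 1: if v = (t -
      1)^j w, then 0 = N v = (t - 1)^j (w + (t - 1) w'), so v = -(t - 1)^(j+1) w'.\<close>
    have "\<exists>w\<in>fn L 1. v - sc ((var 1 - 1) ^ j) w \<in> rdc.spn" for j
    proof (induction j)
      case 0
      show ?case using v by (intro bexI[of _ v]) auto
    next
      case (Suc j)
      then obtain w where w: "w \<in> fn L 1" "v - sc ((var 1 - 1) ^ j) w \<in> rdc.spn" by blast
      obtain w' where w': "w' \<in> fn L 1" "N w - w - sc (var 1 - 1) w' \<in> rdc.spn" using u1[OF w(1)] by blast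
      have "v - sc ((var 1 - 1) ^ Suc j) (- w') =
        (v - sc ((var 1 - 1) ^ j) w) + (N v - N (v - sc ((var 1 - 1) ^ j) w))
        - sc ((var 1 - 1) ^ j) (N w - w - sc (var 1 - 1) w')"
        unfolding N by (simp add: fun_eq_iff fun_apply algebra_simps)
      also have "\<dots> \<in> rdc.spn"
        by (rule rdc.spn_diff[OF rdc.spn_add[OF w(2) rdc.spn_diff[OF Nv spn[OF w(2)]]] rdc.spn_sc[OF t w'(2)]])
      finally show ?case using w'(1) by (intro bexI[of _ "- w'"]) auto
    qed
    then obtain w where w: "w \<in> fn L 1" "v - sc ((var 1 - 1) ^ m) w \<in> rdc.spn" by blast
    \<comment> \<open>At the power m the values of w and N w agree, so v = (t - 1)^m w = (t - 1)^m N
      w = N v = 0.\<close>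
    have "v = (v - sc ((var 1 - 1) ^ m) w) + (N v - N (v - sc ((var 1 - 1) ^ m) w)) - sc ((var 1 - 1) ^ m) (N w - w)"
      unfolding N by (simp add: fun_eq_iff fun_apply algebra_simps)
    also have "\<dots> \<in> rdc.spn"
      by (rule rdc.spn_diff[OF rdc.spn_add[OF w(2) rdc.spn_diff[OF Nv spn[OF w(2)]]] u2[OF w(1)]])
    finally show ?thesis .
  qed
  \<comment> \<open>Successive approximation of a preimage: adding the error term to u raises the
    power of t - 1 that divides the error.\<close>
  have "\<exists>u\<in>fn L 1. \<exists>w\<in>fn L 1. N u - v + sc ((var 1 - 1) ^ j) w \<in> rdc.spn" for j
  proof (induction j)
    case 0
    show ?case
      using v N(2)[of 0 0] by (intro bexI[of _ 0] bexI[of _ v]) auto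
  next
    case (Suc j)
    then obtain u w where u: "u \<in> fn L 1" and w: "w \<in> fn L 1" "N u - v + sc ((var 1 - 1) ^ j) w \<in> rdc.spn" by blast
    obtain w' where w': "w' \<in> fn L 1" "N w - w - sc (var 1 - 1) w' \<in> rdc.spn" using u1[OF w(1)] by blast
    have "N (u + sc ((var 1 - 1) ^ j) w) - v + sc ((var 1 - 1) ^ Suc j) (- w') =
      (N u - v + sc ((var 1 - 1) ^ j) w) + sc ((var 1 - 1) ^ j) (N w - w - sc (var 1 - 1) w')"
      unfolding N by (simp add: fun_eq_iff fun_apply algebra_simps)
    also have "\<dots> \<in> rdc.spn"
      by (rule rdc.spn_add[OF w(2) rdc.spn_sc[OF t w'(2)]])
    finally show ?case using u w(1) w'(1) t by (intro bexI[of _ "u + sc ((var 1 - 1) ^ j) w"] bexI[of _ "- w'"]) auto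
  qed
  then obtain u w where u: "u \<in> fn L 1" and w: "w \<in> fn L 1" "N u - v + sc ((var 1 - 1) ^ m) w \<in> rdc.spn" by blast
  have "N (u + sc ((var 1 - 1) ^ m) w) - v =
      (N u - v + sc ((var 1 - 1) ^ m) w) + sc ((var 1 - 1) ^ m) (N w - w)"
    unfolding N by (simp add: fun_eq_iff fun_apply algebra_simps)
  also have "\<dots> \<in> rdc.spn"
    by (rule rdc.spn_add[OF w(2) u2[OF w(1)]])
  finally show "\<exists>u\<in>fn L 1. N u - v \<in> rdc.spn"
    using u w t by (intro bexI[of _ "u + sc ((var 1 - 1) ^ m) w"]) auto
qed

text \<open>The coordinate for component i of the reduced module modulo t - 1, which is free abelian
  with one generator for each component.\<close>

definition th :: "nat \<Rightarrow> (space set \<Rightarrow> laurent) \<Rightarrow> int" where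
  "th i v = (\<Sum>a\<in>arcs L. if arc_comp L a = i then aug (v a) else 0)"

lemma th_simps [simp]:
  "th i 0 = 0" "th i (v + w) = th i v + th i w" "th i (v - w) = th i v - th i w"
  "th i (sc r v) = aug r * th i v" "th i (Rd v) = th i v"
  "a \<in> arcs L \<Longrightarrow> th i (dl a) = (if arc_comp L a = i then 1 else 0)"
proof -
  show "th i (dl a) = (if arc_comp L a = i then 1 else 0)" if "a \<in> arcs L"
  proof -
    have "th i (dl a) = (\<Sum>b\<in>arcs L. if b = a then (if arc_comp L a = i then 1 else 0) else 0)"
      unfolding th_def by (intro sum.cong) (auto simp: dl_def)
    then show ?thesis using that finA by simp
  qed
  show "th i 0 = 0" by (simp add: th_def fun_apply cong: if_cong)
qed (auto simp: th_def fun_apply Rd_def sum.distrib[symmetric] sum_subtractf[symmetric] sum_distrib_left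
    intro!: sum.cong)

lemma th_spn: "v \<in> rdc.spn \<Longrightarrow> th i v = 0"
  by (induction rule: rdc.spn_induct) (simp_all add: rdc.rel_def comp_left)

text \<open>phi determines these coordinates as its partial derivatives at 1. This is how
  compatibility of an isomorphism with phi controls the induced linear map modulo t - 1.\<close>

lemma th_expt: "th i v = expt i (mul.phi v)"
  unfolding th_def mul.phi_def expt_sum by (intro sum.cong) (simp_all add: expt_mult_var)

text \<open>Modulo t - 1 the arcs of one component coincide and coefficients become integers. So v
  is congruent to the combination of one arc from each component with coefficients
  \<open>th i v\<close>.\<close>

lemma th_zero_imp:
  assumes v: "v \<in> fn L 1" and th: "\<And>i. i \<in> {1..ncomp L} \<Longrightarrow> th i v = 0"
  shows "\<exists>w\<in>fn L 1. v - sc (var 1 - 1) w \<in> rdc.spn"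
proof -
  define X where "X = {v \<in> fn L 1. \<exists>w\<in>fn L 1. v - sc (var 1 - 1) w \<in> rdc.spn}"
  have X_add: "x + y \<in> X" if xy: "x \<in> X" "y \<in> X" for x y
  proof -
    obtain w w' where "w \<in> fn L 1" "x - sc (var 1 - 1) w \<in> rdc.spn"
      "w' \<in> fn L 1" "y - sc (var 1 - 1) w' \<in> rdc.spn" using xy unfolding X_def by blast
    then have "(x - sc (var 1 - 1) w) + (y - sc (var 1 - 1) w') \<in> rdc.spn" "w + w' \<in> fn L 1"
      by (blast intro: rdc.spn_add fn_closed)+
    moreover have "(x - sc (var 1 - 1) w) + (y - sc (var 1 - 1) w') = x + y - sc (var 1 - 1) (w + w')"
      by (simp add: sc_right_distrib)
    ultimately show ?thesis using xy unfolding X_def by auto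
  qed
  have X_sc: "sc r x \<in> X" if x: "x \<in> X" "r \<in> lring 1" for x r
  proof -
    obtain w where w: "w \<in> fn L 1" "x - sc (var 1 - 1) w \<in> rdc.spn" using x unfolding X_def by blast
    have "sc r (x - sc (var 1 - 1) w) = sc r x - sc (var 1 - 1) (sc r w)"
      by (simp add: sc_right_distrib mult.commute)
    then show ?thesis using x w rdc.spn_sc[OF x(2) w(2)] unfolding X_def
      by (intro CollectI conjI bexI[of _ "sc r w"]) auto
  qed
  have X_dl: "dl b - dl a \<in> X" if ab: "a \<in> arcs L" "b \<in> arcs L" "arc_comp L a = arc_comp L b" for a b
  proof -
    \<comment> \<open>Modulo t - 1 a crossing relation says that the two underpassing arcs are
      equal; \<open>conn\<close> then spreads this along the component.\<close>
    have lr: "dl (left_arc L z) - dl (right_arc L z) \<in> X" if z: "z \<in> crossings L" for z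
    proof -
      have "dl (left_arc L z) - dl (right_arc L z) - sc (var 1 - 1) (dl (right_arc L z) - dl (over_arc L z))
        = - rdc.rel z" by (simp add: rdc.rel_def fun_eq_iff fun_apply algebra_simps)
      then show ?thesis using z rdc.spn_uminus[OF rdc.rel_spn[OF z]] unfolding X_def
        by (auto intro!: bexI[of _ "dl (right_arc L z) - dl (over_arc L z)"])
    qed
    have "b \<in> {b. dl b - dl a \<in> X}"
    proof (rule conn[OF _ _ ab(1) ab(2) ab(3)])
      show "right_arc L z \<in> {b. dl b - dl a \<in> X} \<longleftrightarrow> left_arc L z \<in> {b. dl b - dl a \<in> X}"
        if z: "z \<in> crossings L" for z
        using X_add[OF lr[OF z], of "dl (right_arc L z) - dl a"]
          X_add[OF X_sc[OF lr[OF z], of "- 1"], of "dl (left_arc L z) - dl a"]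
        by (auto simp: sc_minus_one)
      show "a \<in> {b. dl b - dl a \<in> X}" by (auto simp: X_def intro!: bexI[of _ 0])
    qed
    then show ?thesis by simp
  qed
  have X_aug: "sc p (dl a) - sc (of_int (aug p)) (dl a) \<in> X" if pa: "p \<in> lring 1" "a \<in> arcs L" for p a
  proof -
    obtain q where q: "q \<in> lring 1" "p - of_int (aug p) = (var 1 - 1) * q" using aug_dvd[OF pa(1)] by blast
    have "sc p (dl a) - sc (of_int (aug p)) (dl a) = sc (var 1 - 1) (sc q (dl a))"
      using q(2) by (simp add: fun_eq_iff fun_apply left_diff_distrib[symmetric])
    then show ?thesis using pa q unfolding X_def by (auto intro!: bexI[of _ "sc q (dl a)"])
  qed
  define r where "r i = (SOME a. a \<in> arcs L \<and> arc_comp L a = i)" for i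
  have r: "r (arc_comp L a) \<in> arcs L" "arc_comp L (r (arc_comp L a)) = arc_comp L a" if "a \<in> arcs L" for a
    using someI[of "\<lambda>b. b \<in> arcs L \<and> arc_comp L b = arc_comp L a" a] that unfolding r_def by auto
  have "sc (v a) (dl a) - sc (of_int (aug (v a))) (dl (r (arc_comp L a))) \<in> X" if a: "a \<in> arcs L" for a
  proof -
    have "sc (v a) (dl a) - sc (of_int (aug (v a))) (dl (r (arc_comp L a))) =
      (sc (v a) (dl a) - sc (of_int (aug (v a))) (dl a)) + sc (of_int (aug (v a))) (dl a - dl (r (arc_comp L a)))"
      by (simp add: sc_right_distrib)
    also have "\<dots> \<in> X"
      using r[OF a] v a by (intro X_add[OF X_aug X_sc[OF X_dl]]) auto
    finally show ?thesis .
  qed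
  note summand = this
  have "(\<Sum>a\<in>S. sc (v a) (dl a) - sc (of_int (aug (v a))) (dl (r (arc_comp L a)))) \<in> X"
    if "finite S" "S \<subseteq> arcs L" for S
    using that
  proof (induction S rule: finite_induct)
    case empty
    show ?case by (auto simp: X_def intro!: bexI[of _ 0])
  next
    case (insert a S)
    then show ?case by (simp add: X_add[OF summand])
  qed
  from this[OF finA order_refl]
  have "v - (\<Sum>a\<in>arcs L. sc (of_int (aug (v a))) (dl (r (arc_comp L a)))) \<in> X"
    using rdc.fn_expand[OF v] by (simp add: sum_subtractf)
  \<comment> \<open>Grouping by components collects exactly \<open>th i v\<close> in front of the
    representative arc of component i.\<close>
  moreover have "(\<Sum>a\<in>arcs L. sc (of_int (aug (v a))) (dl (r (arc_comp L a)))) = (0 :: space set \<Rightarrow> laurent)"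
  proof -
    have "(\<Sum>a\<in>arcs L. sc (of_int (aug (v a))) (dl (r (arc_comp L a)) :: space set \<Rightarrow> laurent)) =
      (\<Sum>i\<in>{1..ncomp L}. \<Sum>a\<in>{a\<in>arcs L. arc_comp L a = i}. sc (of_int (aug (v a))) (dl (r (arc_comp L a))))"
      using arc_comp by (intro sum.group[symmetric] finA) auto
    also have "\<dots> = (\<Sum>i\<in>{1..ncomp L}. sc (of_int (th i v)) (dl (r i)))"
    proof (intro sum.cong refl)
      fix i
      have "(\<Sum>a\<in>{a\<in>arcs L. arc_comp L a = i}. sc (of_int (aug (v a))) (dl (r (arc_comp L a)))) =
        (\<Sum>a\<in>{a\<in>arcs L. arc_comp L a = i}. sc (of_int (aug (v a))) (dl (r i)))"
        by (intro sum.cong) auto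
      also have "\<dots> = sc (of_int (th i v)) (dl (r i))"
      proof -
        have "th i v = (\<Sum>a\<in>{a\<in>arcs L. arc_comp L a = i}. aug (v a))"
          using finA by (simp add: th_def sum.inter_filter)
        then show ?thesis
          by (simp add: fun_eq_iff sum_fun_apply sc_apply sum_distrib_right)
      qed
      finally show "(\<Sum>a\<in>{a\<in>arcs L. arc_comp L a = i}. sc (of_int (aug (v a))) (dl (r (arc_comp L a)))) =
        sc (of_int (th i v)) (dl (r i))" .
    qed
    also have "\<dots> = 0" using th by simp
    finally show ?thesis .
  qed
  ultimately show ?thesis unfolding X_def by simp
qed

end

context diagram_pair
begin

text \<open>\<open>D\<close> is the difference of two quandle homomorphisms that agree on arcs.  The element \<open>kz a\<close> below
  comes from the commutator of the actions of \<open>a\<close> and \<open>b\<close>; since \<open>\<phi> k = 0\<close>, the element \<open>(t\<^sub>j - 1) k\<close> is the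
  combination of the \<open>kz a\<close> with the coefficients of \<open>k\<close>, which makes Koszul exactness unnecessary.\<close>

lemma torsion:
  fixes D :: "(space set \<Rightarrow> laurent) \<Rightarrow> space set \<Rightarrow> laurent"
  assumes VV: "\<And>v w i j. v \<in> A.V i \<Longrightarrow> w \<in> A.V j \<Longrightarrow> i \<in> {1..ncomp L} \<Longrightarrow> j \<in> {1..ncomp L} \<Longrightarrow>
      D (A.tr v w) - (sc (var 1) (D v) - sc (var 1 - 1) (D w)) \<in> B.rdc.spn"
    and VK: "\<And>v k i. v \<in> A.V i \<Longrightarrow> k \<in> A.K \<Longrightarrow> i \<in> {1..ncomp L} \<Longrightarrow>
      D (A.tr v k) - (D v - sc (var 1 - 1) (D k)) \<in> B.rdc.spn"
    and KV: "\<And>v k i. v \<in> A.V i \<Longrightarrow> k \<in> A.K \<Longrightarrow> i \<in> {1..ncomp L} \<Longrightarrow>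
      D (A.tr k v) - sc (var 1) (D k) \<in> B.rdc.spn"
    and dl: "\<And>a. a \<in> arcs L \<Longrightarrow> D (dl a) \<in> B.rdc.spn"
    and y: "y \<in> A.V j" "j \<in> {1..ncomp L}"
  shows "sc ((var 1 - 1) ^ 2) (D y) \<in> B.rdc.spn"
proof -
  define E where "E v = sc (var 1 - 1) (D v)" for v
  have K: "k + k' \<in> A.K" "k - k' \<in> A.K" "0 \<in> A.K" if "k \<in> A.K" "k' \<in> A.K" for k k'
    using that by (auto simp: A.K_def)
  have K_sc: "sc r k \<in> A.K" if "k \<in> A.K" "r \<in> lring (ncomp L)" for r k
    using that by (auto simp: A.K_def)
  have dlV: "dl a \<in> A.V (arc_comp L a)" "arc_comp L a \<in> {1..ncomp L}" if "a \<in> arcs L" for a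
    by (rule A.dl_V[OF that], rule A.arc_comp[OF that])
  obtain b where b: "b \<in> arcs L" "arc_comp L b = j" using A.comp_arc[OF y(2)] by blast
  have bV: "dl b \<in> A.V j" using dlV[OF b(1)] b(2) by simp
  have E_add: "E (k + k') - (E k + E k') \<in> B.rdc.spn" if k: "k \<in> A.K" "k' \<in> A.K" for k k'
  proof -
    let ?c = "dl b" and ?c1 = "A.tr (dl b) k"
    have c1: "?c1 \<in> A.V j" using bV A.tr_V A.K_fn[OF k(1)] by blast
    \<comment> \<open>Translations compose: both factors are scaled by the same phi, namely that of
      the arc \<open>b\<close>, which translation does not change.\<close>
    have eq: "A.tr ?c1 k' = A.tr ?c (k + k')"
      using k bV by (simp add: A.tr_def[of "A.tr _ _"]) (simp add: A.tr_def A.K_def A.V_def fun_eq_iff fun_apply algebra_simps)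
    have "(D (A.tr ?c (k + k')) - (D ?c - sc (var 1 - 1) (D (k + k'))))
      - (D (A.tr ?c1 k') - (D ?c1 - sc (var 1 - 1) (D k'))) - (D ?c1 - (D ?c - sc (var 1 - 1) (D k))) \<in> B.rdc.spn"
      by (rule B.rdc.spn_diff[OF B.rdc.spn_diff[OF VK[OF bV K(1)[OF k] y(2)] VK[OF c1 k(2) y(2)]] VK[OF bV k(1) y(2)]])
    then show ?thesis unfolding eq E_def by (simp add: algebra_simps)
  qed
  have E_diff: "E (k - k') - (E k - E k') \<in> B.rdc.spn" if k: "k \<in> A.K" "k' \<in> A.K" for k k'
    using B.rdc.spn_uminus[OF E_add[OF K(2)[OF k] k(2)]] by (simp add: algebra_simps)
  have E_zero: "E 0 \<in> B.rdc.spn"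
    using B.rdc.spn_uminus[OF E_add[of 0 0]] K(3) y by (simp add: A.K_def)
  \<comment> \<open>E becomes linear over reduction because multiplication of a kernel element by
    t_i is a quandle action, to which \<open>KV\<close> applies.\<close>
  have E_sc: "E (sc r k) - sc (red r) (E k) \<in> B.rdc.spn" if r: "r \<in> lring (ncomp L)" and k: "k \<in> A.K" for r k
    using r
  proof (induction r rule: lring_induct)
    case (diff r s)
    have eq: "sc (r - s) k = sc r k - sc s k" "sc (red (r - s)) (E k) = sc (red r) (E k) - sc (red s) (E k)"
      by (simp_all add: fun_eq_iff fun_apply algebra_simps)
    have "(E (sc r k - sc s k) - (E (sc r k) - E (sc s k))) + (E (sc r k) - sc (red r) (E k))
      - (E (sc s k) - sc (red s) (E k)) \<in> B.rdc.spn"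
      by (rule B.rdc.spn_diff[OF B.rdc.spn_add[OF E_diff[OF K_sc[OF k] K_sc[OF k]]]]) (use diff in auto)
    then show ?case unfolding eq by (simp add: algebra_simps)
  next
    case (var i r)
    obtain a where a: "a \<in> arcs L" "arc_comp L a = i" using A.comp_arc[OF var(1)] by blast
    have k': "sc r k \<in> A.K" using K_sc k var by blast
    have eq: "A.tr (sc r k) (dl a) = sc (var i * r) k"
      using k a by (simp add: A.tr_def A.K_def)
    have "sc (var 1 - 1) (D (sc (var i * r) k) - sc (var 1) (D (sc r k))) + sc (var 1) (E (sc r k) - sc (red r) (E k)) \<in> B.rdc.spn"
      using KV[OF dlV(1)[OF a(1)] k' dlV(2)[OF a(1)]] unfolding eq
      by (intro B.rdc.spn_add B.rdc.spn_sc[OF _ var(3)] B.rdc.spn_sc) auto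
    then show ?case by (simp add: E_def sc_right_distrib algebra_simps)
  next
    case (ivar i r)
    obtain a where a: "a \<in> arcs L" "arc_comp L a = i" using A.comp_arc[OF ivar(1)] by blast
    have "ivar i * r \<in> lring (ncomp L)" using ivar by auto
    then have k': "sc (ivar i * r) k \<in> A.K" by (rule K_sc[OF k])
    \<comment> \<open>Division by t_i is not itself a product here; instead the element to be
      treated is the one that yields r k when acted upon, and its value is recovered with the
      inverse of t.\<close>
    have eq: "A.tr (sc (ivar i * r) k) (dl a) = sc r k"
      using k a by (simp add: A.tr_def A.K_def)
    have "sc (var 1 - 1) (D (sc r k) - sc (var 1) (D (sc (ivar i * r) k))) \<in> B.rdc.spn"
      using KV[OF dlV(1)[OF a(1)] k' dlV(2)[OF a(1)]] unfolding eq by (intro B.rdc.spn_sc) auto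
    then have "sc (ivar 1) ((E (sc r k) - sc (red r) (E k)) - sc (var 1 - 1) (D (sc r k) - sc (var 1) (D (sc (ivar i * r) k)))) \<in> B.rdc.spn"
      by (intro B.rdc.spn_sc[OF _ B.rdc.spn_diff[OF ivar(3)]]) auto
    moreover have "sc (ivar 1) ((E (sc r k) - sc (red r) (E k)) - sc (var 1 - 1) (D (sc r k) - sc (var 1) (D (sc (ivar i * r) k))))
      = E (sc (ivar i * r) k) - sc (red (ivar i * r)) (E k)"
    proof -
      have *: "ivar 1 * ((var 1 - 1) * var 1) = var 1 - 1"
        by (simp add: algebra_simps)
      show ?thesis by (simp add: E_def sc_right_distrib mult.assoc *)
    qed
    ultimately show ?case by simp
  qed simp
  define kz where "kz a = sc (var j - 1) (dl a) - sc (var (arc_comp L a) - 1) (dl b)" for a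
  have kz: "kz a \<in> A.K" if "a \<in> arcs L" for a
    using that b y A.arc_comp[OF that] by (simp add: kz_def A.K_def algebra_simps)
  have E_kz: "E (kz a) \<in> B.rdc.spn" if a: "a \<in> arcs L" for a
  proof -
    \<comment> \<open>Both elements are products of arcs, where D vanishes, and the translation by
      \<open>kz a\<close> carries the second to the first. Hence (t - 1) D (\<open>kz a\<close>)
      vanishes as well.\<close>
    let ?x1 = "A.tr (A.tr (dl b) (dl a)) (dl b)" and ?x2 = "A.tr (A.tr (dl b) (dl b)) (dl a)"
    have D2: "D (A.tr v (dl c)) \<in> B.rdc.spn" "A.tr v (dl c) \<in> A.V j"
      if "v \<in> A.V j" "D v \<in> B.rdc.spn" "c \<in> arcs L" for v c
    proof -
      have "(D (A.tr v (dl c)) - (sc (var 1) (D v) - sc (var 1 - 1) (D (dl c))))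
        + (sc (var 1) (D v) - sc (var 1 - 1) (D (dl c))) \<in> B.rdc.spn"
        by (rule B.rdc.spn_add[OF VV[OF that(1) dlV(1)[OF that(3)] y(2) dlV(2)[OF that(3)]]
              B.rdc.spn_diff[OF B.rdc.spn_sc[OF _ that(2)] B.rdc.spn_sc[OF _ dl[OF that(3)]]]]) auto
      then show "D (A.tr v (dl c)) \<in> B.rdc.spn" by simp
      show "A.tr v (dl c) \<in> A.V j" using that A.tr_V by simp
    qed
    have x1: "D ?x1 \<in> B.rdc.spn"
      by (intro D2 bV dl a b)
    have x2: "?x2 \<in> A.V j" "D ?x2 \<in> B.rdc.spn"
      by (intro D2 bV dl a b)+
    have eq: "A.tr ?x2 (kz a) = ?x1"
      using a b by (simp add: A.tr_def kz_def fun_eq_iff fun_apply algebra_simps)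
    have "(D ?x2 - D ?x1) + (D ?x1 - (D ?x2 - sc (var 1 - 1) (D (kz a)))) \<in> B.rdc.spn"
      by (rule B.rdc.spn_add[OF B.rdc.spn_diff[OF x2(2) x1] VK[OF x2(1) kz[OF a] y(2), unfolded eq]])
    then show ?thesis by (simp add: E_def)
  qed
  have E_K: "sc (var 1 - 1) (E k) \<in> B.rdc.spn" if k: "k \<in> A.K" for k
  proof -
    have "E (\<Sum>a\<in>S. sc (k a) (kz a)) \<in> B.rdc.spn \<and> (\<Sum>a\<in>S. sc (k a) (kz a)) \<in> A.K"
      if "finite S" "S \<subseteq> arcs L" for S
      using that
    proof (induction S rule: finite_induct)
      case empty
      show ?case using E_zero by (simp add: A.K_def)
    next
      case (insert a S)
      let ?s = "\<Sum>a\<in>S. sc (k a) (kz a)"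
      have a: "a \<in> arcs L" "k a \<in> lring (ncomp L)" and s: "E ?s \<in> B.rdc.spn" "?s \<in> A.K"
        using insert A.K_fn[OF k] by auto
      have ka: "sc (k a) (kz a) \<in> A.K" using K_sc kz a by blast
      have "(E (sc (k a) (kz a) + ?s) - (E (sc (k a) (kz a)) + E ?s))
        + ((E (sc (k a) (kz a)) - sc (red (k a)) (E (kz a))) + (sc (red (k a)) (E (kz a)) + E ?s)) \<in> B.rdc.spn"
        by (rule B.rdc.spn_add[OF E_add[OF ka s(2)] B.rdc.spn_add[OF E_sc[OF a(2) kz[OF a(1)]]
              B.rdc.spn_add[OF B.rdc.spn_sc[OF _ E_kz[OF a(1)]] s(1)]]]) simp
      then show ?case using insert K(1)[OF ka s(2)] by (simp add: algebra_simps)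
    qed
    from this[OF A.finA order_refl] have E_sum: "E (\<Sum>a\<in>arcs L. sc (k a) (kz a)) \<in> B.rdc.spn" by blast
    have "(\<Sum>a\<in>arcs L. sc (k a) (kz a)) = sc (var j - 1) k"
    proof -
      have "(\<Sum>a\<in>arcs L. sc (k a) (kz a)) =
        sc (var j - 1) (\<Sum>a\<in>arcs L. sc (k a) (dl a)) - sc (A.mul.phi k) (dl b)"
        by (simp add: kz_def A.mul.phi_def fun_eq_iff fun_apply sum_fun_apply sum_subtractf sum.distrib
            sum_distrib_left sum_distrib_right algebra_simps)
      then show ?thesis
        using A.mul.fn_expand[OF A.K_fn[OF k]] k by (simp add: A.K_def)
    qed
    with E_sum have "E (sc (var j - 1) k) \<in> B.rdc.spn" by simp
    moreover have "E (sc (var j - 1) k) - sc (red (var j - 1)) (E k) \<in> B.rdc.spn"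
      using y k by (intro E_sc) auto
    ultimately have "E (sc (var j - 1) k) - (E (sc (var j - 1) k) - sc (red (var j - 1)) (E k)) \<in> B.rdc.spn"
      by (rule B.rdc.spn_diff)
    then show ?thesis by simp
  qed
  \<comment> \<open>y and b have the same phi, so acting on b by y is the same as translating b by y
    - b. Comparing \<open>VV\<close> with \<open>VK\<close> replaces y by an element of the
    kernel.\<close>
  let ?k = "y - dl b"
  have k: "?k \<in> A.K"
    using y b bV by (simp add: A.K_def A.V_def)
  have eq: "A.tr (dl b) y = A.tr (dl b) ?k"
    using y b bV by (simp add: A.tr_def A.V_def fun_eq_iff fun_apply algebra_simps)
  have "(D (A.tr (dl b) ?k) - (D (dl b) - sc (var 1 - 1) (D ?k)))
    - (D (A.tr (dl b) y) - (sc (var 1) (D (dl b)) - sc (var 1 - 1) (D y))) - sc (var 1 - 1) (D (dl b)) \<in> B.rdc.spn"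
    by (rule B.rdc.spn_diff[OF B.rdc.spn_diff[OF VK[OF bV k y(2)] VV[OF bV y(1) y(2) y(2)]] B.rdc.spn_sc[OF _ dl[OF b(1)]]]) auto
  also have "(D (A.tr (dl b) ?k) - (D (dl b) - sc (var 1 - 1) (D ?k)))
    - (D (A.tr (dl b) y) - (sc (var 1) (D (dl b)) - sc (var 1 - 1) (D y))) - sc (var 1 - 1) (D (dl b)) = E ?k - E y"
    unfolding eq E_def by (simp add: fun_eq_iff fun_apply algebra_simps)
  finally have "sc (var 1 - 1) (E ?k) - sc (var 1 - 1) (E ?k - E y) \<in> B.rdc.spn"
    by (intro B.rdc.spn_diff[OF E_K[OF k] B.rdc.spn_sc]) auto
  then show ?thesis by (simp add: sc_right_distrib E_def power2_eq_square)
qed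

end

lemma (in wirtinger) total_tri_closed:
  assumes "X \<in> carrier (total_quandle L)" "Y \<in> carrier (total_quandle L)"
  shows "tri (total_quandle L) X Y \<in> carrier (total_quandle L)"
proof -
  obtain v w where v: "v \<in> U" "X = mul.cl v" and w: "w \<in> U" "Y = mul.cl w"
    using assms unfolding total_simps(1) by blast
  show ?thesis
    unfolding v(2) w(2) total_simps(1) total_simps(2)[OF U_fn[OF v(1)] U_fn[OF w(1)]]
    using tr_U[OF v(1) w(1)] by blast
qed

lemma (in wirtinger) phi_L_cases:
  assumes "X \<in> mul.cl ` fn L (ncomp L)"
  shows "X \<in> mul.cl ` V i \<longleftrightarrow> phi_L L X = var i - 1" "X \<in> mul.cl ` K \<longleftrightarrow> phi_L L X = 0"
    "phi_L L X \<in> lring (ncomp L)"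
proof -
  obtain v where v: "v \<in> fn L (ncomp L)" "X = mul.cl v" using assms by blast
  have *: "X \<in> mul.cl ` {v \<in> fn L (ncomp L). mul.phi v = r} \<longleftrightarrow> phi_L L X = r" for r
  proof
    assume "X \<in> mul.cl ` {v \<in> fn L (ncomp L). mul.phi v = r}"
    then obtain w where "w \<in> fn L (ncomp L)" "X = mul.cl w" "mul.phi w = r" by blast
    then show "phi_L L X = r" by (simp add: mul.alex_phi_cl)
  next
    assume "phi_L L X = r"
    then show "X \<in> mul.cl ` {v \<in> fn L (ncomp L). mul.phi v = r}"
      using v by (auto simp: mul.alex_phi_cl)
  qed
  show "X \<in> mul.cl ` V i \<longleftrightarrow> phi_L L X = var i - 1" "X \<in> mul.cl ` K \<longleftrightarrow> phi_L L X = 0"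
    unfolding V_def K_def by (rule *)+
  show "phi_L L X \<in> lring (ncomp L)"
    using v by (simp add: mul.alex_phi_cl)
qed

context diagram_pair
begin

text \<open>The consequences of compatibility with phi that are used below. They do not mention the
  ring isomorphism and hold for \<open>f\<close> and for its inverse alike.\<close>

definition typed :: "(alex \<Rightarrow> alex) \<Rightarrow> (nat \<Rightarrow> nat) \<Rightarrow> bool" where
  "typed f \<pi> \<longleftrightarrow>
     (\<forall>X\<in>carrier (total_quandle L). \<forall>Y\<in>carrier (total_quandle L).
        f X \<in> carrier (total_quandle L') \<and> f (tri (total_quandle L) X Y) = tri (total_quandle L') (f X) (f Y)) \<and>
     (\<forall>i\<in>{1..ncomp L}. \<pi> i \<in> {1..ncomp L'} \<and> (\<forall>X\<in>A.mul.cl ` A.V i. f X \<in> B.mul.cl ` B.V (\<pi> i))) \<and>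
     (\<forall>X\<in>A.mul.cl ` A.K. f X \<in> B.mul.cl ` B.K)"

text \<open>Away from the arcs the linear map and the reduction of \<open>f\<close> agree only up to
  elements killed by (t - 1)^2, since the subquandle generated by the arcs need not reach all
  elements of \<open>A.V j\<close>. The last claim turns the known values of phi on arcs into
  coordinates modulo t - 1.\<close>

lemma total_images:
  fixes f :: "alex \<Rightarrow> alex"
  defines "p \<equiv> \<lambda>a. Rd (B.mul.rep (f (A.mul.cl (dl a))))"
  assumes f: "typed f \<pi>"
  shows "a \<in> arcs L \<Longrightarrow> p a \<in> fn L' 1" "a \<in> arcs L \<Longrightarrow> B.rdc.phi (p a) = var 1 - 1"
    and "v \<in> A.rdc.spn \<Longrightarrow> lin L p v \<in> B.rdc.spn"
    and "y \<in> A.V j \<Longrightarrow> j \<in> {1..ncomp L} \<Longrightarrow>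
      sc ((var 1 - 1) ^ 2) (lin L p (Rd y) - Rd (B.mul.rep (f (A.mul.cl y)))) \<in> B.rdc.spn"
    and "inj_on \<pi> {1..ncomp L} \<Longrightarrow> i \<in> {1..ncomp L} \<Longrightarrow> B.th (\<pi> i) (lin L p v) = A.th i v"
proof -
  have fU: "f X \<in> carrier (total_quandle L')"
    and hom: "f (tri (total_quandle L) X Y) = tri (total_quandle L') (f X) (f Y)"
    if "X \<in> carrier (total_quandle L)" "Y \<in> carrier (total_quandle L)" for X Y
    using f that unfolding typed_def by blast+
  have fV: "\<pi> i \<in> {1..ncomp L'}" "f (A.mul.cl v) \<in> B.mul.cl ` B.V (\<pi> i)" if "v \<in> A.V i" "i \<in> {1..ncomp L}" for v i
    using f that unfolding typed_def by blast+
  have fK: "f (A.mul.cl k) \<in> B.mul.cl ` B.K" if "k \<in> A.K" for k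
    using f that unfolding typed_def by blast
  have dlU: "A.mul.cl (dl a) \<in> carrier (total_quandle L)" if "a \<in> arcs L" for a
    using A.V_U[OF A.dl_V[OF that] A.arc_comp[OF that]] unfolding A.total_simps(1) by blast
  have V: "\<exists>i\<in>{1..ncomp L'}. f (A.mul.cl (dl a)) \<in> B.mul.cl ` B.V i" if "a \<in> arcs L" for a
    using fV[OF A.dl_V[OF that] A.arc_comp[OF that]] by blast
  have hom': "f (tri (total_quandle L) (A.mul.cl (dl a)) (A.mul.cl (dl b)))
      = tri (total_quandle L') (f (A.mul.cl (dl a))) (f (A.mul.cl (dl b)))" if "a \<in> arcs L" "b \<in> arcs L" for a b
    by (rule hom[OF dlU[OF that(1)] dlU[OF that(2)]])
  show "p a \<in> fn L' 1" if "a \<in> arcs L" for a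
    unfolding p_def by (rule arc_images(1)[of f]; fact V hom' that)
  show "B.rdc.phi (p a) = var 1 - 1" if "a \<in> arcs L" for a
    unfolding p_def by (rule arc_images(2)[of f]; fact V hom' that)
  show spn: "lin L p v \<in> B.rdc.spn" if "v \<in> A.rdc.spn" for v
    unfolding p_def by (rule arc_images(3)[of f]; fact V hom' that)
  define D where "D y = lin L p (Rd y) - Rd (B.mul.rep (f (A.mul.cl y)))" for y
  \<comment> \<open>Elements on which \<open>f\<close> preserves the reduced phi. Between two of
    them the discrepancy D transforms with the same coefficients as the reduced product.\<close>
  define good where "good v \<longleftrightarrow> v \<in> A.U \<and> red (B.mul.phi (B.mul.rep (f (A.mul.cl v)))) = red (A.mul.phi v)" for v
  have goodV: "good v" if v: "v \<in> A.V i" "i \<in> {1..ncomp L}" for v i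
  proof -
    have U: "f (A.mul.cl v) \<in> B.mul.cl ` B.U" using fV[OF v] B.V_U by blast
    show ?thesis
      using B.rep_V[OF U fV(2)[OF v]] v A.V_U[OF v] by (simp add: good_def A.V_def B.V_def)
  qed
  have goodK: "good k" if k: "k \<in> A.K" for k
  proof -
    have U: "f (A.mul.cl k) \<in> B.mul.cl ` B.U" using fK[OF k] B.K_U by blast
    show ?thesis
      using B.rep_K[OF U fK[OF k]] k A.K_U[OF k] by (simp add: good_def A.K_def B.K_def)
  qed
  have D_tr: "D (A.tr v w) - (sc (red (A.mul.phi w) + 1) (D v) - sc (red (A.mul.phi v)) (D w)) \<in> B.rdc.spn"
    if v: "good v" and w: "good w" for v w
  proof -
    have U: "v \<in> A.U" "w \<in> A.U" using v w by (auto simp: good_def)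
    then have c: "A.mul.cl v \<in> carrier (total_quandle L)" "A.mul.cl w \<in> carrier (total_quandle L)"
      by (auto simp: A.total_simps(1))
    have "A.mul.cl (A.tr v w) = tri (total_quandle L) (A.mul.cl v) (A.mul.cl w)"
      using U A.U_fn by (simp add: A.total_simps)
    then have eq: "f (A.mul.cl (A.tr v w)) = tri (total_quandle L') (f (A.mul.cl v)) (f (A.mul.cl w))"
      using hom[OF c] by simp
    let ?J = "\<lambda>v. B.mul.rep (f (A.mul.cl v))"
    have "Rd (?J (A.tr v w)) - (sc (red (A.mul.phi w) + 1) (Rd (?J v)) - sc (red (A.mul.phi v)) (Rd (?J w))) \<in> B.rdc.spn"
      using B.Rd_rep_tri[OF fU[OF c] fU[OF c(2,2)]] v w unfolding eq good_def B.Rd_tr by simp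
    from B.rdc.spn_uminus[OF this] show ?thesis
      unfolding D_def A.Rd_tr lin_simps by (simp add: sc_right_distrib algebra_simps)
  qed
  show "sc ((var 1 - 1) ^ 2) (lin L p (Rd y) - Rd (B.mul.rep (f (A.mul.cl y)))) \<in> B.rdc.spn"
    if y: "y \<in> A.V j" "j \<in> {1..ncomp L}"
    unfolding D_def[symmetric]
  proof (rule torsion[OF _ _ _ _ y])
    show "D (A.tr v w) - (sc (var 1) (D v) - sc (var 1 - 1) (D w)) \<in> B.rdc.spn"
      if "v \<in> A.V i" "w \<in> A.V j" "i \<in> {1..ncomp L}" "j \<in> {1..ncomp L}" for v w i j
      using D_tr[OF goodV[OF that(1,3)] goodV[OF that(2,4)]] that by (simp add: A.V_def)
    show "D (A.tr v k) - (D v - sc (var 1 - 1) (D k)) \<in> B.rdc.spn"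
      if "v \<in> A.V i" "k \<in> A.K" "i \<in> {1..ncomp L}" for v k i
      using D_tr[OF goodV[OF that(1,3)] goodK[OF that(2)]] that by (simp add: A.V_def A.K_def)
    show "D (A.tr k v) - sc (var 1) (D k) \<in> B.rdc.spn"
      if "v \<in> A.V i" "k \<in> A.K" "i \<in> {1..ncomp L}" for v k i
      using D_tr[OF goodK[OF that(2)] goodV[OF that(1,3)]] that by (simp add: A.V_def A.K_def)
    show "D (dl a) \<in> B.rdc.spn" if "a \<in> arcs L" for a
      using that by (simp add: D_def p_def)
  qed
  show "B.th (\<pi> i) (lin L p v) = A.th i v" if inj: "inj_on \<pi> {1..ncomp L}" and i: "i \<in> {1..ncomp L}"
  proof -
    have th: "B.th (\<pi> i) (p a) = (if arc_comp L a = i then 1 else 0)" if a: "a \<in> arcs L" for a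
    proof -
      note V = fV[OF A.dl_V[OF a] A.arc_comp[OF a]]
      have U: "f (A.mul.cl (dl a)) \<in> B.mul.cl ` B.U" using V B.V_U by blast
      have "B.mul.phi (B.mul.rep (f (A.mul.cl (dl a)))) = var (\<pi> (arc_comp L a)) - 1"
        using B.rep_V[OF U V(2)] by (simp add: B.V_def)
      then show ?thesis
        using inj_on_eq_iff[OF inj A.arc_comp[OF a] i]
        unfolding p_def B.th_simps(5) unfolding B.th_expt by (simp add: expt_var)
    qed
    have "B.th (\<pi> i) (\<Sum>a\<in>S. sc (v a) (p a)) = (\<Sum>a\<in>S. aug (v a) * B.th (\<pi> i) (p a))" for S
      by (induction S rule: infinite_finite_induct) simp_all
    then show ?thesis
      unfolding lin_def A.th_def by (simp add: th if_distrib[of "\<lambda>x. _ * x"] cong: if_cong)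
  qed
qed

text \<open>N preserves the coordinates \<open>th\<close>, which gives the hypothesis modulo t - 1
  of \<open>unipotent\<close>; the torsion estimate on arcs gives the other hypothesis with exponent
  2.\<close>

lemma total_inverse:
  fixes f g :: "alex \<Rightarrow> alex"
  defines "N \<equiv> \<lambda>v. lin L' (\<lambda>b. Rd (A.mul.rep (g (B.mul.cl (dl b))))) (lin L (\<lambda>a. Rd (B.mul.rep (f (A.mul.cl (dl a))))) v)"
  assumes f: "typed f \<pi>" and g: "diagram_pair.typed L' L g \<pi>'"
    and gf: "\<And>X. X \<in> carrier (total_quandle L) \<Longrightarrow> g (f X) = X"
    and \<pi>: "\<And>i. i \<in> {1..ncomp L} \<Longrightarrow> \<pi>' (\<pi> i) = i" "inj_on \<pi>' {1..ncomp L'}"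
    and v: "v \<in> fn L 1"
  shows "N v \<in> A.rdc.spn \<Longrightarrow> v \<in> A.rdc.spn" and "\<exists>u\<in>fn L 1. N u - v \<in> A.rdc.spn"
proof -
  interpret C: diagram_pair L' L by unfold_locales
  define p where "p = (\<lambda>a. Rd (B.mul.rep (f (A.mul.cl (dl a)))))"
  define q where "q = (\<lambda>b. Rd (A.mul.rep (g (B.mul.cl (dl b)))))"
  have N: "N = (\<lambda>v. lin L' q (lin L p v))" by (simp add: N_def p_def q_def)
  have p_fn: "p a \<in> fn L' 1" if "a \<in> arcs L" for a
    unfolding p_def by (rule total_images(1)[OF f that])
  have q_fn: "q b \<in> fn L 1" if "b \<in> arcs L'" for b
    unfolding q_def by (rule C.total_images(1)[OF g that])
  have p_spn: "lin L p v \<in> B.rdc.spn" if "v \<in> A.rdc.spn" for v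
    unfolding p_def by (rule total_images(3)[OF f that])
  have q_spn: "lin L' q v \<in> A.rdc.spn" if "v \<in> B.rdc.spn" for v
    unfolding q_def by (rule C.total_images(3)[OF g that])
  have N_fn: "N v \<in> fn L 1" if "v \<in> fn L 1" for v
    unfolding N by (rule C.lin_fn[OF q_fn lin_fn[OF p_fn that]])
  have N_spn: "N v \<in> A.rdc.spn" if "v \<in> A.rdc.spn" for v
    unfolding N by (rule q_spn[OF p_spn[OF that]])
  have N_lin: "N (v + w) = N v + N w" "N (v - w) = N v - N w" "N (sc r v) = sc r (N v)" "N 0 = 0" for v w r
    by (simp_all add: N)
  have \<pi>_inj: "inj_on \<pi> {1..ncomp L}"
    by (rule inj_on_inverseI[of _ \<pi>']) (rule \<pi>(1))
  have th: "A.th i (N v) = A.th i v" if i: "i \<in> {1..ncomp L}" for i v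
  proof -
    have "\<pi> i \<in> {1..ncomp L'}" using f i unfolding typed_def by blast
    then have "A.th (\<pi>' (\<pi> i)) (N v) = B.th (\<pi> i) (lin L p v)"
      unfolding N q_def by (rule C.total_images(5)[OF g \<pi>(2)])
    also have "\<dots> = A.th i v"
      unfolding p_def by (rule total_images(5)[OF f \<pi>_inj i])
    finally show ?thesis using \<pi>(1)[OF i] by simp
  qed
  have u1: "\<exists>w\<in>fn L 1. N v - v - sc (var 1 - 1) w \<in> A.rdc.spn" if "v \<in> fn L 1" for v
    using th that N_fn by (intro A.th_zero_imp) simp_all
  have dl: "sc ((var 1 - 1) ^ 2) (N (dl a) - dl a) \<in> A.rdc.spn" if a: "a \<in> arcs L" for a
  proof -
    note aV = A.dl_V[OF a] A.arc_comp[OF a]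
    have X: "A.mul.cl (dl a) \<in> carrier (total_quandle L)"
      using A.V_U[OF aV] unfolding A.total_simps(1) by blast
    have fX: "f (A.mul.cl (dl a)) \<in> B.mul.cl ` B.V (\<pi> (arc_comp L a))" "\<pi> (arc_comp L a) \<in> {1..ncomp L'}"
      using f aV unfolding typed_def by blast+
    \<comment> \<open>The image of an arc is in general no arc, so the torsion estimate for the
      inverse is needed at an arbitrary element with phi + 1 a variable.\<close>
    define y where "y = B.mul.rep (f (A.mul.cl (dl a)))"
    have "f (A.mul.cl (dl a)) \<in> B.mul.cl ` B.U" using fX B.V_U by blast
    then have y: "y \<in> B.V (\<pi> (arc_comp L a))" "B.mul.cl y = f (A.mul.cl (dl a))"
      unfolding y_def using B.rep_V B.rep_U(2) fX(1) by blast+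
    have "sc ((var 1 - 1) ^ 2) (lin L' q (Rd y) - Rd (A.mul.rep (g (B.mul.cl y)))) \<in> A.rdc.spn"
      unfolding q_def by (rule C.total_images(4)[OF g y(1) fX(2)])
    moreover have "g (B.mul.cl y) = A.mul.cl (dl a)"
      unfolding y(2) by (rule gf[OF X])
    moreover have "N (dl a) = lin L' q (Rd y)"
      using a by (simp add: N p_def y_def)
    moreover have "sc ((var 1 - 1) ^ 2) (Rd (A.mul.rep (A.mul.cl (dl a))) - dl a) \<in> A.rdc.spn"
      using A.Rd_rep_cl[of "dl a"] a by (intro A.rdc.spn_sc) (simp_all add: power2_eq_square)
    ultimately have "sc ((var 1 - 1) ^ 2) (N (dl a) - Rd (A.mul.rep (A.mul.cl (dl a))))
      + sc ((var 1 - 1) ^ 2) (Rd (A.mul.rep (A.mul.cl (dl a))) - dl a) \<in> A.rdc.spn"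
      by (simp only: A.rdc.spn_add)
    then show ?thesis by (simp add: sc_right_distrib)
  qed
  have u2: "sc ((var 1 - 1) ^ 2) (N v - v) \<in> A.rdc.spn" if "v \<in> fn L 1" for v
    by (rule A.linear_extend[of N, OF N_lin(4,1,3) dl that])
  show "N v \<in> A.rdc.spn \<Longrightarrow> v \<in> A.rdc.spn"
    by (rule A.unipotent(1)[of N, OF N_lin(1-3) N_fn N_spn u1 u2 v])
  show "\<exists>u\<in>fn L 1. N u - v \<in> A.rdc.spn"
    by (rule A.unipotent(2)[of N, OF N_lin(1-3) N_fn N_spn u1 u2 v])
qed

lemma total_same:
  assumes "same_total L L'"
  shows "same_standard_module L L' \<and> same_standard_invariant L L'"
proof -
  interpret C: diagram_pair L' L by unfold_locales
  let ?U = "carrier (total_quandle L)" and ?U' = "carrier (total_quandle L')"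
  obtain f \<sigma> \<pi> where f: "bij_betw f ?U ?U'"
    "\<And>X Y. X \<in> ?U \<Longrightarrow> Y \<in> ?U \<Longrightarrow> f (tri (total_quandle L) X Y) = tri (total_quandle L') (f X) (f Y)"
    and \<sigma>: "\<sigma> \<in> ring_iso (lam L) (lam L')" "\<And>i. i \<in> {1..ncomp L} \<Longrightarrow> \<sigma> (var i) = var (\<pi> i)"
    and \<pi>: "bij_betw \<pi> {1..ncomp L} {1..ncomp L'}"
    and phi: "\<And>X. X \<in> ?U \<Longrightarrow> phi_L L' (f X) = \<sigma> (phi_L L X)"
    using assms unfolding same_total_def quandle_iso_def by blast
  define g where "g = inv_into ?U f"
  define \<pi>' where "\<pi>' = inv_into {1..ncomp L} \<pi>"
  have gf: "\<And>X. X \<in> ?U \<Longrightarrow> g (f X) = X" and fg: "\<And>X. X \<in> ?U' \<Longrightarrow> f (g X) = X"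
    and fU: "\<And>X. X \<in> ?U \<Longrightarrow> f X \<in> ?U'" and gU: "\<And>X. X \<in> ?U' \<Longrightarrow> g X \<in> ?U"
    using bij_betw_inv_into_left[OF f(1)] bij_betw_inv_into_right[OF f(1)]
      bij_betwE[OF bij_betw_inv_into[OF f(1)]] bij_betwE[OF f(1)] unfolding g_def by blast+
  have \<pi>': "\<And>i. i \<in> {1..ncomp L} \<Longrightarrow> \<pi>' (\<pi> i) = i" "\<And>i. i \<in> {1..ncomp L'} \<Longrightarrow> \<pi> (\<pi>' i) = i"
    "\<And>i. i \<in> {1..ncomp L} \<Longrightarrow> \<pi> i \<in> {1..ncomp L'}" "\<And>i. i \<in> {1..ncomp L'} \<Longrightarrow> \<pi>' i \<in> {1..ncomp L}"
    using bij_betw_inv_into_left[OF \<pi>] bij_betw_inv_into_right[OF \<pi>]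
      bij_betwE[OF bij_betw_inv_into[OF \<pi>]] bij_betwE[OF \<pi>] unfolding \<pi>'_def by blast+
  have \<sigma>_inj: "inj_on \<sigma> (lring (ncomp L))" and \<sigma>_add: "\<And>x y. x \<in> lring (ncomp L) \<Longrightarrow> y \<in> lring (ncomp L) \<Longrightarrow> \<sigma> (x + y) = \<sigma> x + \<sigma> y"
    and \<sigma>_one: "\<sigma> 1 = 1"
    using \<sigma>(1) ring_hom_add[of \<sigma> "lam L" "lam L'"] ring_hom_one[of \<sigma> "lam L" "lam L'"]
    by (auto simp: ring_iso_def bij_betw_def)
  have \<sigma>_zero: "\<sigma> 0 = 0" using \<sigma>_add[of 0 0] by simp
  have \<sigma>_var: "\<sigma> (var i - 1) = var (\<pi> i) - 1" if "i \<in> {1..ncomp L}" for i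
    using \<sigma>_add[of "var i - 1" 1] \<sigma>(2)[OF that] \<sigma>_one that by simp
  have A_cl: "X \<in> A.mul.cl ` A.V i \<longleftrightarrow> phi_L L X = var i - 1" "X \<in> A.mul.cl ` A.K \<longleftrightarrow> phi_L L X = 0"
    "phi_L L X \<in> lring (ncomp L)" if X: "X \<in> ?U" for X i
  proof -
    have "X \<in> A.mul.cl ` fn L (ncomp L)"
      using X A.U_fn unfolding A.total_simps(1) by blast
    note * = A.phi_L_cases[OF this]
    show "X \<in> A.mul.cl ` A.V i \<longleftrightarrow> phi_L L X = var i - 1" "X \<in> A.mul.cl ` A.K \<longleftrightarrow> phi_L L X = 0"
      "phi_L L X \<in> lring (ncomp L)" by (rule *)+
  qed
  have B_cl: "X \<in> B.mul.cl ` B.V i \<longleftrightarrow> phi_L L' X = var i - 1" "X \<in> B.mul.cl ` B.K \<longleftrightarrow> phi_L L' X = 0"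
    if X: "X \<in> ?U'" for X i
  proof -
    have "X \<in> B.mul.cl ` fn L' (ncomp L')"
      using X B.U_fn unfolding B.total_simps(1) by blast
    note * = B.phi_L_cases[OF this]
    show "X \<in> B.mul.cl ` B.V i \<longleftrightarrow> phi_L L' X = var i - 1" "X \<in> B.mul.cl ` B.K \<longleftrightarrow> phi_L L' X = 0"
       by (rule *)+
  qed
  have A_sub: "X \<in> ?U" if "X \<in> A.mul.cl ` A.V i \<and> i \<in> {1..ncomp L} \<or> X \<in> A.mul.cl ` A.K" for X i
    using that A.V_U A.K_U unfolding A.total_simps(1) by blast
  have B_sub: "X \<in> ?U'" if "X \<in> B.mul.cl ` B.V i \<and> i \<in> {1..ncomp L'} \<or> X \<in> B.mul.cl ` B.K" for X i
    using that B.V_U B.K_U unfolding B.total_simps(1) by blast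
  have tf: "typed f \<pi>"
    unfolding typed_def
  proof (intro conjI ballI)
    fix i X assume i: "i \<in> {1..ncomp L}" and X: "X \<in> A.mul.cl ` A.V i"
    have U: "X \<in> ?U" using A_sub i X by blast
    show "f X \<in> B.mul.cl ` B.V (\<pi> i)"
      unfolding B_cl[OF fU[OF U]] phi[OF U] X[unfolded A_cl[OF U]] by (rule \<sigma>_var[OF i])
  next
    fix X assume X: "X \<in> A.mul.cl ` A.K"
    have U: "X \<in> ?U" using A_sub X by blast
    show "f X \<in> B.mul.cl ` B.K"
      unfolding B_cl[OF fU[OF U]] phi[OF U] X[unfolded A_cl[OF U]] by (rule \<sigma>_zero)
  qed (use fU f(2) \<pi>'(3) in blast)+
  have phi_g: "phi_L L' Y = \<sigma> (phi_L L (g Y))" if "Y \<in> ?U'" for Y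
    using phi[OF gU[OF that]] fg[OF that] by simp
  have tg: "C.typed g \<pi>'"
    unfolding C.typed_def
  proof (intro conjI ballI)
    fix X Y assume XY: "X \<in> ?U'" "Y \<in> ?U'"
    have "f (tri (total_quandle L) (g X) (g Y)) = tri (total_quandle L') X Y"
      using f(2)[OF gU[OF XY(1)] gU[OF XY(2)]] fg[OF XY(1)] fg[OF XY(2)] by simp
    then show "g (tri (total_quandle L') X Y) = tri (total_quandle L) (g X) (g Y)"
      using gf[OF A.total_tri_closed[OF gU[OF XY(1)] gU[OF XY(2)]]] by simp
  next
    fix i X assume i: "i \<in> {1..ncomp L'}" and X: "X \<in> B.mul.cl ` B.V i"
    have U: "X \<in> ?U'" using B_sub i X by blast
    \<comment> \<open>For the inverse the value of phi is known only after applying the ring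
      isomorphism, whose injectivity recovers it.\<close>
    have "\<sigma> (phi_L L (g X)) = \<sigma> (var (\<pi>' i) - 1)"
      using X[unfolded B_cl[OF U]] phi_g[OF U] \<sigma>_var[OF \<pi>'(4)[OF i]] \<pi>'(2)[OF i] by simp
    then have "phi_L L (g X) = var (\<pi>' i) - 1"
      using inj_onD[OF \<sigma>_inj] A_cl(3)[OF gU[OF U]] \<pi>'(4)[OF i] by simp
    then show "g X \<in> A.mul.cl ` A.V (\<pi>' i)"
      unfolding A_cl[OF gU[OF U]] .
  next
    fix X assume X: "X \<in> B.mul.cl ` B.K"
    have U: "X \<in> ?U'" using B_sub X by blast
    have "\<sigma> (phi_L L (g X)) = \<sigma> 0"
      using X[unfolded B_cl[OF U]] phi_g[OF U] \<sigma>_zero by simp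
    then have "phi_L L (g X) = 0"
      using inj_onD[OF \<sigma>_inj] A_cl(3)[OF gU[OF U]] by simp
    then show "g X \<in> A.mul.cl ` A.K"
      unfolding A_cl[OF gU[OF U]] .
  qed (use gU \<pi>'(4) in blast)+
  define p where "p = (\<lambda>a. Rd (B.mul.rep (f (A.mul.cl (dl a)))))"
  define q where "q = (\<lambda>b. Rd (A.mul.rep (g (B.mul.cl (dl b)))))"
  have inj: "inj_on \<pi> {1..ncomp L}" "inj_on \<pi>' {1..ncomp L'}"
    by (rule inj_on_inverseI[of _ \<pi>'], rule \<pi>'(1), assumption)
      (rule inj_on_inverseI[of _ \<pi>], rule \<pi>'(2), assumption)
  have N: "v \<in> A.rdc.spn" if "v \<in> fn L 1" "lin L' q (lin L p v) \<in> A.rdc.spn" for v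
    by (rule total_inverse(1)[OF tf tg, folded p_def q_def]; fact gf \<pi>'(1) inj(2) that)
  have N': "\<exists>u\<in>fn L' 1. lin L p (lin L' q u) - v \<in> B.rdc.spn" if "v \<in> fn L' 1" for v
    by (rule C.total_inverse(2)[OF tg tf, folded p_def q_def]; fact fg \<pi>'(2) inj(1) that)
  have p: "p a \<in> fn L' 1" "B.rdc.phi (p a) = var 1 - 1" if "a \<in> arcs L" for a
    unfolding p_def by (rule total_images(1)[OF tf that], rule total_images(2)[OF tf that])
  have p_spn: "lin L p v \<in> B.rdc.spn" if "v \<in> A.rdc.spn" for v
    unfolding p_def by (rule total_images(3)[OF tf that])
  have q: "q b \<in> fn L 1" if "b \<in> arcs L'" for b
    unfolding q_def by (rule C.total_images(1)[OF tg that])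
  have q_spn: "lin L' q v \<in> A.rdc.spn" if "v \<in> B.rdc.spn" for v
    unfolding q_def by (rule C.total_images(3)[OF tg that])
  show ?thesis
  \<comment> \<open>The composite in one order yields injectivity of the linear map of
    \<open>p\<close>, the composite in the other order its surjectivity.\<close>
  proof (rule linear_same[of p])
    fix v assume v: "v \<in> fn L 1"
    show "lin L p v \<in> B.rdc.spn \<longleftrightarrow> v \<in> A.rdc.spn"
      using N[OF v q_spn] p_spn by blast
  next
    fix v' assume v': "v' \<in> fn L' 1"
    obtain u where u: "u \<in> fn L' 1" "lin L p (lin L' q u) - v' \<in> B.rdc.spn"
      using N'[OF v'] by blast
    have "lin L' q u \<in> fn L 1" by (rule C.lin_fn; fact q u(1))
    then show "\<exists>v\<in>fn L 1. lin L p v - v' \<in> B.rdc.spn"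
      using u(2) by blast
  qed (use p in auto)
qed

end

section \<open>Arcs of a diagram\<close>

lemma embedded_circle_of_int:
  assumes "embedded_circle g"
  shows "g (s + of_int m) = g s"
proof -
  have 1: "g (s + real k) = g s" for s k
  proof (induction k)
    case (Suc k)
    have "g (s + real (Suc k)) = g ((s + real k) + 1)" by (simp add: algebra_simps)
    also have "\<dots> = g (s + real k)" using assms unfolding embedded_circle_def by blast
    finally show ?case using Suc by simp
  qed simp
  show ?thesis
  proof (cases m rule: int_cases2)
    case (nonneg n)
    then show ?thesis using 1 by simp
  next
    case (nonpos n)
    then show ?thesis using 1[of "s - real n" n] by simp
  qed
qed

lemma embedded_circle_eqD:
  assumes "embedded_circle g" "g s = g u"
  shows "\<exists>m. u = s + of_int m"
proof -
  have *: "g (frac x) = g x" for x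
    using embedded_circle_of_int[OF assms(1), of "frac x" "\<lfloor>x\<rfloor>"] by (simp add: frac_def)
  have "frac s \<in> {0..<1}" "frac u \<in> {0..<1}"
    by (auto simp: frac_lt_1)
  moreover have "inj_on g {0..<1}" using assms(1) unfolding embedded_circle_def by blast
  ultimately have "frac s = frac u"
    using * assms(2) by (metis inj_on_eq_iff)
  then show ?thesis
    by (intro exI[of _ "\<lfloor>u\<rfloor> - \<lfloor>s\<rfloor>"]) (simp add: frac_def)
qed

lemma smooth_regular_on_continuous: "smooth_regular_on S g \<Longrightarrow> continuous_on S g"
  unfolding smooth_regular_on_def continuous_on_eq_continuous_within
  by (metis has_vector_derivative_continuous)

text \<open>The smooth pieces give continuity on one closed period. Gluing shifted periods places
  every parameter in the interior of an interval of continuity, also where two pieces meet.\<close>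

lemma embedded_circle_continuous:
  fixes g :: "real \<Rightarrow> space"
  assumes "embedded_circle g"
  shows "continuous_on UNIV g"
proof -
  obtain s n where n: "0 < n" "s n = s 0 + 1"
    and s: "\<And>k. k < n \<Longrightarrow> s k < s (Suc k)" "\<And>k. k < n \<Longrightarrow> smooth_regular_on {s k..s (Suc k)} g"
    using assms unfolding embedded_circle_def piecewise_regular_def by (metis (no_types))
  have "s 0 \<le> s k \<and> continuous_on {s 0..s k} g" if "k \<le> n" for k
    using that
  proof (induction k)
    case (Suc k)
    have "{s 0..s (Suc k)} = {s 0..s k} \<union> {s k..s (Suc k)}" using Suc s(1)[of k] by auto
    moreover have "continuous_on ({s 0..s k} \<union> {s k..s (Suc k)}) g"
      using Suc smooth_regular_on_continuous[OF s(2)[of k]] by (intro continuous_on_closed_Un) auto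
    ultimately show ?case using Suc s(1)[of k] by auto
  qed simp
  then have one: "continuous_on {s 0..s 0 + 1} g" using n by force
  have shift: "continuous_on {s 0 + of_int m..s 0 + of_int m + 1} g" for m
  proof -
    have "continuous_on {s 0 + of_int m..s 0 + of_int m + 1} (\<lambda>x. g (x - of_int m))"
      by (rule continuous_on_compose2[OF one]) (auto intro!: continuous_intros)
    moreover have "g (x - of_int m) = g x" for x
      using embedded_circle_of_int[OF assms, of x "- m"] by simp
    ultimately show ?thesis by simp
  qed
  have big: "continuous_on {s 0 - real k..s 0 + real k} g" for k
  proof (induction k)
    case (Suc k)
    have "{s 0 - real (Suc k)..s 0 + real (Suc k)} =
      ({s 0 - real (Suc k)..s 0 - real k} \<union> {s 0 - real k..s 0 + real k}) \<union> {s 0 + real k..s 0 + real (Suc k)}"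
      by auto
    moreover have "continuous_on {s 0 - real (Suc k)..s 0 - real k} g"
      using shift[of "- int (Suc k)"] by (simp add: algebra_simps)
    moreover have "continuous_on {s 0 + real k..s 0 + real (Suc k)} g"
      using shift[of "int k"] by (simp add: algebra_simps)
    ultimately show ?case
      using Suc by (metis closed_Un closed_real_atLeastAtMost continuous_on_closed_Un)
  qed simp
  have "isCont g x" for x
  proof -
    obtain k where k: "\<bar>x - s 0\<bar> < real k" using reals_Archimedean2 by blast
    have "continuous_on {s 0 - real k<..<s 0 + real k} g"
      by (rule continuous_on_subset[OF big[of k]]) auto
    moreover have "x \<in> {s 0 - real k<..<s 0 + real k}" using k by auto
    ultimately show ?thesis by (simp add: continuous_on_eq_continuous_at)
  qed
  then show ?thesis by (simp add: continuous_at_imp_continuous_on)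
qed

locale diagram =
  fixes L :: link
  assumes diagram: "is_diagram L"
begin

abbreviation "I \<equiv> {1..ncomp L}"
abbreviation "E \<equiv> link_set L"
abbreviation "P \<equiv> under_pt L ` crossings L"

lemma circle: "i \<in> I \<Longrightarrow> embedded_circle (strand L i)"
  using diagram unfolding is_diagram_def is_link_def by blast

lemma strand_eqD:
  assumes "i \<in> I" "j \<in> I" "strand L i s = strand L j u"
  shows "i = j" "\<exists>m. u = s + of_int m"
proof -
  have "strand L i s \<in> comp L i \<inter> comp L j"
    using assms(3) by (metis IntI Defs.comp_def rangeI)
  then show "i = j"
    using diagram assms unfolding is_diagram_def is_link_def by blast
  then show "\<exists>m. u = s + of_int m"
    using embedded_circle_eqD[OF circle[OF assms(1)]] assms(3) by blast
qed

lemma strand_of_int: "i \<in> I \<Longrightarrow> strand L i (s + of_int m) = strand L i s"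
  by (rule embedded_circle_of_int[OF circle])

lemma strand_cont: "i \<in> I \<Longrightarrow> continuous_on S (strand L i)"
  using continuous_on_subset[OF embedded_circle_continuous[OF circle]] by blast

lemma strand_inj:
  assumes "i \<in> I" "strand L i s = strand L i u" "\<bar>u - s\<bar> < 1"
  shows "u = s"
proof -
  obtain m where m: "u = s + of_int m" using strand_eqD(2)[OF assms(1,1,2)] by blast
  then have "m = 0" using assms(3) by (simp add: abs_less_iff)
  then show ?thesis using m by simp
qed

lemma strand_E: "i \<in> I \<Longrightarrow> strand L i s \<in> E"
  unfolding link_set_def Defs.comp_def by blast

lemma E_strand: "x \<in> E \<Longrightarrow> \<exists>i\<in>I. \<exists>s\<in>{a..<a+1}. x = strand L i s"
proof -
  assume "x \<in> E"
  then obtain i s where i: "i \<in> I" "x = strand L i s" by (auto simp: link_set_def Defs.comp_def)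
  have "x = strand L i (s + of_int (- \<lfloor>s - a\<rfloor>))" unfolding strand_of_int[OF i(1)] by (rule i(2))
  moreover have "s + of_int (- \<lfloor>s - a\<rfloor>) \<in> {a..<a+1}" by (simp add: algebra_simps) linarith
  ultimately show ?thesis using i(1) by blast
qed

lemma comp_compact: "i \<in> I \<Longrightarrow> compact (comp L i)"
proof -
  assume i: "i \<in> I"
  have "comp L i = strand L i ` {0..1}"
  proof
    show "comp L i \<subseteq> strand L i ` {0..1}"
    proof
      fix x assume "x \<in> comp L i"
      then obtain s where "x = strand L i s" by (auto simp: Defs.comp_def)
      then have "x = strand L i (frac s)"
        using strand_of_int[OF i, of "frac s" "\<lfloor>s\<rfloor>"] by (simp add: frac_def)
      moreover have "frac s \<in> {0..1}" using frac_lt_1[of s] by simp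
      ultimately show "x \<in> strand L i ` {0..1}" by blast
    qed
  qed (auto simp: Defs.comp_def)
  then show ?thesis
    using compact_continuous_image[OF strand_cont[OF i]] by auto
qed

text \<open>Evaluates the definite descriptions at a crossing. The two points of the fibre have
  different heights, as they are distinct with the same projection.\<close>

lemma crossing:
  assumes z: "z \<in> crossings L"
  obtains i s j u v w where "i \<in> I" "j \<in> I" "over_pt L z = strand L i s" "under_pt L z = strand L j u"
    "fst (over_pt L z) = z" "fst (under_pt L z) = z" "snd (under_pt L z) < snd (over_pt L z)"
    "((fst \<circ> strand L j) has_vector_derivative w) (at u)" "Im (cnj v * w) \<noteq> 0" "over_dir L z = v"
    "{x \<in> E. fst x = z} = {over_pt L z, under_pt L z}"
proof -
  obtain i j s u v w where ij: "i \<in> I" "j \<in> I" and eq: "{x \<in> E. fst x = z} = {strand L i s, strand L j u}"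
    and d: "((fst \<circ> strand L i) has_vector_derivative v) (at s)"
      "((fst \<circ> strand L j) has_vector_derivative w) (at u)" "Im (cnj v * w) \<noteq> 0"
    using diagram z unfolding is_diagram_def regular_projection_def by blast
  obtain x y where "x \<in> E" "y \<in> E" "x \<noteq> y" "fst x = z" "fst y = z"
    using z unfolding crossings_def by blast
  then have "x \<in> {strand L i s, strand L j u}" "y \<in> {strand L i s, strand L j u}" "x \<noteq> y"
    using eq by blast+
  then have ne: "strand L i s \<noteq> strand L j u" by auto
  have f: "fst (strand L i s) = z" "fst (strand L j u) = z" using eq by blast+
  then have "snd (strand L i s) \<noteq> snd (strand L j u)" using ne by (metis prod_eqI)
  \<comment> \<open>The strands are named so that the first is the upper one; exchanging them only
    changes the sign of the determinant.\<close>
  then have "\<exists>i s j u v w. i \<in> I \<and> j \<in> I \<and> {x \<in> E. fst x = z} = {strand L i s, strand L j u} \<and>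
    ((fst \<circ> strand L i) has_vector_derivative v) (at s) \<and>
    ((fst \<circ> strand L j) has_vector_derivative w) (at u) \<and> Im (cnj v * w) \<noteq> 0 \<and>
    snd (strand L j u) < snd (strand L i s) \<and> fst (strand L i s) = z \<and> fst (strand L j u) = z"
  proof (cases "snd (strand L j u) < snd (strand L i s)")
    case True
    then show ?thesis using ij eq d f by blast
  next
    case False
    then have "snd (strand L i s) < snd (strand L j u)" using \<open>snd (strand L i s) \<noteq> snd (strand L j u)\<close> by simp
    moreover have "{x \<in> E. fst x = z} = {strand L j u, strand L i s}" using eq by blast
    moreover have "Im (cnj w * v) \<noteq> 0" using d(3) by (simp add: algebra_simps)
    ultimately show ?thesis using ij d f by blast
  qed
  then obtain i s j u v w where ij: "i \<in> I" "j \<in> I" and eq: "{x \<in> E. fst x = z} = {strand L i s, strand L j u}"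
    and d: "((fst \<circ> strand L i) has_vector_derivative v) (at s)"
      "((fst \<circ> strand L j) has_vector_derivative w) (at u)" "Im (cnj v * w) \<noteq> 0"
    and lt: "snd (strand L j u) < snd (strand L i s)" and f: "fst (strand L i s) = z" "fst (strand L j u) = z"
    by blast
  have pts: "x = strand L i s \<or> x = strand L j u" if "x \<in> E" "fst x = z" for x
    using eq that by blast
  have o: "over_pt L z = strand L i s"
    unfolding over_pt_def
  proof (rule the_equality)
    show "strand L i s \<in> E \<and> fst (strand L i s) = z \<and> (\<exists>y\<in>E. fst y = z \<and> snd y < snd (strand L i s))"
      using ij f lt strand_E by blast
    show "x = strand L i s" if "x \<in> E \<and> fst x = z \<and> (\<exists>y\<in>E. fst y = z \<and> snd y < snd x)" for x
      using that pts lt by (metis less_asym less_irrefl)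
  qed
  have un: "under_pt L z = strand L j u"
    unfolding under_pt_def
  proof (rule the_equality)
    show "strand L j u \<in> E \<and> fst (strand L j u) = z \<and> (\<exists>y\<in>E. fst y = z \<and> snd (strand L j u) < snd y)"
      using ij f lt strand_E by blast
    show "x = strand L j u" if "x \<in> E \<and> fst x = z \<and> (\<exists>y\<in>E. fst y = z \<and> snd x < snd y)" for x
      using that pts lt by (metis less_asym less_irrefl)
  qed
  have dir: "over_dir L z = v"
    unfolding over_dir_def
  proof (rule the_equality)
    show "\<exists>i\<in>I. \<exists>s. strand L i s = over_pt L z \<and> ((fst \<circ> strand L i) has_vector_derivative v) (at s)"
      using ij d(1) o by metis
    fix v' assume "\<exists>i\<in>I. \<exists>s. strand L i s = over_pt L z \<and> ((fst \<circ> strand L i) has_vector_derivative v') (at s)"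
    then obtain i' s' where i': "i' \<in> I" "strand L i' s' = strand L i s"
      "((fst \<circ> strand L i') has_vector_derivative v') (at s')" unfolding o by blast
    then have "i' = i" using strand_eqD(1) ij by blast
    \<comment> \<open>Another parameter of the overpassing point differs by an integer, and
      periodicity transports the velocity.\<close>
    moreover obtain m where m: "s = s' + of_int m" using strand_eqD(2)[OF i'(1) ij(1) i'(2)] by blast
    ultimately have "((fst \<circ> strand L i) has_vector_derivative v') (at (s - of_int m))" using i'(3) by simp
    then have "((\<lambda>x. (fst \<circ> strand L i) (x - of_int m)) has_vector_derivative v') (at s)"
      using vector_diff_chain_at[of "\<lambda>x. x - of_int m" 1 s "fst \<circ> strand L i" v']
        has_vector_derivative_diff[OF has_vector_derivative_id has_vector_derivative_const[of "of_int m"], of "at s"]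
      by (simp add: o_def)
    moreover have "(\<lambda>x. (fst \<circ> strand L i) (x - of_int m)) = fst \<circ> strand L i"
      using strand_of_int[OF ij(1), of _ "- m"] by auto
    ultimately have "((fst \<circ> strand L i) has_vector_derivative v') (at s)" by simp
    then show "v' = v" using d(1) vector_derivative_unique_at by blast
  qed
  show ?thesis
    by (rule that[OF ij o un _ _ _ d(2,3) dir]) (use o un f lt eq in auto)
qed

lemma finite_crossings: "finite (crossings L)"
  using diagram unfolding is_diagram_def regular_projection_def by blast

lemma fst_over: "z \<in> crossings L \<Longrightarrow> fst (over_pt L z) = z"
  by (rule crossing)

lemma fst_under: "z \<in> crossings L \<Longrightarrow> fst (under_pt L z) = z"
  by (rule crossing)

lemma under_over: "z \<in> crossings L \<Longrightarrow> snd (under_pt L z) < snd (over_pt L z)"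
  by (rule crossing)

lemma over_E: "z \<in> crossings L \<Longrightarrow> over_pt L z \<in> E"
  by (erule crossing) blast

lemma under_comp: "z \<in> crossings L \<Longrightarrow> \<exists>i\<in>I. under_pt L z \<in> comp L i"
  by (erule crossing, unfold Defs.comp_def) blast

lemma over_free: "z \<in> crossings L \<Longrightarrow> over_pt L z \<in> E - P"
proof -
  assume z: "z \<in> crossings L"
  have "over_pt L z \<noteq> under_pt L y" if y: "y \<in> crossings L" for y
  proof
    assume eq: "over_pt L z = under_pt L y"
    then have "y = z" using fst_over[OF z] fst_under[OF y] by simp
    then show False using eq under_over[OF z] by simp
  qed
  then show ?thesis using over_E[OF z] by blast
qed

lemma arc_superset:
  assumes "connected T" "T \<noteq> {}" "T \<subseteq> E - P"
  shows "\<exists>a\<in>arcs L. T \<subseteq> a"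
  using exists_component_superset[OF assms(3) _ assms(1)] assms unfolding arcs_def by blast

lemma arc_unique:
  assumes "a \<in> arcs L" "b \<in> arcs L" "x \<in> a" "x \<in> b"
  shows "a = b"
  using assms components_nonoverlap unfolding arcs_def by (metis disjoint_iff)

lemma arc_subset: "a \<in> arcs L \<Longrightarrow> a \<subseteq> E - P"
  unfolding arcs_def by (rule in_components_subset)

lemma arc_nonempty: "a \<in> arcs L \<Longrightarrow> a \<noteq> {}"
  unfolding arcs_def by (rule in_components_nonempty)

lemma over_arc_mem:
  assumes "z \<in> crossings L"
  shows "over_arc L z \<in> arcs L" "over_pt L z \<in> over_arc L z"
proof -
  obtain a where a: "a \<in> arcs L" "over_pt L z \<in> a"
    using arc_superset[of "{over_pt L z}"] over_free[OF assms] by auto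
  then have "over_arc L z = a"
    unfolding over_arc_def by (intro the_equality) (auto dest: arc_unique)
  then show "over_arc L z \<in> arcs L" "over_pt L z \<in> over_arc L z" using a by auto
qed

text \<open>Connectedness: the component through a point of the arc and the union of the other
  components are disjoint closed sets that cover the arc.\<close>

lemma arc_comp_ex:
  assumes a: "a \<in> arcs L"
  shows "\<exists>i\<in>I. a \<subseteq> comp L i"
proof -
  obtain x where x: "x \<in> a" using arc_nonempty[OF a] by blast
  then obtain i where i: "i \<in> I" "x \<in> comp L i"
    using arc_subset[OF a] by (auto simp: link_set_def)
  let ?C = "\<Union>j\<in>I - {i}. comp L j"
  have "connected a" using a unfolding arcs_def by (rule in_components_connected)
  moreover have "closed (comp L i)" "closed ?C"
    using comp_compact i by (auto intro!: compact_imp_closed)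
  moreover have "a \<subseteq> comp L i \<union> ?C" using arc_subset[OF a] by (auto simp: link_set_def)
  moreover have "comp L i \<inter> ?C \<inter> a = {}"
    using diagram i unfolding is_diagram_def is_link_def by blast
  ultimately have "comp L i \<inter> a = {} \<or> ?C \<inter> a = {}"
    unfolding connected_closed by blast
  then have "?C \<inter> a = {}" using x i by blast
  then show ?thesis using i \<open>a \<subseteq> comp L i \<union> ?C\<close> by blast
qed

lemma arc_comp_eqI:
  assumes "a \<in> arcs L" "i \<in> I" "strand L i s \<in> a"
  shows "arc_comp L a = i"
  unfolding arc_comp_def
proof (rule the_equality)
  have *: "j = i" if j: "j \<in> I" "a \<subseteq> comp L j" for j
  proof -
    have "strand L i s \<in> comp L j" using j assms by blast
    then show ?thesis using strand_eqD(1)[OF assms(2) j(1)] by (auto simp: Defs.comp_def)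
  qed
  then show "i \<in> I \<and> a \<subseteq> comp L i" using arc_comp_ex[OF assms(1)] by blast
  show "j = i" if "j \<in> I \<and> a \<subseteq> comp L j" for j using * that by blast
qed

lemma arc_strand:
  assumes "a \<in> arcs L"
  shows "\<exists>s. strand L (arc_comp L a) s \<in> a" "arc_comp L a \<in> I" "a \<subseteq> comp L (arc_comp L a)"
proof -
  obtain i where i: "i \<in> I" "a \<subseteq> comp L i" using arc_comp_ex[OF assms] by blast
  then obtain s where "strand L i s \<in> a" using arc_nonempty[OF assms] unfolding Defs.comp_def by blast
  then show "\<exists>s. strand L (arc_comp L a) s \<in> a" "arc_comp L a \<in> I" "a \<subseteq> comp L (arc_comp L a)"
    using arc_comp_eqI[OF assms i(1)] i by auto
qed

lemma local_free:
  assumes i: "i \<in> I"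
  obtains \<delta> where "0 < \<delta>" "\<delta> \<le> 1/2" "\<And>t. \<bar>t - s\<bar> < \<delta> \<Longrightarrow> t \<noteq> s \<Longrightarrow> strand L i t \<notin> P"
proof -
  have "open (- (P - {strand L i s}))"
    using finite_crossings by (intro open_Compl finite_imp_closed) simp
  then have "open (strand L i -` (- (P - {strand L i s})))"
    using strand_cont[OF i, of UNIV] by (simp add: continuous_on_open_vimage)
  moreover have "s \<in> strand L i -` (- (P - {strand L i s}))" by simp
  ultimately obtain e where e: "0 < e" "\<And>t. dist t s < e \<Longrightarrow> strand L i t \<in> - (P - {strand L i s})"
    unfolding open_dist by blast
  have "strand L i t \<notin> P" if t: "\<bar>t - s\<bar> < min e (1/2)" "t \<noteq> s" for t
  proof -
    have "strand L i t \<noteq> strand L i s"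
      using strand_inj[OF i, of s t] t by auto
    moreover have "strand L i t \<in> - (P - {strand L i s})"
      using e(2)[of t] t by (simp add: dist_real_def)
    ultimately show ?thesis by blast
  qed
  then show ?thesis using e(1) by (intro that[of "min e (1/2)"]) auto
qed

lemma interval_arc:
  assumes "i \<in> I" "a < b" "\<And>t. a < t \<Longrightarrow> t < b \<Longrightarrow> strand L i t \<notin> P"
  shows "\<exists>c\<in>arcs L. strand L i ` {a<..<b} \<subseteq> c"
proof (rule arc_superset)
  show "connected (strand L i ` {a<..<b})"
    by (intro connected_continuous_image strand_cont assms) simp
  show "strand L i ` {a<..<b} \<noteq> {}" using assms(2) by simp
  show "strand L i ` {a<..<b} \<subseteq> E - P"
    using assms(3) strand_E[OF assms(1)] by (intro image_subsetI DiffI) simp_all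
qed

text \<open>The rest of the link is compact, so a small neighbourhood in space meets the link only
  in parameters near \<open>s\<close>. This excludes that far parts of the link accumulate at the
  point.\<close>

lemma nbhd:
  assumes i: "i \<in> I" and \<delta>: "0 < \<delta>" "\<delta> \<le> 1/2"
  obtains T where "open T" "strand L i s \<in> T" "E \<inter> T \<subseteq> strand L i ` {s - \<delta><..<s + \<delta>}"
proof -
  let ?C = "(\<Union>j\<in>I - {i}. comp L j) \<union> strand L i ` {s + \<delta>..s + 1 - \<delta>}"
  have "closed ?C"
    using comp_compact i by (intro closed_Un closed_UN compact_imp_closed compact_continuous_image strand_cont) auto
  moreover have "strand L i s \<notin> ?C"
  proof
    assume "strand L i s \<in> ?C"
    then consider j t where "j \<in> I" "j \<noteq> i" "strand L i s = strand L j t"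
      | t where "t \<in> {s + \<delta>..s + 1 - \<delta>}" "strand L i s = strand L i t"
      unfolding Defs.comp_def by blast
    then show False
    proof cases
      case 1
      then show ?thesis using strand_eqD(1)[OF i] by blast
    next
      case 2
      then have "t = s" using \<delta> by (intro strand_inj[OF i]) auto
      then show ?thesis using 2 \<delta> by simp
    qed
  qed
  moreover have "E \<inter> - ?C \<subseteq> strand L i ` {s - \<delta><..<s + \<delta>}"
  proof
    fix x assume x: "x \<in> E \<inter> - ?C"
    then obtain j t where j: "j \<in> I" "t \<in> {s - \<delta>..<s - \<delta> + 1}" "x = strand L j t"
      using E_strand[of x "s - \<delta>"] by blast
    have "strand L j t \<in> comp L j" unfolding Defs.comp_def by blast
    then have "j = i" using x j(1,3) by blast
    have "t \<noteq> s - \<delta>"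
    proof
      assume "t = s - \<delta>"
      then have "s + 1 - \<delta> = t + of_int 1" by simp
      then have "x = strand L i (s + 1 - \<delta>)"
        using strand_of_int[OF i, of t 1] j \<open>j = i\<close> by presburger
      then show False using x \<delta> by auto
    qed
    moreover have "t < s + \<delta>"
    proof (rule ccontr)
      assume "\<not> t < s + \<delta>"
      then have "t \<in> {s + \<delta>..s + 1 - \<delta>}" using j by auto
      then show False using x j \<open>j = i\<close> by auto
    qed
    ultimately show "x \<in> strand L i ` {s - \<delta><..<s + \<delta>}" using j \<open>j = i\<close> by auto
  qed
  ultimately show ?thesis
    by (intro that[of "- ?C"] open_Compl) blast+
qed

text \<open>Evaluates the descriptions of the right and left arc. Here \<open>T\<close> holds the
  parameters on the wanted side and \<open>T'\<close> those on the other. An arc that accumulates at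
  the point from the wanted side has a point with parameter in \<open>T\<close>, hence is
  \<open>a\<close>.\<close>

lemma one_sided:
  assumes j: "j \<in> I" and \<delta>: "0 < \<delta>" "\<delta> \<le> 1/2"
    and a: "a \<in> arcs L" "strand L j ` T \<subseteq> a"
    and T: "{u - \<delta><..<u + \<delta>} \<subseteq> insert u (T \<union> T')" "u \<in> closure T"
    and P: "strand L j u \<in> P"
    and S: "\<And>t. t \<in> T \<Longrightarrow> S (strand L j t)" "\<And>t. t \<in> T' \<Longrightarrow> \<not> S (strand L j t)"
  shows "(THE c. c \<in> arcs L \<and> strand L j u \<in> closure {x \<in> c. S x}) = a"
proof (rule the_equality)
  have "strand L j ` closure T \<subseteq> closure (strand L j ` T)"
    by (rule image_closure_subset[OF strand_cont[OF j] closed_closure closure_subset])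
  also have "\<dots> \<subseteq> closure {x \<in> a. S x}"
    using a S(1) by (intro closure_mono) auto
  finally show "a \<in> arcs L \<and> strand L j u \<in> closure {x \<in> a. S x}" using a(1) T(2) by blast
  fix c assume c: "c \<in> arcs L \<and> strand L j u \<in> closure {x \<in> c. S x}"
  obtain W where W: "open W" "strand L j u \<in> W" "E \<inter> W \<subseteq> strand L j ` {u - \<delta><..<u + \<delta>}"
    using nbhd[OF j \<delta>] by blast
  have "W \<inter> {x \<in> c. S x} \<noteq> {}"
    using c W open_Int_closure_eq_empty[OF W(1)] by blast
  then obtain x where x: "x \<in> W" "x \<in> c" "S x" by blast
  have xE: "x \<in> E" "x \<notin> P" using x c arc_subset by blast+
  then obtain t where t: "x = strand L j t" "t \<in> {u - \<delta><..<u + \<delta>}" using x W(3) by blast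
  have "t \<notin> T'" using S(2) t(1) x(3) by blast
  moreover have "t \<noteq> u" using t(1) P xE by blast
  ultimately have "x \<in> a" using t T(1) a(2) by blast
  then show "c = a" using arc_unique c a(1) x by blast
qed

text \<open>By transversality the lower strand changes sides exactly at the crossing, so one of the
  pieces before and after it is the right arc and the other the left arc.\<close>

lemma under_arcs:
  assumes z: "z \<in> crossings L"
  obtains j u \<delta> a b where "j \<in> I" "under_pt L z = strand L j u" "0 < \<delta>"
    "a \<in> arcs L" "strand L j ` {u - \<delta><..<u} \<subseteq> a" "b \<in> arcs L" "strand L j ` {u<..<u + \<delta>} \<subseteq> b"
    "right_arc L z = a \<and> left_arc L z = b \<or> right_arc L z = b \<and> left_arc L z = a"
proof -
  obtain i s j u v w where "i \<in> I" and j: "j \<in> I" and "over_pt L z = strand L i s"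
    and un: "under_pt L z = strand L j u" and "fst (over_pt L z) = z" and fu: "fst (under_pt L z) = z"
    and "snd (under_pt L z) < snd (over_pt L z)"
    and d: "((fst \<circ> strand L j) has_vector_derivative w) (at u)" "Im (cnj v * w) \<noteq> 0" and v: "over_dir L z = v"
    and "{x \<in> E. fst x = z} = {over_pt L z, under_pt L z}"
    by (rule crossing[OF z])
  \<comment> \<open>Up to scaling, the signed distance from the tangent of the upper strand; its
    derivative at u is the nonzero determinant of the two velocities.\<close>
  define h where "h t = Im (cnj v * (fst (strand L j t) - z))" for t
  have hu: "h u = 0" using fu un by (simp add: h_def)
  have bl: "bounded_linear (\<lambda>x. Im (cnj v * x))"
    by (intro bounded_linear_compose[OF bounded_linear_Im bounded_linear_mult_right])
  have "((\<lambda>t. Im (cnj v * ((fst \<circ> strand L j) t - z))) has_vector_derivative Im (cnj v * w)) (at u)"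
    using bounded_linear.has_vector_derivative[OF bl has_vector_derivative_diff[OF d(1) has_vector_derivative_const[of z]]]
    by simp
  then have h': "(h has_real_derivative Im (cnj v * w)) (at u)"
    unfolding h_def has_real_derivative_iff_has_vector_derivative by simp
  obtain d1 where d1: "0 < d1" "d1 \<le> 1/2" "\<And>t. \<bar>t - u\<bar> < d1 \<Longrightarrow> t \<noteq> u \<Longrightarrow> strand L j t \<notin> P"
    using local_free[OF j] by blast
  have P: "strand L j u \<in> P" using z un by (metis imageI)
  have arcs: "\<exists>a\<in>arcs L. \<exists>b\<in>arcs L. strand L j ` {u - \<delta><..<u} \<subseteq> a \<and> strand L j ` {u<..<u + \<delta>} \<subseteq> b"
    if "0 < \<delta>" "\<delta> \<le> d1" for \<delta>
  proof -
    have "\<exists>a\<in>arcs L. strand L j ` {u - \<delta><..<u} \<subseteq> a"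
      using that by (intro interval_arc[OF j] d1(3)) auto
    moreover have "\<exists>b\<in>arcs L. strand L j ` {u<..<u + \<delta>} \<subseteq> b"
      using that by (intro interval_arc[OF j] d1(3)) auto
    ultimately show ?thesis by blast
  qed
  have R: "right_arc L z = (THE c. c \<in> arcs L \<and> strand L j u \<in> closure {x \<in> c. Im (cnj v * (fst x - z)) < 0})"
    and Lf: "left_arc L z = (THE c. c \<in> arcs L \<and> strand L j u \<in> closure {x \<in> c. Im (cnj v * (fst x - z)) > 0})"
    unfolding right_arc_def left_arc_def v un by simp_all
  have "\<exists>\<delta>>0. \<delta> \<le> d1 \<and> ((\<forall>t\<in>{u - \<delta><..<u}. h t < 0) \<and> (\<forall>t\<in>{u<..<u + \<delta>}. 0 < h t) \<or>
    (\<forall>t\<in>{u - \<delta><..<u}. 0 < h t) \<and> (\<forall>t\<in>{u<..<u + \<delta>}. h t < 0))"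
  proof (cases "0 < Im (cnj v * w)")
    case True
    obtain d2 where d2: "0 < d2" "\<And>t. 0 < t \<Longrightarrow> t < d2 \<Longrightarrow> h u < h (u + t)"
      using DERIV_pos_inc_right[OF h' True] by blast
    obtain d3 where d3: "0 < d3" "\<And>t. 0 < t \<Longrightarrow> t < d3 \<Longrightarrow> h (u - t) < h u"
      using DERIV_pos_inc_left[OF h' True] by blast
    have "0 < h t" if "u < t" "t < u + d2" for t using d2(2)[of "t - u"] that hu by simp
    moreover have "h t < 0" if "u - d3 < t" "t < u" for t using d3(2)[of "u - t"] that hu by simp
    ultimately show ?thesis
      using d1 d2(1) d3(1) by (intro exI[of _ "min d1 (min d2 d3)"]) auto
  next
    case False
    then have neg: "Im (cnj v * w) < 0" using d(2) by linarith
    obtain d2 where d2: "0 < d2" "\<And>t. 0 < t \<Longrightarrow> t < d2 \<Longrightarrow> h u > h (u + t)"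
      using DERIV_neg_dec_right[OF h' neg] by blast
    obtain d3 where d3: "0 < d3" "\<And>t. 0 < t \<Longrightarrow> t < d3 \<Longrightarrow> h (u - t) > h u"
      using DERIV_neg_dec_left[OF h' neg] by blast
    have "h t < 0" if "u < t" "t < u + d2" for t using d2(2)[of "t - u"] that hu by simp
    moreover have "0 < h t" if "u - d3 < t" "t < u" for t using d3(2)[of "u - t"] that hu by simp
    ultimately show ?thesis
      using d1 d2(1) d3(1) by (intro exI[of _ "min d1 (min d2 d3)"]) auto
  qed
  then obtain \<delta> where \<delta>: "0 < \<delta>" "\<delta> \<le> d1" and sgn:
    "(\<forall>t\<in>{u - \<delta><..<u}. h t < 0) \<and> (\<forall>t\<in>{u<..<u + \<delta>}. 0 < h t) \<or>
     (\<forall>t\<in>{u - \<delta><..<u}. 0 < h t) \<and> (\<forall>t\<in>{u<..<u + \<delta>}. h t < 0)" by blast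
  have \<delta>2: "\<delta> \<le> 1/2" using \<delta>(2) d1(2) by simp
  obtain a b where ab: "a \<in> arcs L" "strand L j ` {u - \<delta><..<u} \<subseteq> a" "b \<in> arcs L" "strand L j ` {u<..<u + \<delta>} \<subseteq> b"
    using arcs[OF \<delta>] by blast
  have T: "{u - \<delta><..<u + \<delta>} \<subseteq> insert u ({u - \<delta><..<u} \<union> {u<..<u + \<delta>})" "u \<in> closure {u - \<delta><..<u}"
    "{u - \<delta><..<u + \<delta>} \<subseteq> insert u ({u<..<u + \<delta>} \<union> {u - \<delta><..<u})" "u \<in> closure {u<..<u + \<delta>}"
    using \<delta>(1) by auto
  note before = one_sided[OF j \<delta>(1) \<delta>2 ab(1,2) T(1,2) P] and after = one_sided[OF j \<delta>(1) \<delta>2 ab(3,4) T(3,4) P]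
  have "right_arc L z = a \<and> left_arc L z = b \<or> right_arc L z = b \<and> left_arc L z = a"
    using sgn
  proof (elim disjE conjE)
    assume "\<forall>t\<in>{u - \<delta><..<u}. h t < 0" "\<forall>t\<in>{u<..<u + \<delta>}. 0 < h t"
    then have "right_arc L z = a" "left_arc L z = b"
      unfolding R Lf h_def by (intro before after; force)+
    then show ?thesis by blast
  next
    assume "\<forall>t\<in>{u - \<delta><..<u}. 0 < h t" "\<forall>t\<in>{u<..<u + \<delta>}. h t < 0"
    then have "right_arc L z = b" "left_arc L z = a"
      unfolding R Lf h_def by (intro before after; force)+
    then show ?thesis by blast
  qed
  then show ?thesis using that[OF j un \<delta>(1) ab] by blast
qed

lemma under_arcs_comp:
  assumes "z \<in> crossings L" "i \<in> I" "under_pt L z \<in> comp L i"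
  shows "right_arc L z \<in> arcs L" "left_arc L z \<in> arcs L" "arc_comp L (right_arc L z) = i" "arc_comp L (left_arc L z) = i"
proof -
  obtain j u \<delta> a b where j: "j \<in> I" and un: "under_pt L z = strand L j u" and \<delta>: "0 < \<delta>"
    and ab: "a \<in> arcs L" "strand L j ` {u - \<delta><..<u} \<subseteq> a" "b \<in> arcs L" "strand L j ` {u<..<u + \<delta>} \<subseteq> b"
    and rl: "right_arc L z = a \<and> left_arc L z = b \<or> right_arc L z = b \<and> left_arc L z = a"
    by (rule under_arcs[OF assms(1)])
  have "j = i" using strand_eqD(1)[OF j assms(2)] assms(3) un unfolding Defs.comp_def by auto
  have "strand L j (u - \<delta> / 2) \<in> a" "strand L j (u + \<delta> / 2) \<in> b" using ab \<delta> by auto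
  then have "arc_comp L a = i" "arc_comp L b = i"
    using arc_comp_eqI ab(1,3) j \<open>j = i\<close> by auto
  then show "right_arc L z \<in> arcs L" "left_arc L z \<in> arcs L" "arc_comp L (right_arc L z) = i" "arc_comp L (left_arc L z) = i"
    using rl ab by auto
qed

text \<open>Two local facts with the same case distinction: the finiteness is globalized by
  compactness of a period, the constancy by connectedness of the line.\<close>

lemma local_arcs:
  assumes i: "i \<in> I"
  shows "\<exists>\<delta>>0. finite {a \<in> arcs L. \<exists>t. \<bar>t - s\<bar> < \<delta> \<and> strand L i t \<in> a} \<and>
    (\<forall>S. (\<forall>z\<in>crossings L. right_arc L z \<in> S \<longleftrightarrow> left_arc L z \<in> S) \<longrightarrow>
      (\<exists>c. \<forall>t. \<bar>t - s\<bar> < \<delta> \<longrightarrow> ((\<exists>a\<in>arcs L \<inter> S. strand L i t \<in> a) \<or>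
        (\<exists>z\<in>crossings L. strand L i t = under_pt L z \<and> right_arc L z \<in> S)) = c))"
proof -
  \<comment> \<open>Membership in S along the strand, completed at under points, which belong to no
    arc, by the value of the adjacent right arc.\<close>
  let ?Q = "\<lambda>S t. (\<exists>a\<in>arcs L \<inter> S. strand L i t \<in> a) \<or> (\<exists>z\<in>crossings L. strand L i t = under_pt L z \<and> right_arc L z \<in> S)"
  have Q_arc: "?Q S t \<longleftrightarrow> a \<in> S" if "a \<in> arcs L" "strand L i t \<in> a" for a S t
  proof -
    have "strand L i t \<notin> P" using that arc_subset by blast
    then show ?thesis using that arc_unique by blast
  qed
  obtain \<delta> where \<delta>: "0 < \<delta>" "\<delta> \<le> 1/2" "\<And>t. \<bar>t - s\<bar> < \<delta> \<Longrightarrow> t \<noteq> s \<Longrightarrow> strand L i t \<notin> P"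
    using local_free[OF i] by blast
  show ?thesis
  proof (cases "strand L i s \<in> P")
    case False
    then have "strand L i t \<notin> P" if "s - \<delta> < t" "t < s + \<delta>" for t
      using \<delta>(3)[of t] that by (cases "t = s") (auto simp: abs_less_iff)
    then obtain a where a: "a \<in> arcs L" "strand L i ` {s - \<delta><..<s + \<delta>} \<subseteq> a"
      using interval_arc[OF i, of "s - \<delta>" "s + \<delta>"] \<delta>(1) by auto
    then have ta: "strand L i t \<in> a" if "\<bar>t - s\<bar> < \<delta>" for t using that by (auto simp: abs_less_iff)
    show ?thesis
    proof (intro exI[of _ \<delta>] conjI allI impI \<delta>(1))
      have "{b \<in> arcs L. \<exists>t. \<bar>t - s\<bar> < \<delta> \<and> strand L i t \<in> b} \<subseteq> {a}"
        using ta arc_unique a(1) by blast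
      then show "finite {b \<in> arcs L. \<exists>t. \<bar>t - s\<bar> < \<delta> \<and> strand L i t \<in> b}"
        by (rule finite_subset) simp
      show "\<exists>c. \<forall>t. \<bar>t - s\<bar> < \<delta> \<longrightarrow> ?Q S t = c"
        if "\<forall>z\<in>crossings L. right_arc L z \<in> S \<longleftrightarrow> left_arc L z \<in> S" for S
        by (intro exI[of _ "a \<in> S"] allI impI Q_arc[OF a(1) ta])
    qed
  next
    case True
    then obtain z where z: "z \<in> crossings L" "strand L i s = under_pt L z" by blast
    obtain j u d a b where j: "j \<in> I" and un: "under_pt L z = strand L j u" and d: "0 < d"
      and ab: "a \<in> arcs L" "strand L j ` {u - d<..<u} \<subseteq> a" "b \<in> arcs L" "strand L j ` {u<..<u + d} \<subseteq> b"
      and rl: "right_arc L z = a \<and> left_arc L z = b \<or> right_arc L z = b \<and> left_arc L z = a"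
      by (rule under_arcs[OF z(1)])
    have "i = j" by (rule strand_eqD(1)[OF i j]) (use z(2) un in simp)
    \<comment> \<open>\<open>under_arcs\<close> supplies some parameter of the under point, possibly
      in another period than \<open>s\<close>.\<close>
    obtain m where m: "u = s + of_int m" using strand_eqD(2)[OF i j] z(2) un by auto
    have sh: "strand L i t = strand L j (t + of_int m)" for t
      using strand_of_int[OF i, of t m] \<open>i = j\<close> by simp
    have ta: "strand L i t \<in> a" if "s - d < t" "t < s" for t
      unfolding sh using ab(2) that m by auto
    have tb: "strand L i t \<in> b" if "s < t" "t < s + d" for t
      unfolding sh using ab(4) that m by auto
    have cases: "strand L i t \<in> a \<or> strand L i t \<in> b \<or> t = s" if "\<bar>t - s\<bar> < d" for t
      using ta[of t] tb[of t] that by (cases t s rule: linorder_cases) (auto simp: abs_less_iff)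
    show ?thesis
    proof (intro exI[of _ d] conjI allI impI d)
      have "{c \<in> arcs L. \<exists>t. \<bar>t - s\<bar> < d \<and> strand L i t \<in> c} \<subseteq> {a, b}"
      proof
        fix c assume "c \<in> {c \<in> arcs L. \<exists>t. \<bar>t - s\<bar> < d \<and> strand L i t \<in> c}"
        then obtain t where c: "c \<in> arcs L" "\<bar>t - s\<bar> < d" "strand L i t \<in> c" by blast
        have "t \<noteq> s" using c True arc_subset[OF c(1)] by blast
        then show "c \<in> {a, b}"
          using cases[OF c(2)] arc_unique[OF c(1) ab(1) c(3)] arc_unique[OF c(1) ab(3) c(3)] by blast
      qed
      then show "finite {c \<in> arcs L. \<exists>t. \<bar>t - s\<bar> < d \<and> strand L i t \<in> c}"
        by (rule finite_subset) simp
      fix S assume S: "\<forall>z\<in>crossings L. right_arc L z \<in> S \<longleftrightarrow> left_arc L z \<in> S"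
      have s: "?Q S s \<longleftrightarrow> right_arc L z \<in> S"
      proof -
        have "y = z" if "y \<in> crossings L" "strand L i s = under_pt L y" for y
          using fst_under[OF that(1)] fst_under[OF z(1)] that z by simp
        moreover have "strand L i s \<notin> c" if "c \<in> arcs L" for c
          using True arc_subset[OF that] by blast
        ultimately show ?thesis using z by blast
      qed
      have "?Q S t \<longleftrightarrow> right_arc L z \<in> S" if "\<bar>t - s\<bar> < d" for t
        using cases[OF that]
      proof (elim disjE)
        assume "strand L i t \<in> a"
        from Q_arc[OF ab(1) this] show ?thesis using rl bspec[OF S z(1)] by auto
      next
        assume "strand L i t \<in> b"
        from Q_arc[OF ab(3) this] show ?thesis using rl bspec[OF S z(1)] by auto
      qed (use s in simp)
      then show "\<exists>c. \<forall>t. \<bar>t - s\<bar> < d \<longrightarrow> ?Q S t = c"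
        by (intro exI[of _ "right_arc L z \<in> S"] allI impI)
    qed
  qed
qed

lemma finite_arcs: "finite (arcs L)"
proof -
  have "finite {a \<in> arcs L. \<exists>t\<in>{0..1}. strand L i t \<in> a}" if i: "i \<in> I" for i
  proof -
    have "\<forall>s. \<exists>\<delta>. 0 < \<delta> \<and> finite {a \<in> arcs L. \<exists>t. \<bar>t - s\<bar> < \<delta> \<and> strand L i t \<in> a}"
    proof
      fix s
      from local_arcs[OF i, of s] show "\<exists>\<delta>. 0 < \<delta> \<and> finite {a \<in> arcs L. \<exists>t. \<bar>t - s\<bar> < \<delta> \<and> strand L i t \<in> a}"
        by (elim exE conjE) (intro exI conjI)
    qed
    from choice[OF this] obtain \<delta> where
      "\<forall>s. 0 < \<delta> s \<and> finite {a \<in> arcs L. \<exists>t. \<bar>t - s\<bar> < \<delta> s \<and> strand L i t \<in> a}" ..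
    then have \<delta>: "0 < \<delta> s" "finite {a \<in> arcs L. \<exists>t. \<bar>t - s\<bar> < \<delta> s \<and> strand L i t \<in> a}" for s
      by simp_all
    have "{0..1} \<subseteq> (\<Union>s\<in>{0..1}. ball s (\<delta> s))"
    proof
      fix t :: real assume t: "t \<in> {0..1}"
      have "t \<in> ball t (\<delta> t)" using \<delta>(1) by simp
      then show "t \<in> (\<Union>s\<in>{0..1}. ball s (\<delta> s))" using t by blast
    qed
    then obtain C where C: "C \<subseteq> {0..1}" "finite C" "{0..1} \<subseteq> (\<Union>s\<in>C. ball s (\<delta> s))"
      by (rule compactE_image[OF compact_Icc open_ball])
    have "{a \<in> arcs L. \<exists>t\<in>{0..1}. strand L i t \<in> a} \<subseteq> (\<Union>s\<in>C. {a \<in> arcs L. \<exists>t. \<bar>t - s\<bar> < \<delta> s \<and> strand L i t \<in> a})"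
    proof
      fix a assume "a \<in> {a \<in> arcs L. \<exists>t\<in>{0..1}. strand L i t \<in> a}"
      then obtain t where t: "a \<in> arcs L" "t \<in> {0..1}" "strand L i t \<in> a" by blast
      then obtain s where "s \<in> C" "t \<in> ball s (\<delta> s)" using C(3) by blast
      then show "a \<in> (\<Union>s\<in>C. {a \<in> arcs L. \<exists>t. \<bar>t - s\<bar> < \<delta> s \<and> strand L i t \<in> a})"
        using t by (auto simp: dist_real_def abs_minus_commute)
    qed
    then show ?thesis by (rule finite_subset) (use C(2) \<delta>(2) in blast)
  qed
  moreover have "arcs L \<subseteq> (\<Union>i\<in>I. {a \<in> arcs L. \<exists>t\<in>{0..1}. strand L i t \<in> a})"
  proof
    fix a assume a: "a \<in> arcs L"
    obtain x where x: "x \<in> a" using arc_nonempty[OF a] by blast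
    then have "x \<in> E" using arc_subset[OF a] by blast
    from E_strand[OF this, of 0] obtain i t where "i \<in> I" "t \<in> {0..<1}" "x = strand L i t" by auto
    then show "a \<in> (\<Union>i\<in>I. {a \<in> arcs L. \<exists>t\<in>{0..1}. strand L i t \<in> a})"
      using a x by (intro UN_I[of i]) auto
  qed
  ultimately show ?thesis
    by (intro finite_subset[of "arcs L"]) auto
qed

text \<open>Membership in S, completed at the under points, is locally constant along the
  parametrization, and the real line is connected.\<close>

lemma arcs_connected:
  assumes S: "\<And>z. z \<in> crossings L \<Longrightarrow> right_arc L z \<in> S \<longleftrightarrow> left_arc L z \<in> S"
    and a: "a \<in> S" "a \<in> arcs L" and b: "b \<in> arcs L" "arc_comp L a = arc_comp L b"
  shows "b \<in> S"
proof -
  define i where "i = arc_comp L a"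
  have i: "i \<in> I" using arc_strand[OF a(2)] i_def by simp
  define Q where "Q t \<longleftrightarrow> (\<exists>a\<in>arcs L \<inter> S. strand L i t \<in> a) \<or>
    (\<exists>z\<in>crossings L. strand L i t = under_pt L z \<and> right_arc L z \<in> S)" for t
  obtain s where s: "strand L i s \<in> a" using arc_strand(1)[OF a(2)] i_def by blast
  obtain t where t: "strand L i t \<in> b" using arc_strand(1)[OF b(1)] b(2) i_def by auto
  have "Q t"
  proof (rule connected_induction_simple[of UNIV s t])
    show "connected (UNIV :: real set)" by (rule connected_UNIV)
    show "Q s" using s a unfolding Q_def by blast
    fix x :: real
    obtain \<delta> where \<delta>: "0 < \<delta>"
      "\<forall>S. (\<forall>z\<in>crossings L. right_arc L z \<in> S \<longleftrightarrow> left_arc L z \<in> S) \<longrightarrow>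
        (\<exists>c. \<forall>t. \<bar>t - x\<bar> < \<delta> \<longrightarrow> ((\<exists>a\<in>arcs L \<inter> S. strand L i t \<in> a) \<or>
          (\<exists>z\<in>crossings L. strand L i t = under_pt L z \<and> right_arc L z \<in> S)) = c)"
      using local_arcs[OF i, of x] by (elim exE conjE)
    have "\<exists>c. \<forall>t. \<bar>t - x\<bar> < \<delta> \<longrightarrow> Q t = c"
      unfolding Q_def by (rule \<delta>(2)[rule_format]) (rule S)
    then obtain c where c: "\<And>t. \<bar>t - x\<bar> < \<delta> \<Longrightarrow> Q t = c" by blast
    show "\<exists>T. openin (top_of_set UNIV) T \<and> x \<in> T \<and> (\<forall>y\<in>T. \<forall>z\<in>T. Q y \<longrightarrow> Q z)"
      using \<delta>(1) c by (intro exI[of _ "ball x \<delta>"]) (auto simp: dist_real_def abs_minus_commute)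
  qed auto
  then show ?thesis
    using t b(1) arc_unique arc_subset unfolding Q_def by blast
qed

sublocale wirtinger L
proof
  show "finite (crossings L)" by (rule finite_crossings)
  show "finite (arcs L)" by (rule finite_arcs)
  have ex: "\<exists>a\<in>arcs L. arc_comp L a = i" if i: "i \<in> I" for i
  proof -
    obtain \<delta> where \<delta>: "0 < \<delta>" "\<And>t. \<bar>t - 0\<bar> < \<delta> \<Longrightarrow> t \<noteq> 0 \<Longrightarrow> strand L i t \<notin> P"
      using local_free[OF i] by metis
    then obtain a where a: "a \<in> arcs L" "strand L i ` {0<..<\<delta>} \<subseteq> a"
      using interval_arc[OF i, of 0 \<delta>] by auto
    moreover have "\<delta> / 2 \<in> {0<..<\<delta>}" using \<delta>(1) by simp
    ultimately have "strand L i (\<delta> / 2) \<in> a" by blast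
    then show ?thesis using arc_comp_eqI[OF a(1) i] a(1) by blast
  qed
  show "\<exists>a\<in>arcs L. arc_comp L a = i" if "i \<in> I" for i by (rule ex[OF that])
  have "1 \<in> I" using diagram unfolding is_diagram_def is_link_def by simp
  then show "arcs L \<noteq> {}" using ex by blast
  show "over_arc L z \<in> arcs L" if "z \<in> crossings L" for z by (rule over_arc_mem(1)[OF that])
  show "arc_comp L a \<in> I" if "a \<in> arcs L" for a by (rule arc_strand(2)[OF that])
  note un = under_comp
  show "right_arc L z \<in> arcs L" if "z \<in> crossings L" for z
    using under_arcs_comp(1)[OF that] un[OF that] by blast
  show "left_arc L z \<in> arcs L" if "z \<in> crossings L" for z
    using under_arcs_comp(2)[OF that] un[OF that] by blast
  show "arc_comp L (left_arc L z) = arc_comp L (right_arc L z)" if "z \<in> crossings L" for z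
    using under_arcs_comp(3,4)[OF that] un[OF that] by metis
  show "b \<in> S" if "\<And>z. z \<in> crossings L \<Longrightarrow> right_arc L z \<in> S \<longleftrightarrow> left_arc L z \<in> S"
    "a \<in> S" "a \<in> arcs L" "b \<in> arcs L" "arc_comp L a = arc_comp L b" for S a b
    by (rule arcs_connected[OF that])
qed

end

section \<open>Standard quandles of links with flat reduced module\<close>

text \<open>A finitely supported function is encoded by its graph over the support, a finite set of
  pairs. Countability is later used to find a bijection between two infinite trivial
  quandles.\<close>

lemma countable_poly_mapping:
  assumes "countable (UNIV :: 'k set)" "countable (UNIV :: 'v set)"
  shows "countable (UNIV :: ('k \<Rightarrow>\<^sub>0 'v::zero) set)"
proof -
  let ?g = "\<lambda>p :: 'k \<Rightarrow>\<^sub>0 'v. (\<lambda>k. (k, Poly_Mapping.lookup p k)) ` Poly_Mapping.keys p"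
  have mem: "(k, c) \<in> ?g p \<longleftrightarrow> c = Poly_Mapping.lookup p k \<and> c \<noteq> 0" for k c and p :: "'k \<Rightarrow>\<^sub>0 'v"
    by (auto simp: image_iff in_keys_iff)
  have inj: "inj ?g"
  proof (rule injI, rule poly_mapping_eqI)
    fix p q :: "'k \<Rightarrow>\<^sub>0 'v" and k
    assume "?g p = ?g q"
    then have "(k, c) \<in> ?g p \<longleftrightarrow> (k, c) \<in> ?g q" for c by simp
    then show "Poly_Mapping.lookup p k = Poly_Mapping.lookup q k"
      unfolding mem by metis
  qed
  have "countable (UNIV :: ('k \<times> 'v) set)"
    using countable_SIGMA[OF assms(1), of "\<lambda>_. UNIV"] assms(2) by simp
  then have "countable {A :: ('k \<times> 'v) set. finite A \<and> A \<subseteq> UNIV}"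
    by (rule countable_Collect_finite_subset)
  then have "countable (range ?g)"
    by (rule countable_subset[rotated]) auto
  then show ?thesis
    using countable_image_inj_on[OF _ inj] by blast
qed

lemma countable_laurent: "countable (S :: laurent set)"
proof -
  have "countable (UNIV :: laurent set)"
    by (intro countable_poly_mapping) (rule countableI_type)+
  then show ?thesis by (rule countable_subset[rotated]) simp
qed

context wirtinger
begin

definition flat :: bool where
  "flat \<longleftrightarrow> (\<forall>a\<in>arcs L. \<forall>b\<in>arcs L. sc (var 1 - 1) (dl a - dl b) \<in> rdc.spn)"

definition dsum :: "(space set \<Rightarrow> laurent) \<Rightarrow> laurent" where
  "dsum v = (\<Sum>a\<in>arcs L. v a)"

lemma dsum_simps [simp]:
  "dsum 0 = 0" "dsum (v + w) = dsum v + dsum w" "dsum (v - w) = dsum v - dsum w" "dsum (sc r v) = r * dsum v"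
  "a \<in> arcs L \<Longrightarrow> dsum (dl a) = 1" "v \<in> fn L 1 \<Longrightarrow> dsum v \<in> lring 1"
  using finA by (simp_all add: dsum_def fun_apply sum.distrib sum_subtractf sum_distrib_left dl_def)

lemma dsum_spn: "v \<in> rdc.spn \<Longrightarrow> dsum v = 0"
  by (induction rule: rdc.spn_induct) (simp_all add: rdc.rel_def)

lemma phi_dsum: "rdc.phi v = dsum v * (var 1 - 1)"
  by (simp add: rdc.phi_def dsum_def sum_distrib_right)

text \<open>The reduced phi is the coefficient sum times t - 1, and Laurent polynomials have no zero
  divisors.\<close>

lemma K1_iff: "v \<in> K1 \<longleftrightarrow> v \<in> fn L 1 \<and> dsum v = 0"
proof -
  have "var 1 - 1 \<noteq> 0"
  proof
    assume *: "var 1 - 1 = 0"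
    show False using expt_var[of 1 1] unfolding * by (simp add: expt_def)
  qed
  then show ?thesis by (simp add: K1_def phi_dsum)
qed

lemma K1_closed: "v \<in> K1 \<Longrightarrow> w \<in> K1 \<Longrightarrow> v - w \<in> K1" "v \<in> K1 \<Longrightarrow> w \<in> fn L 1 \<Longrightarrow> w - v \<in> rdc.spn \<Longrightarrow> w \<in> K1"
proof -
  show "v \<in> K1 \<Longrightarrow> w \<in> K1 \<Longrightarrow> v - w \<in> K1" by (simp add: K1_iff)
  show "w \<in> K1" if "v \<in> K1" "w \<in> fn L 1" "w - v \<in> rdc.spn"
    using that dsum_spn[OF that(3)] by (simp add: K1_iff)
qed

text \<open>With coefficient sum 0, v is a combination of differences of arcs, each of which t - 1
  annihilates.\<close>

lemma flat_K1:
  assumes flat and v: "v \<in> K1"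
  shows "sc (var 1 - 1) v \<in> rdc.spn"
proof -
  obtain b where b: "b \<in> arcs L" using neA by blast
  have "(\<Sum>a\<in>arcs L. sc (v a) (sc (var 1 - 1) (dl a - dl b))) \<in> rdc.spn"
    using assms b K1_fn[OF v] unfolding flat_def by (intro rdc.spn_sum rdc.spn_sc[of "v _"]) auto
  moreover have "(\<Sum>a\<in>arcs L. sc (v a) (sc (var 1 - 1) (dl a - dl b))) =
      sc (var 1 - 1) (\<Sum>a\<in>arcs L. sc (v a) (dl a)) - sc ((var 1 - 1) * dsum v) (dl b)"
    by (simp add: dsum_def fun_eq_iff fun_apply sum_fun_apply sum_subtractf sum.distrib
        sum_distrib_left sum_distrib_right algebra_simps)
  moreover have "(\<Sum>a\<in>arcs L. sc (v a) (dl a)) = v"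
    using rdc.fn_expand[OF K1_fn[OF v]] by simp
  moreover have "dsum v = 0" using v by (simp add: K1_iff)
  ultimately show ?thesis by simp
qed

text \<open>On the kernel the standard operation moves v by a multiple of t - 1 times a kernel
  element, so the quandle is trivial there.\<close>

lemma flat_st:
  assumes flat "v \<in> K1" "w \<in> K1"
  shows "st v w - v \<in> rdc.spn" "sti v w - v \<in> rdc.spn"
proof -
  have "st v w - v = sc (var 1 - 1) (v - w)"
    by (simp add: st_def fun_eq_iff fun_apply algebra_simps)
  then show "st v w - v \<in> rdc.spn"
    using flat_K1[OF assms(1) K1_closed(1)[OF assms(2,3)]] by simp
  have "sti v w - v = sc (ivar 1) (sc (var 1 - 1) (w - v))"
    by (simp add: sti_def fun_eq_iff fun_apply algebra_simps)
  moreover have "sc (ivar 1) (sc (var 1 - 1) (w - v)) \<in> rdc.spn"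
    by (rule rdc.spn_sc[OF _ flat_K1[OF assms(1) K1_closed(1)[OF assms(3,2)]]]) simp
  ultimately show "sti v w - v \<in> rdc.spn" by simp
qed

lemma countable_K1: "countable (rdc.cl ` K1)"
proof -
  have "countable (arcs L \<rightarrow>\<^sub>E lring 1)"
    by (intro countable_PiE finA countable_laurent)
  then have "countable (alex_gamma 1 (\<lambda>_. var 1) L ` (arcs L \<rightarrow>\<^sub>E lring 1))"
    by (rule countable_image)
  moreover have "rdc.cl ` K1 \<subseteq> alex_gamma 1 (\<lambda>_. var 1) L ` (arcs L \<rightarrow>\<^sub>E lring 1)"
    using rdc.rs_fn K1_fn unfolding rdc.cl_def by blast
  ultimately show ?thesis by (rule countable_subset[rotated])
qed

text \<open>The integer multiples of a - b are separated by the coordinate \<open>th\<close> of the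
  component of a.\<close>

lemma infinite_K1:
  assumes a: "a \<in> arcs L" and b: "b \<in> arcs L" and ab: "arc_comp L a \<noteq> arc_comp L b"
  shows "infinite (rdc.cl ` K1)"
proof -
  let ?f = "\<lambda>n :: int. sc (of_int n) (dl a - dl b)"
  have K: "?f n \<in> K1" for n using a b by (simp add: K1_iff)
  have "inj (\<lambda>n. rdc.cl (?f n))"
  proof (rule injI)
    fix m n assume "rdc.cl (?f m) = rdc.cl (?f n)"
    then have "?f m - ?f n \<in> rdc.spn" using rdc.cl_eq[OF K1_fn[OF K] K1_fn[OF K]] by blast
    then have "th (arc_comp L a) (?f m - ?f n) = 0" by (rule th_spn)
    then show "m = n" using a b ab by simp
  qed
  then have "infinite (range (\<lambda>n. rdc.cl (?f n)))"
    using infinite_UNIV_char_0[where 'a = int] by (simp add: finite_image_iff)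
  moreover have "range (\<lambda>n. rdc.cl (?f n)) \<subseteq> rdc.cl ` K1" using K by blast
  ultimately show ?thesis using finite_subset by blast
qed

end

context diagram_pair
begin

text \<open>Any bijection between trivial quandles is an isomorphism, and both kernels are countably
  infinite. For the modules it is combined with the identity on coefficient sums.\<close>

lemma flat_same:
  assumes flat: A.flat B.flat
    and ab: "a \<in> arcs L" "b \<in> arcs L" "arc_comp L a \<noteq> arc_comp L b"
    and ab': "a' \<in> arcs L'" "b' \<in> arcs L'" "arc_comp L' a' \<noteq> arc_comp L' b'"
  shows "same_standard_module L L' \<and> same_standard_invariant L L'"
proof -
  let ?C = "A.rdc.cl ` A.K1" and ?C' = "B.rdc.cl ` B.K1"
  obtain \<beta> where \<beta>: "bij_betw \<beta> ?C ?C'"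
    using bij_betw_trans[OF to_nat_on_infinite[OF A.countable_K1 A.infinite_K1[OF ab]]
        bij_betw_inv_into[OF to_nat_on_infinite[OF B.countable_K1 B.infinite_K1[OF ab']]]] by blast
  define g where "g v = B.rdc.rep (\<beta> (A.rdc.cl v))" for v
  have g: "g v \<in> B.K1" "B.rdc.cl (g v) = \<beta> (A.rdc.cl v)" if v: "v \<in> A.K1" for v
  proof -
    have "\<beta> (A.rdc.cl v) \<in> ?C'" using \<beta> v bij_betwE by blast
    then obtain x where x: "x \<in> B.K1" "\<beta> (A.rdc.cl v) = B.rdc.cl x" by blast
    note r = B.rdc.rep_cl[OF B.K1_fn[OF x(1)]]
    show "g v \<in> B.K1" unfolding g_def x(2) by (rule B.K1_closed(2)[OF x(1) r])
    show "B.rdc.cl (g v) = \<beta> (A.rdc.cl v)"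
      unfolding g_def x(2) by (rule B.rdc.cl_eqI[OF r(1) B.K1_fn[OF x(1)] r(2)])
  qed
  have g_eq: "g v - g w \<in> B.rdc.spn \<longleftrightarrow> v - w \<in> A.rdc.spn" if "v \<in> A.K1" "w \<in> A.K1" for v w
  proof -
    have "g v - g w \<in> B.rdc.spn \<longleftrightarrow> \<beta> (A.rdc.cl v) = \<beta> (A.rdc.cl w)"
      using B.rdc.cl_eq[OF B.K1_fn[OF g(1)[OF that(1)]] B.K1_fn[OF g(1)[OF that(2)]]] g(2) that by simp
    also have "\<dots> \<longleftrightarrow> A.rdc.cl v = A.rdc.cl w"
      using bij_betw_imp_inj_on[OF \<beta>] that by (simp add: inj_on_eq_iff)
    also have "\<dots> \<longleftrightarrow> v - w \<in> A.rdc.spn"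
      using that by (intro A.rdc.cl_eq A.K1_fn)
    finally show ?thesis .
  qed
  have g_surj: "\<exists>v\<in>A.K1. g v - v' \<in> B.rdc.spn" if v': "v' \<in> B.K1" for v'
  proof -
    have "B.rdc.cl v' \<in> \<beta> ` ?C" using bij_betw_imp_surj_on[OF \<beta>] v' by blast
    then obtain v where v: "v \<in> A.K1" "B.rdc.cl v' = \<beta> (A.rdc.cl v)" by blast
    then have "g v - v' \<in> B.rdc.spn"
      using B.rdc.cl_eq[OF B.K1_fn[OF g(1)[OF v(1)]] B.K1_fn[OF v']] g(2) by simp
    then show ?thesis using v(1) by blast
  qed
  have g_st: "g (A.st v w) - B.st (g v) (g w) \<in> B.rdc.spn" "g (A.sti v w) - B.sti (g v) (g w) \<in> B.rdc.spn"
    if vw: "v \<in> A.K1" "w \<in> A.K1" for v w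
  proof -
    have "g (A.st v w) - g v \<in> B.rdc.spn" "g (A.sti v w) - g v \<in> B.rdc.spn"
      using g_eq A.flat_st[OF flat(1) vw] vw by simp_all
    from B.rdc.spn_diff[OF this(1) B.flat_st(1)[OF flat(2) g(1)[OF vw(1)] g(1)[OF vw(2)]]]
      B.rdc.spn_diff[OF this(2) B.flat_st(2)[OF flat(2) g(1)[OF vw(1)] g(1)[OF vw(2)]]]
    show "g (A.st v w) - B.st (g v) (g w) \<in> B.rdc.spn" "g (A.sti v w) - B.sti (g v) (g w) \<in> B.rdc.spn"
      by simp_all
  qed
  have K1: "A.K1 \<subseteq> fn L 1" "B.K1 \<subseteq> fn L' 1" using A.K1_fn B.K1_fn by blast+
  have "same_standard_invariant L L'"
    unfolding same_standard_invariant_def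
    by (rule quandles_isomorphicI[where g = g and H = "A.K1" and H' = "B.K1", OF K1 g(1) g_eq g_surj _ g_st(1) _ g_st(2)])
      (simp_all add: A.invariant_simps B.invariant_simps)
  \<comment> \<open>A base arc splits off the coefficient sum: the sum transforms as in the standard
    quandle of the ring, the remaining part lies in the kernel, where the operation is
    trivial.\<close>
  define pr where "pr v = v - sc (A.dsum v) (dl a)" for v
  have pr: "pr v \<in> A.K1" if "v \<in> fn L 1" for v
    using that ab(1) by (simp add: pr_def A.K1_iff)
  define h where "h v = sc (A.dsum v) (dl a') + g (pr v)" for v
  have h_fn: "h v \<in> fn L' 1" if v: "v \<in> fn L 1" for v
    using v ab'(1) B.K1_fn[OF g(1)[OF pr[OF v]]] by (simp add: h_def)
  have h_dsum: "B.dsum (h v) = A.dsum v" if v: "v \<in> fn L 1" for v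
    using g(1)[OF pr[OF v]] ab'(1) by (simp add: h_def B.K1_iff)
  have h_eq: "h v - h w \<in> B.rdc.spn \<longleftrightarrow> v - w \<in> A.rdc.spn" if vw: "v \<in> fn L 1" "w \<in> fn L 1" for v w
  proof (cases "A.dsum v = A.dsum w")
    case True
    then have "h v - h w = g (pr v) - g (pr w)" "pr v - pr w = v - w" by (simp_all add: h_def pr_def)
    then show ?thesis using g_eq[OF pr[OF vw(1)] pr[OF vw(2)]] by simp
  next
    case False
    then show ?thesis
      using h_dsum[OF vw(1)] h_dsum[OF vw(2)] B.dsum_spn[of "h v - h w"] A.dsum_spn[of "v - w"] by auto
  qed
  have h_surj: "\<exists>v\<in>fn L 1. h v - v' \<in> B.rdc.spn" if v': "v' \<in> fn L' 1" for v'
  proof -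
    have "v' - sc (B.dsum v') (dl a') \<in> B.K1" using v' ab'(1) by (simp add: B.K1_iff)
    then obtain k where k: "k \<in> A.K1" "g k - (v' - sc (B.dsum v') (dl a')) \<in> B.rdc.spn"
      using g_surj by blast
    let ?v = "sc (B.dsum v') (dl a) + k"
    have "?v \<in> fn L 1" using v' ab(1) A.K1_fn[OF k(1)] by simp
    moreover have "A.dsum ?v = B.dsum v'" "pr ?v = k"
      using k(1) ab(1) by (simp_all add: pr_def A.K1_iff)
    then have "h ?v - v' = g k - (v' - sc (B.dsum v') (dl a'))" by (simp add: h_def)
    ultimately show ?thesis
      using k(2) by (intro bexI[of _ ?v]) (simp_all only:)
  qed
  have lin: "h x - (sc (A.dsum x) (dl a') + y) \<in> B.rdc.spn"
    if "g (pr x) - y \<in> B.rdc.spn" for x y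
    using that by (simp add: h_def)
  have h_st: "h (A.st v w) - B.st (h v) (h w) \<in> B.rdc.spn" "h (A.sti v w) - B.sti (h v) (h w) \<in> B.rdc.spn"
    if vw: "v \<in> fn L 1" "w \<in> fn L 1" for v w
  proof -
    have 1: "pr (A.st v w) = A.st (pr v) (pr w)" "pr (A.sti v w) = A.sti (pr v) (pr w)"
      by (simp_all add: pr_def A.st_def A.sti_def fun_eq_iff fun_apply algebra_simps)
    have 2: "B.st (h v) (h w) = sc (A.dsum (A.st v w)) (dl a') + B.st (g (pr v)) (g (pr w))"
      "B.sti (h v) (h w) = sc (A.dsum (A.sti v w)) (dl a') + B.sti (g (pr v)) (g (pr w))"
      by (simp_all add: h_def A.st_def A.sti_def B.st_def B.sti_def fun_eq_iff fun_apply algebra_simps)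
    show "h (A.st v w) - B.st (h v) (h w) \<in> B.rdc.spn" "h (A.sti v w) - B.sti (h v) (h w) \<in> B.rdc.spn"
      unfolding 2 by (rule lin, unfold 1, rule g_st[OF pr[OF vw(1)] pr[OF vw(2)]])+
  qed
  have "same_standard_module L L'"
    unfolding same_standard_module_def
    by (rule quandles_isomorphicI[where g = h and H = "fn L 1" and H' = "fn L' 1", OF _ _ h_fn h_eq h_surj _ h_st(1) _ h_st(2)])
      (simp_all add: A.standard_simps(1) B.standard_simps(1))
  with \<open>same_standard_invariant L L'\<close> show ?thesis by blast
qed

end

section \<open>Criteria for trivial and nontrivial multivariate quandles\<close>

context wirtinger
begin

text \<open>The product of x and y differs from x by phi(y) x - phi(x) y. This expression is
  bilinear, so it vanishes as soon as it does on pairs of arcs.\<close>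

lemma tri_trivial:
  assumes ab: "\<And>a b. a \<in> arcs L \<Longrightarrow> b \<in> arcs L \<Longrightarrow>
      sc (var (arc_comp L b) - 1) (dl a) - sc (var (arc_comp L a) - 1) (dl b) \<in> mul.spn"
    and X: "X \<in> carrier (total_quandle L)" and Y: "Y \<in> carrier (total_quandle L)"
  shows "tri (total_quandle L) X Y = X"
proof -
  obtain v w where v: "v \<in> fn L (ncomp L)" "X = mul.cl v" and w: "w \<in> fn L (ncomp L)" "Y = mul.cl w"
    using X Y U_fn unfolding total_simps(1) by blast
  have 1: "sc (var (arc_comp L b) - 1) v - sc (mul.phi v) (dl b) \<in> mul.spn" if b: "b \<in> arcs L" for b
  proof -
    have "(\<Sum>a\<in>arcs L. sc (v a) (sc (var (arc_comp L b) - 1) (dl a) - sc (var (arc_comp L a) - 1) (dl b))) \<in> mul.spn"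
      using v by (intro mul.spn_sum mul.spn_sc ab b) auto
    moreover have "(\<Sum>a\<in>arcs L. sc (v a) (sc (var (arc_comp L b) - 1) (dl a) - sc (var (arc_comp L a) - 1) (dl b)))
      = sc (var (arc_comp L b) - 1) (\<Sum>a\<in>arcs L. sc (v a) (dl a)) - sc (mul.phi v) (dl b)"
      by (simp add: mul.phi_def fun_eq_iff fun_apply sum_fun_apply sum_subtractf sum.distrib
          sum_distrib_left sum_distrib_right algebra_simps)
    ultimately show ?thesis using mul.fn_expand[OF v(1)] by simp
  qed
  have "(\<Sum>b\<in>arcs L. sc (w b) (sc (var (arc_comp L b) - 1) v - sc (mul.phi v) (dl b))) \<in> mul.spn"
    using w by (intro mul.spn_sum mul.spn_sc 1) auto
  moreover have "(\<Sum>b\<in>arcs L. sc (w b) (sc (var (arc_comp L b) - 1) v - sc (mul.phi v) (dl b)))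
    = sc (mul.phi w) v - sc (mul.phi v) (\<Sum>b\<in>arcs L. sc (w b) (dl b))"
    by (simp add: mul.phi_def[of w] fun_eq_iff fun_apply sum_fun_apply sum_subtractf sum.distrib
        sum_distrib_left sum_distrib_right algebra_simps)
  moreover have "tr v w - v = sc (mul.phi w) v - sc (mul.phi v) w"
    by (simp add: tr_def fun_eq_iff fun_apply algebra_simps)
  ultimately have "tr v w - v \<in> mul.spn"
    using mul.fn_expand[OF w(1)] by simp
  then show ?thesis
    unfolding v(2) w(2) total_simps(2)[OF v(1) w(1)] using v w by (intro mul.cl_eqI) simp_all
qed

lemma tri_nontrivial:
  assumes n: "3 \<le> ncomp L"
    and z: "\<And>z. z \<in> crossings L \<Longrightarrow>
      {arc_comp L (over_arc L z), arc_comp L (right_arc L z)} \<noteq> {2, 3}"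
  shows "\<exists>X\<in>Q. \<exists>Y\<in>Q. tri (total_quandle L) X Y \<noteq> X"
proof -
  \<comment> \<open>evaluation at \<open>t\<^sub>2 = -1\<close> and \<open>t\<^sub>i = 1\<close> otherwise\<close>
  define eps :: "laurent \<Rightarrow> int" where "eps = ev (\<lambda>m. if even (Poly_Mapping.lookup m 2) then 1 else - 1)"
  have eps: "eps 0 = 0" "eps 1 = 1" "eps (p + q) = eps p + eps q" "eps (p - q) = eps p - eps q"
    "eps (p * q) = eps p * eps q" "eps (var i) = (if i = 2 then - 1 else 1)" for p q i
    unfolding eps_def by (simp_all add: ev_add ev_diff ev_one ev_mult lookup_add var_frag_of ev_frag_of lookup_single)
  \<comment> \<open>A functional on the module that reads the coefficients of component 3. It kills
    a crossing relation unless components 2 and 3 meet there: only then does the factor t_2 - 1, of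
    value -2, appear.\<close>
  define psi where "psi v = (\<Sum>a\<in>arcs L. if arc_comp L a = 3 then eps (v a) else 0)" for v
  have psi: "psi (v + w) = psi v + psi w" "psi (v - w) = psi v - psi w" "psi (sc r v) = eps r * psi v" for v w r
    by (auto simp: psi_def fun_apply eps sum.distrib[symmetric] sum_subtractf[symmetric] sum_distrib_left intro!: sum.cong)
  have psi_dl: "psi (dl a) = (if arc_comp L a = 3 then 1 else 0)" if "a \<in> arcs L" for a
  proof -
    have "psi (dl a) = (\<Sum>b\<in>arcs L. if b = a then (if arc_comp L a = 3 then 1 else 0) else 0)"
      unfolding psi_def by (intro sum.cong) (auto simp: dl_def eps)
    then show ?thesis using that finA by simp
  qed
  have psi_spn: "psi v = 0" if "v \<in> mul.spn" for v
    using that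
  proof (induction rule: mul.spn_induct)
    case zero
    show ?case using psi(2)[of 0 0] by simp
  next
    case (add r y v)
    have "psi (mul.rel y) = 0"
      using z[OF add(2)] add(2) by (auto simp: mul.rel_def psi psi_dl eps comp_left)
    then show ?case using add by (simp add: psi)
  qed
  obtain a c where a: "a \<in> arcs L" "arc_comp L a = 2" and c: "c \<in> arcs L" "arc_comp L c = 3"
    using comp_arc[of 2] comp_arc[of 3] n by auto
  have "psi (tr (dl c) (dl a) - dl c) = - 2"
    using a c by (simp add: tr_def psi psi_dl eps)
  then have "tr (dl c) (dl a) - dl c \<notin> mul.spn" using psi_spn by force
  then have "tri (total_quandle L) (mul.cl (dl c)) (mul.cl (dl a)) \<noteq> mul.cl (dl c)"
    using a c by (simp add: total_simps mul.cl_eq)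
  then show ?thesis using Q_dl[OF a(1)] Q_dl[OF c(1)] by blast
qed

end

lemma not_quandles_isomorphic:
  assumes "\<And>x y. x \<in> carrier Q \<Longrightarrow> y \<in> carrier Q \<Longrightarrow> tri Q x y = x"
    and xy: "x \<in> carrier Q'" "y \<in> carrier Q'" "tri Q' x y \<noteq> x"
  shows "\<not> quandles_isomorphic Q Q'"
proof
  assume "quandles_isomorphic Q Q'"
  then obtain f where f: "bij_betw f (carrier Q) (carrier Q')"
    "\<And>x y. x \<in> carrier Q \<Longrightarrow> y \<in> carrier Q \<Longrightarrow> f (tri Q x y) = tri Q' (f x) (f y)"
    unfolding quandles_isomorphic_def quandle_iso_def by blast
  obtain u v where "u \<in> carrier Q" "v \<in> carrier Q" "x = f u" "y = f v"
    using xy bij_betw_imp_surj_on[OF f(1)] by blast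
  then show False using f(2)[of u v] assms(1)[of u v] xy(3) by simp
qed

context diagram
begin

lemma over_under_set: "z \<in> crossings L \<Longrightarrow> {x \<in> E. fst x = z} = {over_pt L z, under_pt L z}"
  by (erule crossing)

lemma over_arc_comp:
  assumes "z \<in> crossings L" "i \<in> I" "over_pt L z \<in> comp L i"
  shows "arc_comp L (over_arc L z) = i"
  using arc_comp_eqI[OF over_arc_mem(1)[OF assms(1)] assms(2)] over_arc_mem(2)[OF assms(1)] assms(3)
  unfolding Defs.comp_def by auto

text \<open>A circle that passes under exactly once is, with that point removed, the image of one
  open period and hence connected.\<close>

lemma single_arc:
  assumes i: "i \<in> I" and p: "p \<in> P" "p \<in> comp L i" and P: "\<And>x. x \<in> P \<Longrightarrow> x \<in> comp L i \<Longrightarrow> x = p"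
    and ab: "a \<in> arcs L" "b \<in> arcs L" "arc_comp L a = i" "arc_comp L b = i"
  shows "a = b"
proof -
  obtain u where u: "p = strand L i u" using p(2) unfolding Defs.comp_def by blast
  have free: "strand L i t \<notin> P" if t: "u < t" "t < u + 1" for t
  proof
    assume "strand L i t \<in> P"
    then have "strand L i u = strand L i t" using P[of "strand L i t"] u unfolding Defs.comp_def by auto
    then have "t = u" using t by (intro strand_inj[OF i]) auto
    then show False using t by simp
  qed
  obtain c where c: "c \<in> arcs L" "strand L i ` {u<..<u + 1} \<subseteq> c"
    using interval_arc[OF i, of u "u + 1"] free by auto
  have *: "d = c" if d: "d \<in> arcs L" "arc_comp L d = i" for d
  proof -
    obtain s where s: "strand L i s \<in> d" using arc_strand(1)[OF d(1)] d(2) by blast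
    define t where "t = s + of_int (- \<lfloor>s - u\<rfloor>)"
    have t: "strand L i t \<in> d" unfolding t_def strand_of_int[OF i] by (rule s)
    have "u \<le> t" "t < u + 1" unfolding t_def by linarith+
    moreover have "t \<noteq> u"
    proof
      assume "t = u"
      then have "p \<in> d" using t u by simp
      then show False using p(1) arc_subset[OF d(1)] by blast
    qed
    ultimately have "strand L i t \<in> c" using c(2) by auto
    then show ?thesis using arc_unique[OF d(1) c(1) t] by blast
  qed
  show ?thesis using *[OF ab(1,3)] *[OF ab(2,4)] by simp
qed

end

section \<open>Arcs whose difference is killed by t - 1\<close>

context wirtinger
begin

definition eqv :: "space set \<Rightarrow> space set \<Rightarrow> bool" where
  "eqv a b \<longleftrightarrow> sc (var 1 - 1) (dl a - dl b) \<in> rdc.spn"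

lemma eqv_refl: "eqv a a"
  by (simp add: eqv_def)

lemma eqv_sym: "eqv a b \<Longrightarrow> eqv b a"
  using rdc.spn_uminus[of "sc (var 1 - 1) (dl a - dl b)"] unfolding eqv_def by (simp add: sc_right_distrib)

lemma eqv_trans: "eqv a b \<Longrightarrow> eqv b c \<Longrightarrow> eqv a c"
  using rdc.spn_add[of "sc (var 1 - 1) (dl a - dl b)" "sc (var 1 - 1) (dl b - dl c)"]
  unfolding eqv_def by (simp add: sc_right_distrib)

text \<open>If the arc below is not cut into two different arcs, the crossing relation is itself the
  required torsion relation.\<close>

lemma eqv_same:
  assumes "z \<in> crossings L" "right_arc L z = left_arc L z"
  shows "eqv (over_arc L z) (left_arc L z)"
proof -
  have "sc (var 1 - 1) (dl (over_arc L z) - dl (left_arc L z)) = - rdc.rel z"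
    using assms(2) by (simp add: rdc.rel_def fun_eq_iff fun_apply algebra_simps)
  then show ?thesis using rdc.spn_uminus[OF rdc.rel_spn[OF assms(1)]] by (simp add: eqv_def)
qed

text \<open>For arcs o, r, l above, right and left, o - l is t (o - r) plus the crossing relation,
  and t is a unit.\<close>

lemma eqv_right_left:
  assumes z: "z \<in> crossings L"
  shows "eqv (over_arc L z) (right_arc L z) \<longleftrightarrow> eqv (over_arc L z) (left_arc L z)"
proof -
  let ?o = "over_arc L z" and ?r = "right_arc L z" and ?l = "left_arc L z"
  have rel: "sc (var 1 - 1) (rdc.rel z) \<in> rdc.spn"
    using z by (intro rdc.spn_sc) auto
  have 1: "sc (var 1 - 1) (dl ?o - dl ?l) = sc (var 1) (sc (var 1 - 1) (dl ?o - dl ?r)) + sc (var 1 - 1) (rdc.rel z)"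
    by (simp add: rdc.rel_def fun_eq_iff fun_apply algebra_simps)
  then have 2: "sc (var 1 - 1) (dl ?o - dl ?r) = sc (ivar 1) (sc (var 1 - 1) (dl ?o - dl ?l) - sc (var 1 - 1) (rdc.rel z))"
    by simp
  show ?thesis
  proof
    assume "eqv ?o ?r"
    then have "sc (var 1) (sc (var 1 - 1) (dl ?o - dl ?r)) \<in> rdc.spn"
      unfolding eqv_def by (rule rdc.spn_sc[rotated]) simp
    then show "eqv ?o ?l" unfolding eqv_def 1 using rel by (rule rdc.spn_add)
  next
    assume "eqv ?o ?l"
    from rdc.spn_diff[OF this[unfolded eqv_def] rel]
    have "sc (ivar 1) (sc (var 1 - 1) (dl ?o - dl ?l) - sc (var 1 - 1) (rdc.rel z)) \<in> rdc.spn"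
      by (rule rdc.spn_sc[rotated]) simp
    then show "eqv ?o ?r" unfolding eqv_def 2 .
  qed
qed

end

section \<open>The Hopf link and the chain of three circles\<close>

text \<open>A unit circle in projection, lying in space on a plane through its centre whose height
  grows with slope \<open>h\<close> in the imaginary direction.\<close>

definition circ :: "complex \<Rightarrow> real \<Rightarrow> real \<Rightarrow> space" where
  "circ c h s = (c + cis (2 * pi * s), h * sin (2 * pi * s))"

lemma cis_deriv: "((\<lambda>s. w * cis (2 * pi * s)) has_vector_derivative 2 * pi * \<i> * (w * cis (2 * pi * s))) (at s within S)"
proof -
  have "((\<lambda>z. w * exp (2 * pi * \<i> * z)) has_field_derivative 2 * pi * \<i> * (w * exp (2 * pi * \<i> * of_real s))) (at (of_real s))"
    by (auto intro!: derivative_eq_intros)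
  from has_vector_derivative_real_field[OF this]
  show ?thesis by (simp add: cis_conv_exp algebra_simps)
qed

lemma circ_smooth: "smooth_regular_on S (circ c h)" "smooth_regular_on S (fst \<circ> circ c h)"
proof -
  define D where "D k s = (if k = (0::nat) then c else 0) + (2 * pi * \<i>) ^ k * cis (2 * pi * s)" for k and s :: real
  define H where "H k s = h * Im ((2 * pi * \<i>) ^ k * cis (2 * pi * s))" for k and s :: real
  have D: "(D k has_vector_derivative D (Suc k) s) (at s within S)" for k s
    unfolding D_def using has_vector_derivative_add[OF has_vector_derivative_const cis_deriv[of "(2 * pi * \<i>) ^ k" s S]]
    by (simp add: mult.assoc)
  have bl: "bounded_linear (\<lambda>x. h * Im x)"
    by (intro bounded_linear_compose[OF bounded_linear_mult_right bounded_linear_Im])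
  have H: "(H k has_vector_derivative H (Suc k) s) (at s within S)" for k s
    unfolding H_def using bounded_linear.has_vector_derivative[OF bl cis_deriv[of "(2 * pi * \<i>) ^ k" s S]]
    by (simp add: mult.assoc)
  have ne: "D 1 s \<noteq> 0" for s
    by (simp add: D_def)
  have c: "circ c h = (\<lambda>s. (D 0 s, H 0 s))" "fst \<circ> circ c h = D 0"
    by (auto simp: circ_def D_def H_def fun_eq_iff)
  show "smooth_regular_on S (circ c h)"
    unfolding smooth_regular_on_def
    by (rule exI[of _ "\<lambda>k s. (D k s, H k s)"]) (use D H ne c in \<open>auto simp: zero_prod_def intro!: has_vector_derivative_Pair\<close>)
  show "smooth_regular_on S (fst \<circ> circ c h)"
    unfolding smooth_regular_on_def
    by (rule exI[of _ D]) (use D ne c in auto)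
qed

lemma circ_piecewise: "piecewise_regular (circ c h)" "piecewise_regular (fst \<circ> circ c h)"
  unfolding piecewise_regular_def
  by (rule exI[of _ real], rule exI[of _ 1], simp add: circ_smooth)+

lemma circ_deriv: "((fst \<circ> circ c h) has_vector_derivative 2 * pi * \<i> * (fst (circ c h s) - c)) (at s)"
  using has_vector_derivative_add[OF has_vector_derivative_const[of c] cis_deriv[of 1 s UNIV]]
  by (simp add: circ_def o_def)

lemma circ_embedded: "embedded_circle (circ c h)"
  unfolding embedded_circle_def
proof (intro conjI allI circ_piecewise)
  show "circ c h (s + 1) = circ c h s" for s
  proof -
    have "2 * pi * (s + 1) = 2 * pi * s + 2 * pi" by (simp add: algebra_simps)
    then show ?thesis by (simp add: circ_def cis_mult[symmetric])
  qed
  show "inj_on (circ c h) {0..<1}"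
  proof (rule inj_onI)
    fix s t assume st: "s \<in> {0..<1}" "t \<in> {0..<1}" "circ c h s = circ c h t"
    then have "cis (2 * pi * s) = cis (2 * pi * t)" by (simp add: circ_def)
    then have "cos (2 * pi * s) = cos (2 * pi * t) \<and> sin (2 * pi * s) = sin (2 * pi * t)"
      by (simp add: complex_eq_iff)
    then obtain n where n: "2 * pi * s = 2 * pi * t + 2 * pi * of_int n"
      using sin_cos_eq_iff[of "2 * pi * s" "2 * pi * t"] by auto
    then have "2 * pi * s = 2 * pi * (t + of_int n)" by (simp add: algebra_simps)
    then have "s = t + of_int n" using pi_gt_zero by simp
    moreover then have "n = 0" using st by auto
    ultimately show "s = t" by simp
  qed
qed

lemma range_circ: "range (circ c h) = {x. cmod (fst x - c) = 1 \<and> snd x = h * Im (fst x - c)}"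
proof
  show "range (circ c h) \<subseteq> {x. cmod (fst x - c) = 1 \<and> snd x = h * Im (fst x - c)}"
    by (auto simp: circ_def)
  show "{x. cmod (fst x - c) = 1 \<and> snd x = h * Im (fst x - c)} \<subseteq> range (circ c h)"
  proof
    fix x assume x: "x \<in> {x. cmod (fst x - c) = 1 \<and> snd x = h * Im (fst x - c)}"
    then have "fst x - c \<noteq> 0" by auto
    then have "cis (Arg (fst x - c)) = fst x - c"
      using cis_Arg[of "fst x - c"] x by (simp add: sgn_eq)
    then have e: "fst x = c + cis (2 * pi * (Arg (fst x - c) / (2 * pi)))" "Im (fst x - c) = sin (2 * pi * (Arg (fst x - c) / (2 * pi)))"
      by (simp_all add: complex_eq_iff)
    have "x = circ c h (Arg (fst x - c) / (2 * pi))"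
      using x e unfolding circ_def by (metis (mono_tags, lifting) mem_Collect_eq prod.collapse)
    then show "x \<in> range (circ c h)" by blast
  qed
qed

text \<open>Circle 1 is horizontal and meets the tilted circles 2 and 3 in projection.  It passes under them at
  the crossings with positive imaginary part and over them at the others.  \<open>chain 2\<close> is the Hopf link.\<close>

definition center :: "nat \<Rightarrow> real" where
  "center i = (if i = 1 then 0 else if i = 2 then 8/5 else - 8/5)"

definition tilt :: "nat \<Rightarrow> real" where
  "tilt i = (if i = 1 then 0 else 1)"

definition chain :: "nat \<Rightarrow> link" where
  "chain n = \<lparr>ncomp = n, strand = \<lambda>i. circ (of_real (center i)) (tilt i)\<rparr>"

lemma ncomp_chain [simp]: "ncomp (chain n) = n"
  by (simp add: chain_def)

lemma comp_chain: "x \<in> comp (chain n) i \<longleftrightarrow>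
    (Re (fst x) - center i)\<^sup>2 + (Im (fst x))\<^sup>2 = 1 \<and> snd x = tilt i * Im (fst x)"
proof -
  have "cmod z = 1 \<longleftrightarrow> (Re z)\<^sup>2 + (Im z)\<^sup>2 = 1" for z
    by (metis cmod_power2 norm_ge_zero one_power2 power2_eq_iff_nonneg zero_le_one)
  then show ?thesis
    by (simp add: Defs.comp_def chain_def range_circ)
qed

text \<open>Unit circles with centres 8/5 apart meet at horizontal distance 4/5 from both, and the
  3-4-5 triangle puts the crossings at the rational heights 3/5 and -3/5 in the plane. The outer
  circles have centres 16/5 apart and do not meet.\<close>

lemma chain_meet:
  assumes n: "n \<in> {2, 3}" and ij: "i \<in> {1..n}" "j \<in> {1..n}" "i \<noteq> j"
    and xy: "x \<in> comp (chain n) i" "y \<in> comp (chain n) j" "fst x = fst y"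
  shows "i = 1 \<or> j = 1" "Re (fst x) = (center i + center j) / 2" "Im (fst x) = 3/5 \<or> Im (fst x) = - 3/5"
proof -
  define r where "r = Re (fst x)"
  define m where "m = Im (fst x)"
  have eq: "(r - center i)\<^sup>2 + m\<^sup>2 = 1" "(r - center j)\<^sup>2 + m\<^sup>2 = 1"
    using xy unfolding comp_chain r_def m_def by simp_all
  have "(center j - center i) * (2 * r - (center i + center j)) = 0"
    using eq by (simp add: power2_eq_square algebra_simps)
  moreover have "center i \<noteq> center j" using n ij by (auto simp: center_def)
  ultimately have r: "r = (center i + center j) / 2" by simp
  have m: "m\<^sup>2 = 1 - ((center j - center i) / 2)\<^sup>2"
    using eq(1) unfolding r by (simp add: field_simps power2_eq_square)
  show i: "i = 1 \<or> j = 1"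
  proof (rule ccontr)
    assume "\<not> (i = 1 \<or> j = 1)"
    then have "i = 2 \<and> j = 3 \<or> i = 3 \<and> j = 2" using n ij by auto
    then have "m\<^sup>2 < 0" using m by (auto simp: center_def power2_eq_square)
    then show False by simp
  qed
  have "i \<in> {1,2,3}" "j \<in> {1,2,3}" using n ij by auto
  then have "m\<^sup>2 = (3/5)\<^sup>2"
    using m i ij(3) by (auto simp: center_def power2_eq_square)
  then show "Im (fst x) = 3/5 \<or> Im (fst x) = - 3/5"
    unfolding m_def power2_eq_iff by simp
  show "Re (fst x) = (center i + center j) / 2" using r r_def by simp
qed

lemma chain_link: "n \<in> {2, 3} \<Longrightarrow> is_link (chain n)"
  unfolding is_link_def
proof (intro conjI ballI impI)
  assume n: "n \<in> {2, 3}"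
  show "1 \<le> ncomp (chain n)" using n by auto
  show "embedded_circle (strand (chain n) i)" for i by (simp add: chain_def circ_embedded)
  fix i j assume ij: "i \<in> {1..ncomp (chain n)}" "j \<in> {1..ncomp (chain n)}" "i \<noteq> j"
  have False if x: "x \<in> comp (chain n) i" "x \<in> comp (chain n) j" for x
  proof -
    have ij': "i \<in> {1..n}" "j \<in> {1..n}" using ij by simp_all
    note m = chain_meet[OF n ij' ij(3) x refl]
    have "tilt i * Im (fst x) = tilt j * Im (fst x)" using x by (simp add: comp_chain)
    then show False using m(1,3) ij(3) by (auto simp: tilt_def)
  qed
  then show "comp (chain n) i \<inter> comp (chain n) j = {}" by blast
qed

text \<open>The crossing of circle 1 with circle j at imaginary part e. There circle 1 has height 0
  and circle j has height e, so the sign of e decides which one is above.\<close>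

definition node :: "nat \<Rightarrow> real \<Rightarrow> complex" where
  "node j e = Complex (center j / 2) e"

lemma node_comp:
  assumes "j \<in> {2, 3}" "e = 3/5 \<or> e = - 3/5"
  shows "(node j e, 0) \<in> comp (chain n) 1" "(node j e, e) \<in> comp (chain n) j"
proof -
  have "e\<^sup>2 = (3/5)\<^sup>2" unfolding power2_eq_iff using assms(2) by simp
  then have "e * e = 9 / 25" by (simp add: power2_eq_square)
  then show "(node j e, 0) \<in> comp (chain n) 1" "(node j e, e) \<in> comp (chain n) j"
    using assms(1) by (auto simp: comp_chain node_def center_def tilt_def power2_eq_square)
qed

lemma chain_fibre:
  assumes n: "n \<in> {2, 3}" and j: "j \<in> {2..n}" and e: "e = 3/5 \<or> e = - 3/5"
  shows "{x \<in> link_set (chain n). fst x = node j e} = {(node j e, 0), (node j e, e)}"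
proof
  have j3: "j \<in> {2, 3}" using n j by auto
  have "x \<in> {(node j e, 0), (node j e, e)}" if x: "x \<in> link_set (chain n)" "fst x = node j e" for x
  proof -
    obtain i where i: "i \<in> {1..n}" "x \<in> comp (chain n) i" using x(1) by (auto simp: link_set_def)
    then have "snd x = tilt i * e" using x(2) by (simp add: comp_chain node_def)
    then have "snd x = 0 \<or> snd x = e" by (simp add: tilt_def split: if_splits)
    then show ?thesis using x(2) by (metis insertCI prod.collapse)
  qed
  then show "{x \<in> link_set (chain n). fst x = node j e} \<subseteq> {(node j e, 0), (node j e, e)}" by blast
  have "1 \<in> {1..n}" "j \<in> {1..n}" using n j by auto
  then show "{(node j e, 0), (node j e, e)} \<subseteq> {x \<in> link_set (chain n). fst x = node j e}"
    using node_comp[OF j3 e, of n] unfolding link_set_def ncomp_chain by auto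
qed

lemma chain_crossings:
  assumes n: "n \<in> {2, 3}"
  shows "z \<in> crossings (chain n) \<longleftrightarrow> (\<exists>j\<in>{2..n}. \<exists>e. (e = 3/5 \<or> e = - 3/5) \<and> z = node j e)"
proof
  assume "z \<in> crossings (chain n)"
  then obtain x y where xy: "x \<in> link_set (chain n)" "y \<in> link_set (chain n)" "x \<noteq> y" "fst x = z" "fst y = z"
    unfolding crossings_def by blast
  then obtain i j where ij: "i \<in> {1..n}" "x \<in> comp (chain n) i" "j \<in> {1..n}" "y \<in> comp (chain n) j"
    by (auto simp: link_set_def)
  have "i \<noteq> j"
  proof
    assume "i = j"
    then have "x = y" using ij xy by (auto simp: comp_chain intro!: prod_eqI)
    then show False using xy by simp
  qed
  have fst: "fst x = fst y" using xy by simp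
  note m = chain_meet[OF n ij(1,3) \<open>i \<noteq> j\<close> ij(2,4) fst]
  define k where "k = (if i = 1 then j else i)"
  have k: "k \<in> {2..n}" using ij m(1) \<open>i \<noteq> j\<close> by (auto simp: k_def)
  have "Re z = center k / 2" using m(1,2) \<open>i \<noteq> j\<close> xy by (auto simp: k_def center_def)
  then have "z = node k (Im z)" by (simp add: node_def complex_eq_iff)
  then show "\<exists>j\<in>{2..n}. \<exists>e. (e = 3/5 \<or> e = - 3/5) \<and> z = node j e"
    using k m(3) xy(4) by blast
next
  assume "\<exists>j\<in>{2..n}. \<exists>e. (e = 3/5 \<or> e = - 3/5) \<and> z = node j e"
  then obtain j e where j: "j \<in> {2..n}" and e: "e = 3/5 \<or> e = - 3/5" and z: "z = node j e" by blast
  have "(node j e, 0) \<in> link_set (chain n)" "(node j e, e) \<in> link_set (chain n)"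
    using chain_fibre[OF n j e] by blast+
  moreover have "(node j e, 0) \<noteq> (node j e, e)" using e by auto
  ultimately show "z \<in> crossings (chain n)"
    unfolding crossings_def z by force
qed

lemma chain_diagram:
  assumes n: "n \<in> {2, 3}"
  shows "is_diagram (chain n)"
  unfolding is_diagram_def regular_projection_def
proof (intro conjI ballI chain_link n)
  show "piecewise_regular (fst \<circ> strand (chain n) i)" for i by (simp add: chain_def circ_piecewise)
  have "crossings (chain n) \<subseteq> (\<lambda>(j, e). node j e) ` ({2..n} \<times> {3/5, - 3/5})"
  proof
    fix z assume "z \<in> crossings (chain n)"
    then obtain j e where "j \<in> {2..n}" "e = 3/5 \<or> e = - 3/5" "z = node j e"
      using chain_crossings[OF n] by blast
    then show "z \<in> (\<lambda>(j, e). node j e) ` ({2..n} \<times> {3/5, - 3/5})"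
      by (intro image_eqI[of _ _ "(j, e)"]) simp_all
  qed
  then show "finite (crossings (chain n))" by (rule finite_subset) simp
  fix z assume "z \<in> crossings (chain n)"
  then obtain j e where j: "j \<in> {2..n}" and e: "e = 3/5 \<or> e = - 3/5" and z: "z = node j e"
    using chain_crossings[OF n] by blast
  have j3: "j \<in> {2, 3}" and I: "1 \<in> {1..ncomp (chain n)}" "j \<in> {1..ncomp (chain n)}" using n j by auto
  obtain s u where s: "(z, 0) = strand (chain n) 1 s" and u: "(z, e) = strand (chain n) j u"
    using node_comp[OF j3 e, of n] unfolding z Defs.comp_def by blast
  have "((fst \<circ> strand (chain n) 1) has_vector_derivative 2 * pi * \<i> * (z - of_real (center 1))) (at s)"
    using circ_deriv[of "of_real (center 1)" "tilt 1" s] s by (simp add: chain_def) (metis fst_conv)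
  moreover have "((fst \<circ> strand (chain n) j) has_vector_derivative 2 * pi * \<i> * (z - of_real (center j))) (at u)"
    using circ_deriv[of "of_real (center j)" "tilt j" u] u by (simp add: chain_def) (metis fst_conv)
  moreover have "{x \<in> link_set (chain n). fst x = z} = {strand (chain n) 1 s, strand (chain n) j u}"
    using chain_fibre[OF n j e] s u unfolding z by simp
  \<comment> \<open>Velocities are radii turned by a right angle. The two radii differ by the real
    distance of the centres and have imaginary part e, so they are not parallel.\<close>
  moreover have "Im (cnj (2 * pi * \<i> * (z - of_real (center 1))) * (2 * pi * \<i> * (z - of_real (center j)))) \<noteq> 0"
    using j3 e pi_gt_zero unfolding z node_def by (auto simp: center_def)
  ultimately show "\<exists>i\<in>{1..ncomp (chain n)}. \<exists>j\<in>{1..ncomp (chain n)}. \<exists>s u v w.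
      {x \<in> link_set (chain n). fst x = z} = {strand (chain n) i s, strand (chain n) j u} \<and>
      ((fst \<circ> strand (chain n) i) has_vector_derivative v) (at s) \<and>
      ((fst \<circ> strand (chain n) j) has_vector_derivative w) (at u) \<and> Im (cnj v * w) \<noteq> 0"
    using I by blast
qed

locale chain_diagram =
  fixes n :: nat
  assumes n: "n \<in> {2, 3}"
begin

sublocale diagram "chain n"
  by unfold_locales (rule chain_diagram[OF n])

lemma node_crossing: "j \<in> {2..n} \<Longrightarrow> e = 3/5 \<or> e = - 3/5 \<Longrightarrow> node j e \<in> crossings (chain n)"
  using chain_crossings[OF n] by blast

lemma node_points:
  assumes j: "j \<in> {2..n}"
  shows "over_pt (chain n) (node j (3/5)) = (node j (3/5), 3/5)"
    "under_pt (chain n) (node j (3/5)) = (node j (3/5), 0)"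
    "over_pt (chain n) (node j (- 3/5)) = (node j (- 3/5), 0)"
    "under_pt (chain n) (node j (- 3/5)) = (node j (- 3/5), - 3/5)"
proof -
  have *: "{over_pt (chain n) (node j e), under_pt (chain n) (node j e)} = {(node j e, 0), (node j e, e)} \<and>
    snd (under_pt (chain n) (node j e)) < snd (over_pt (chain n) (node j e))" if e: "e = 3/5 \<or> e = - 3/5" for e
    using over_under_set[OF node_crossing[OF j e]] chain_fibre[OF n j e] under_over[OF node_crossing[OF j e]] by simp
  show "over_pt (chain n) (node j (3/5)) = (node j (3/5), 3/5)"
    "under_pt (chain n) (node j (3/5)) = (node j (3/5), 0)"
    using *[of "3/5"] by (auto simp: doubleton_eq_iff)
  show "over_pt (chain n) (node j (- 3/5)) = (node j (- 3/5), 0)"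
    "under_pt (chain n) (node j (- 3/5)) = (node j (- 3/5), - 3/5)"
    using *[of "- 3/5"] by (auto simp: doubleton_eq_iff)
qed

lemma j_comp: "j \<in> {2..n} \<Longrightarrow> j \<in> I" "1 \<in> I" "j \<in> {2..n} \<Longrightarrow> j \<in> {2, 3}"
  using n by auto

lemma node_arcs:
  assumes j: "j \<in> {2..n}"
  shows "arc_comp (chain n) (over_arc (chain n) (node j (3/5))) = j"
    "arc_comp (chain n) (right_arc (chain n) (node j (3/5))) = 1"
    "arc_comp (chain n) (over_arc (chain n) (node j (- 3/5))) = 1"
    "arc_comp (chain n) (right_arc (chain n) (node j (- 3/5))) = j"
proof -
  note z = node_crossing[OF j, of "3/5", simplified] node_crossing[OF j, of "- 3/5", simplified]
  note c = node_comp[OF j_comp(3)[OF j], of "3/5" n, simplified] node_comp[OF j_comp(3)[OF j], of "- 3/5" n, simplified]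
  note p = node_points[OF j, simplified]
  show "arc_comp (chain n) (over_arc (chain n) (node j (3/5))) = j"
    using over_arc_comp[OF z(1) j_comp(1)[OF j]] c(2) p(1) by simp
  show "arc_comp (chain n) (right_arc (chain n) (node j (3/5))) = 1"
    using under_arcs_comp(3)[OF z(1) j_comp(2)] c(1) p(2) by simp
  show "arc_comp (chain n) (over_arc (chain n) (node j (- 3/5))) = 1"
    using over_arc_comp[OF z(2) j_comp(2)] c(3) p(3) by simp
  show "arc_comp (chain n) (right_arc (chain n) (node j (- 3/5))) = j"
    using under_arcs_comp(3)[OF z(2) j_comp(1)[OF j]] c(4) p(4) by simp
qed

lemma under_points: "P = (\<Union>j\<in>{2..n}. {(node j (3/5), 0), (node j (- 3/5), - 3/5)})"
proof -
  have "crossings (chain n) = (\<Union>j\<in>{2..n}. {node j (3/5), node j (- 3/5)})"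
    using chain_crossings[OF n] by blast
  then show ?thesis
    using node_points(2,4) by (simp add: image_UN)
qed

text \<open>An outer circle meets only circle 1 and passes under it only at imaginary part -3/5, so
  it is a single arc.\<close>

lemma single:
  assumes j: "j \<in> {2..n}" and ab: "a \<in> arcs (chain n)" "b \<in> arcs (chain n)" "arc_comp (chain n) a = j" "arc_comp (chain n) b = j"
  shows "a = b"
proof (rule single_arc[OF j_comp(1)[OF j] _ _ _ ab])
  let ?p = "(node j (- 3/5), - 3/5) :: space"
  show "?p \<in> P" using j unfolding under_points by blast
  show "?p \<in> comp (chain n) j" using node_comp(2)[OF j_comp(3)[OF j]] by blast
  fix x assume x: "x \<in> P" "x \<in> comp (chain n) j"
  then obtain k where k: "k \<in> {2..n}" "x = (node k (3/5), 0) \<or> x = (node k (- 3/5), - 3/5)"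
    unfolding under_points by blast
  have "j \<noteq> 1" using j by simp
  then have "x = (node k (- 3/5), - 3/5)"
    using k(2) x(2) by (auto simp: comp_chain tilt_def node_def)
  moreover have "k = j"
    using x(2) j_comp(3)[OF j] j_comp(3)[OF k(1)] unfolding calculation
    by (auto simp: comp_chain node_def center_def power2_eq_square)
  ultimately show "x = ?p" by simp
qed

text \<open>Circle 1 goes under only in its upper half. Its lower half, the parameters between 1/2
  and 1, therefore lies in one arc, which passes over every outer circle.\<close>

lemma low_arc:
  obtains c where "c \<in> arcs (chain n)" "arc_comp (chain n) c = 1"
    "\<forall>j\<in>{2..n}. over_arc (chain n) (node j (- 3/5)) = c"
proof -
  have neg: "Im (fst (strand (chain n) 1 t)) < 0" if t: "1/2 < t" "t < 1" for t
  proof -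
    have "0 < sin (2 * pi * t - pi)"
      using t pi_gt_zero by (intro sin_gt_zero) (auto simp: field_simps)
    then show ?thesis by (simp add: chain_def circ_def sin_diff)
  qed
  have one: "x \<in> comp (chain n) 1 \<Longrightarrow> snd x = 0" for x by (simp add: comp_chain tilt_def)
  have "strand (chain n) 1 t \<notin> P" if t: "1/2 < t" "t < 1" for t
  proof
    assume "strand (chain n) 1 t \<in> P"
    moreover have "snd (strand (chain n) 1 t) = 0" by (rule one) (simp add: Defs.comp_def)
    ultimately have "\<exists>j. strand (chain n) 1 t = (node j (3/5), 0)"
      unfolding under_points by auto
    then show False using neg[OF t] by (auto simp: node_def)
  qed
  then obtain c where c: "c \<in> arcs (chain n)" "strand (chain n) 1 ` {1/2<..<1} \<subseteq> c"
    using interval_arc[OF j_comp(2), of "1/2" 1] by auto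
  have "strand (chain n) 1 (3/4) \<in> c" using c(2) by auto
  then have c1: "arc_comp (chain n) c = 1" by (rule arc_comp_eqI[OF c(1) j_comp(2)])
  have "over_arc (chain n) (node j (- 3/5)) = c" if j: "j \<in> {2..n}" for j
  proof -
    have z: "node j (- 3/5) \<in> crossings (chain n)" using node_crossing[OF j] by blast
    have "(node j (- 3/5), 0) \<in> comp (chain n) 1" using node_comp(1)[OF j_comp(3)[OF j]] by blast
    then obtain s where "(node j (- 3/5), 0) = strand (chain n) 1 s" unfolding Defs.comp_def by blast
    then have s: "(node j (- 3/5), 0) = strand (chain n) 1 (frac s)"
      using strand_of_int[OF j_comp(2), of "frac s" "\<lfloor>s\<rfloor>"] by (simp add: frac_def)
    have f: "0 \<le> frac s" "frac s < 1" by (auto simp: frac_lt_1)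
    have "\<not> frac s \<le> 1/2"
    proof
      assume "frac s \<le> 1/2"
      then have "0 \<le> sin (2 * pi * frac s)"
        using f pi_gt_zero by (intro sin_ge_zero) (auto simp: field_simps)
      moreover have "Im (fst (strand (chain n) 1 (frac s))) = - 3/5" using s by (metis complex.sel(2) fst_conv node_def)
      ultimately show False by (simp add: chain_def circ_def)
    qed
    then have "(node j (- 3/5), 0) \<in> c" using c(2) f unfolding s by auto
    then show ?thesis
      using over_arc_mem[OF z] node_points(3)[OF j] arc_unique[OF _ c(1)] by metis
  qed
  then show ?thesis using that c(1) c1 by blast
qed

lemma crossing_cases:
  assumes "z \<in> crossings (chain n)"
  obtains j where "j \<in> {2..n}" "z = node j (3/5)" | j where "j \<in> {2..n}" "z = node j (- 3/5)"
  using assms chain_crossings[OF n] by blast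

lemma left_eq_right: "j \<in> {2..n} \<Longrightarrow> left_arc (chain n) (node j (- 3/5)) = right_arc (chain n) (node j (- 3/5))"
proof -
  assume j: "j \<in> {2..n}"
  have z: "node j (- 3/5) \<in> crossings (chain n)" using node_crossing[OF j] by blast
  show ?thesis
    by (rule single[OF j left_arc[OF z] right_arc[OF z]]) (use comp_left[OF z] node_arcs(4)[OF j] in simp_all)
qed

text \<open>At the lower crossings an outer circle, being one arc, is equivalent to the arc c above
  it. At the upper crossings the arc above is an outer one, so equivalence to c passes between the
  arcs of circle 1, starting from c itself.\<close>

lemma chain_flat: flat
proof -
  obtain c where c: "c \<in> arcs (chain n)" "arc_comp (chain n) c = 1"
    and low: "\<forall>j\<in>{2..n}. over_arc (chain n) (node j (- 3/5)) = c"
    by (rule low_arc)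
  have other: "eqv c a" if a: "a \<in> arcs (chain n)" "arc_comp (chain n) a = j" and j: "j \<in> {2..n}" for a j
  proof -
    have z: "node j (- 3/5) \<in> crossings (chain n)" using node_crossing[OF j] by blast
    have "eqv c (left_arc (chain n) (node j (- 3/5)))"
      using eqv_same[OF z left_eq_right[OF j, symmetric]] bspec[OF low j] by simp
    moreover have "left_arc (chain n) (node j (- 3/5)) = a"
      by (rule single[OF j left_arc[OF z] a(1)]) (use comp_left[OF z] node_arcs(4)[OF j] a(2) in simp_all)
    ultimately show ?thesis by simp
  qed
  have step: "right_arc (chain n) z \<in> {a. eqv c a} \<longleftrightarrow> left_arc (chain n) z \<in> {a. eqv c a}"
    if z: "z \<in> crossings (chain n)" for z
    using z
  proof (cases rule: crossing_cases)
    case (1 j)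
    have "eqv c (over_arc (chain n) z)"
      using other[OF over_arc(1)[OF z]] node_arcs(1)[OF 1(1)] 1 by simp
    then show ?thesis
      using eqv_right_left[OF z] eqv_trans eqv_sym by blast
  next
    case (2 j)
    then show ?thesis using left_eq_right by simp
  qed
  have all: "eqv c a" if a: "a \<in> arcs (chain n)" for a
  proof (cases "arc_comp (chain n) a = 1")
    case True
    have "a \<in> {a. eqv c a}"
      by (rule conn[OF step _ c(1) a]) (use c True eqv_refl in simp_all)
    then show ?thesis by simp
  next
    case False
    then have "arc_comp (chain n) a \<in> {2..n}" using arc_comp[OF a] by auto
    then show ?thesis using other[OF a refl] by blast
  qed
  show ?thesis
    unfolding flat_def using all eqv_sym eqv_trans unfolding eqv_def by blast
qed

end

section \<open>The Hopf link against the chain of three circles\<close>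

interpretation hopf: chain_diagram 2
  by unfold_locales simp

interpretation chain3: chain_diagram 3
  by unfold_locales simp

text \<open>The Hopf diagram has two arcs, one for each circle. The relation at the lower crossing
  is (t_2 - 1) c = (t_1 - 1) b, exactly what \<open>tri_trivial\<close> asks for.\<close>

lemma hopf_trivial:
  assumes "X \<in> carrier (total_quandle (chain 2))" "Y \<in> carrier (total_quandle (chain 2))"
  shows "tri (total_quandle (chain 2)) X Y = X"
proof (rule hopf.tri_trivial[OF _ assms])
  obtain c where c: "c \<in> arcs (chain 2)" "arc_comp (chain 2) c = 1"
    "\<forall>j\<in>{2..2}. over_arc (chain 2) (node j (- 3/5)) = c"
    by (rule hopf.low_arc)
  \<comment> \<open>With only one outer circle, circle 1 also passes under just once and is a single
    arc.\<close>
  have one: "x = y" if "x \<in> arcs (chain 2)" "y \<in> arcs (chain 2)" "arc_comp (chain 2) x = 1" "arc_comp (chain 2) y = 1" for x y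
  proof (rule hopf.single_arc[OF hopf.j_comp(2) _ _ _ that])
    have two: "(2::nat) \<in> {2, 3}" by simp
    show "(node 2 (3/5), 0) \<in> hopf.P" unfolding hopf.under_points by simp
    show "(node 2 (3/5), 0) \<in> comp (chain 2) 1" by (rule node_comp[OF two]) simp
    show "x = (node 2 (3/5), 0)" if "x \<in> hopf.P" "x \<in> comp (chain 2) 1" for x
      using that unfolding hopf.under_points by (auto simp: comp_chain tilt_def)
  qed
  let ?z = "node 2 (- 3/5)" and ?b = "right_arc (chain 2) (node 2 (- 3/5))"
  have j: "(2::nat) \<in> {2..2}" by simp
  have z: "?z \<in> crossings (chain 2)" using hopf.node_crossing[OF j] by blast
  have b: "?b \<in> arcs (chain 2)" "arc_comp (chain 2) ?b = 2"
    using hopf.right_arc[OF z] hopf.node_arcs(4)[OF j] by simp_all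
  have rel: "sc (var 2 - 1) (dl c) - sc (var 1 - 1) (dl ?b) \<in> hopf.mul.spn"
  proof -
    have "sc (var 2 - 1) (dl c) - sc (var 1 - 1) (dl ?b) = - hopf.mul.rel ?z"
      using c(2) bspec[OF c(3) j] b(2) hopf.left_eq_right[OF j]
      by (simp add: hopf.mul.rel_def fun_eq_iff fun_apply algebra_simps)
    then show ?thesis using hopf.mul.spn_uminus[OF hopf.mul.rel_spn[OF z]] by simp
  qed
  fix x y assume xy: "x \<in> arcs (chain 2)" "y \<in> arcs (chain 2)"
  have cases: "w = c \<or> w = ?b" if w: "w \<in> arcs (chain 2)" for w
  proof -
    have "arc_comp (chain 2) w = 1 \<or> arc_comp (chain 2) w = 2" using hopf.arc_comp[OF w] by auto
    then show ?thesis using one[OF w c(1)] hopf.single[OF j w b(1)] c(2) b(2) by blast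
  qed
  show "sc (var (arc_comp (chain 2) y) - 1) (dl x) - sc (var (arc_comp (chain 2) x) - 1) (dl y) \<in> hopf.mul.spn"
    using cases[OF xy(1)] cases[OF xy(2)] rel hopf.mul.spn_commute[OF rel] hopf.mul.spn_zero c(2) b(2) by auto
qed

text \<open>Every crossing involves circle 1, so components 2 and 3 never meet at a
  crossing.\<close>

lemma chain3_nontrivial:
  "\<exists>X\<in>carrier (fundamental_quandle (chain 3)). \<exists>Y\<in>carrier (fundamental_quandle (chain 3)).
     tri (total_quandle (chain 3)) X Y \<noteq> X"
proof (rule chain3.tri_nontrivial)
  show "{arc_comp (chain 3) (over_arc (chain 3) z), arc_comp (chain 3) (right_arc (chain 3) z)} \<noteq> {2, 3}"
    if "z \<in> crossings (chain 3)" for z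
    using that
  proof (cases rule: chain3.crossing_cases)
    case (1 j)
    then show ?thesis using chain3.node_arcs(2)[OF 1(1)] by (auto simp: doubleton_eq_iff)
  next
    case (2 j)
    then show ?thesis using chain3.node_arcs(3)[OF 2(1)] by (auto simp: doubleton_eq_iff)
  qed
qed simp

lemma hopf_chain_same:
  "same_standard_module (chain 2) (chain 3)" "same_standard_invariant (chain 2) (chain 3)"
proof -
  interpret diagram_pair "chain 2" "chain 3" by unfold_locales
  obtain a b where ab: "a \<in> arcs (chain 2)" "arc_comp (chain 2) a = 1" "b \<in> arcs (chain 2)" "arc_comp (chain 2) b = 2"
    using hopf.comp_arc[of 1] hopf.comp_arc[of 2] by auto
  obtain a' b' where ab': "a' \<in> arcs (chain 3)" "arc_comp (chain 3) a' = 1" "b' \<in> arcs (chain 3)" "arc_comp (chain 3) b' = 2"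
    using chain3.comp_arc[of 1] chain3.comp_arc[of 2] by auto
  show "same_standard_module (chain 2) (chain 3)" "same_standard_invariant (chain 2) (chain 3)"
    using flat_same[OF hopf.chain_flat chain3.chain_flat ab(1,3) _ ab'(1,3)] ab ab' by simp_all
qed

lemma hopf_chain_total: "\<not> quandles_isomorphic (total_quandle (chain 2)) (total_quandle (chain 3))"
proof -
  obtain X Y where XY: "X \<in> carrier (fundamental_quandle (chain 3))" "Y \<in> carrier (fundamental_quandle (chain 3))"
    "tri (total_quandle (chain 3)) X Y \<noteq> X"
    using chain3_nontrivial by blast
  show ?thesis
    by (rule not_quandles_isomorphic[OF hopf_trivial subsetD[OF chain3.Q_total XY(1)] subsetD[OF chain3.Q_total XY(2)] XY(3)])
qed

lemma hopf_chain_fundamental: "\<not> same_fundamental (chain 2) (chain 3)"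
proof -
  obtain X Y where XY: "X \<in> carrier (fundamental_quandle (chain 3))" "Y \<in> carrier (fundamental_quandle (chain 3))"
    "tri (fundamental_quandle (chain 3)) X Y \<noteq> X"
    using chain3_nontrivial unfolding chain3.fundamental_simps by blast
  have triv: "tri (fundamental_quandle (chain 2)) X Y = X"
    if "X \<in> carrier (fundamental_quandle (chain 2))" "Y \<in> carrier (fundamental_quandle (chain 2))" for X Y
    unfolding hopf.fundamental_simps
    by (rule hopf_trivial[OF subsetD[OF hopf.Q_total that(1)] subsetD[OF hopf.Q_total that(2)]])
  show ?thesis
    unfolding same_fundamental_def by (rule not_quandles_isomorphic[OF triv XY])
qed

lemma multivariate_same:
  assumes "is_diagram L" "is_diagram L'" "same_fundamental L L' \<or> same_total L L'"
  shows "same_standard_module L L'" "same_standard_invariant L L'"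
proof -
  interpret A: diagram L by unfold_locales (rule assms(1))
  interpret B: diagram L' by unfold_locales (rule assms(2))
  interpret diagram_pair L L' by unfold_locales
  show "same_standard_module L L'" "same_standard_invariant L L'"
    using assms(3) fundamental_same total_same by blast+
qed

lemma hopf_chain_not_same_total: "\<not> same_total (chain 2) (chain 3)"
  using hopf_chain_total unfolding same_total_def quandles_isomorphic_def by blast

theorem corollary12:
  shows "strictly_stronger same_fundamental same_standard_invariant \<and>
         strictly_stronger same_fundamental same_standard_module \<and>
         strictly_stronger same_total same_standard_invariant \<and>
         strictly_stronger same_total same_standard_module \<and>
         (\<exists>L L'. is_diagram L \<and> is_diagram L' \<and>
            same_standard_invariant L L' \<and> same_standard_module L L' \<and>
            \<not> quandles_isomorphic (total_quandle L) (total_quandle L'))"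
proof -
  have d: "is_diagram (chain 2)" "is_diagram (chain 3)"
    by (rule chain_diagram, simp)+
  have stronger: "strictly_stronger P Q"
    if "\<And>L L'. is_diagram L \<Longrightarrow> is_diagram L' \<Longrightarrow> P L L' \<Longrightarrow> Q L L'"
      "Q (chain 2) (chain 3)" "\<not> P (chain 2) (chain 3)" for P Q
    unfolding strictly_stronger_def using that d by blast
  show ?thesis
    by (intro conjI stronger exI[of _ "chain 2"] exI[of _ "chain 3"] d hopf_chain_same hopf_chain_total
        hopf_chain_fundamental hopf_chain_not_same_total)
      (blast intro: multivariate_same)+
qed

end
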